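(* Suppose $\mathcal{H}$ is a hereditary $3$-graph property and $\text{Trip}(\mathcal{H})$ contains $k\otimes U(k)$ for all $k\geq 1$. Then for some $K,K'>0$, $Tw(\epsilon^{-K})\leq M_{\mathcal{H}}(\epsilon)\leq Tw(\epsilon^{-K'})$ for all sufficiently small $\epsilon>0$.
   Context: $3$-graphs are $H=(V,E)$ with $E\subseteq\binom V3$; a hereditary $3$-graph property is a class of finite $3$-graphs closed under isomorphism and induced sub-$3$-graphs. $d_H(X,Y,Z)=|\{(x,y,z)\in X\times Y\times Z:\{x,y,z\}\in E\}|/(|X||Y||Z|)$. A triple $(X,Y,Z)$ is $\epsilon$-regular if $|d_H(X,Y,Z)-d_H(X',Y',Z')|\le\epsilon$ for all $X'\subseteq X,Y'\subseteq Y,Z'\subseteq Z$ of sizes at least $\epsilon|X|,\epsilon|Y|,\epsilon|Z|$; a partition $\mathcal P$ of $V$ is $\epsilon$-regular if at least $(1-\epsilon)|V|^3$ triples of $V^3$ lie in some $\epsilon$-regular $X\times Y\times Z$ with $(X,Y,Z)\in\mathcal P^3$. $M_{\mathcal H}(\epsilon)$ is the least $M$ such that all sufficiently large members of $\mathcal H$ have $\epsilon$-regular partitions with at most $M$ parts. $Tw(1)=1$, $Tw(i)=2^{Tw(i-1)}$. For a $3$-graph $H=(V,E)$, $\text{Trip}(H)$ has vertex set $\{x_v\}\cup\{y_v\}\cup\{z_v\}$ ($v\in V$) and edges $x_vy_{v'}z_{v''}$ for $vv'v''\in E$; $\text{Trip}(\mathcal H)$ is the closure of $\{\text{Trip}(H):H\in\mathcal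 H\}$ under isomorphism and induced sub-$3$-graphs. $U(k)$ is the bipartite graph with parts $\{a_1,\dots,a_k\}$ and $\{b_S:S\subseteq[k]\}$ and edges $a_ib_S$ for $i\in S$. For a bipartite graph $G=(U\cup V,E)$ and $n\ge1$, $n\otimes G$ is the $3$-graph with vertex set $U\cup V\cup\{c_1,\dots,c_n\}$ ($c_i$ new) and edges $\{c_i,u,w\}$ for $i\in[n]$, $uw\in E$. *)

theory Defs
  imports Complex_Main "HOL-Library.Disjoint_Sets"
begin

type_synonym 'a hgraph = "'a set \<times> 'a set set"

definition is_3graph :: "'a hgraph \<Rightarrow> bool" where
  "is_3graph H \<longleftrightarrow> finite (fst H) \<and> (\<forall>e\<in>snd H. e \<subseteq> fst H \<and> card e = 3)"

definition hg_iso :: "'a hgraph \<Rightarrow> 'b hgraph \<Rightarrow> bool" where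
  "hg_iso H H' \<longleftrightarrow> (\<exists>f. bij_betw f (fst H) (fst H') \<and>
      (\<forall>e. e \<subseteq> fst H \<longrightarrow> (e \<in> snd H \<longleftrightarrow> f ` e \<in> snd H')))"

definition induced :: "'a hgraph \<Rightarrow> 'a set \<Rightarrow> 'a hgraph" where
  "induced H S = (S, {e \<in> snd H. e \<subseteq> S})"

text \<open>A hereditary 3-graph property; vertex sets are taken inside nat
  (every finite 3-graph is isomorphic to one of these).\<close>
definition hereditary :: "nat hgraph set \<Rightarrow> bool" where
  "hereditary \<H> \<longleftrightarrow>
     (\<forall>H\<in>\<H>. is_3graph H) \<and>
     (\<forall>H\<in>\<H>. \<forall>H'. is_3graph H' \<and> hg_iso H H' \<longrightarrow> H' \<in> \<H>) \<and>
     (\<forall>H\<in>\<H>. \<forall>S. S \<subseteq> fst H \<longrightarrow> induced H S \<in> \<H>)"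

definition density :: "'a hgraph \<Rightarrow> 'a set \<Rightarrow> 'a set \<Rightarrow> 'a set \<Rightarrow> real" where
  "density H X Y Z =
     real (card {(x,y,z). x \<in> X \<and> y \<in> Y \<and> z \<in> Z \<and> {x,y,z} \<in> snd H})
     / (real (card X) * real (card Y) * real (card Z))"

definition eps_regular_triple :: "real \<Rightarrow> 'a hgraph \<Rightarrow> 'a set \<Rightarrow> 'a set \<Rightarrow> 'a set \<Rightarrow> bool" where
  "eps_regular_triple \<epsilon> H X Y Z \<longleftrightarrow>
     (\<forall>X' Y' Z'. X' \<subseteq> X \<and> Y' \<subseteq> Y \<and> Z' \<subseteq> Z \<and>
        real (card X') \<ge> \<epsilon> * real (card X) \<and> real (card Y') \<ge> \<epsilon> * real (card Y) \<and>
        real (card Z') \<ge> \<epsilon> * real (card Z) \<longrightarrow>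
        \<bar>density H X Y Z - density H X' Y' Z'\<bar> \<le> \<epsilon>)"

definition is_partition :: "'a set set \<Rightarrow> 'a set \<Rightarrow> bool" where
  "is_partition P V \<longleftrightarrow> (\<forall>X\<in>P. X \<noteq> {}) \<and> \<Union>P = V \<and> disjoint P"

definition eps_regular_partition :: "real \<Rightarrow> 'a hgraph \<Rightarrow> 'a set set \<Rightarrow> bool" where
  "eps_regular_partition \<epsilon> H P \<longleftrightarrow> is_partition P (fst H) \<and>
     real (card {(x,y,z). x \<in> fst H \<and> y \<in> fst H \<and> z \<in> fst H \<and>
        (\<exists>X\<in>P. \<exists>Y\<in>P. \<exists>Z\<in>P. x \<in> X \<and> y \<in> Y \<and> z \<in> Z \<and> eps_regular_triple \<epsilon> H X Y Z)})
     \<ge> (1 - \<epsilon>) * real (card (fst H)) ^ 3"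

definition M_reg :: "nat hgraph set \<Rightarrow> real \<Rightarrow> nat" where
  "M_reg \<H> \<epsilon> = (LEAST M. \<exists>N. \<forall>H\<in>\<H>. card (fst H) \<ge> N \<longrightarrow>
       (\<exists>P. eps_regular_partition \<epsilon> H P \<and> card P \<le> M))"

fun Tw :: "nat \<Rightarrow> nat" where
  "Tw 0 = 1"
| "Tw (Suc 0) = 1"
| "Tw (Suc (Suc n)) = 2 ^ Tw (Suc n)"

definition Trip :: "'a hgraph \<Rightarrow> (nat \<times> 'a) hgraph" where
  "Trip H = ({(i, v). i < 3 \<and> v \<in> fst H},
     {{(0, v), (1, v'), (2, v'')} | v v' v''. {v, v', v''} \<in> snd H})"

text \<open>G is (up to isomorphism) a member of Trip(\<H>), the closure of
  {Trip H : H in \<H>} under isomorphism and induced sub-3-graphs.\<close>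
definition in_Trip_class :: "nat hgraph set \<Rightarrow> 'b hgraph \<Rightarrow> bool" where
  "in_Trip_class \<H> G \<longleftrightarrow>
     (\<exists>H\<in>\<H>. \<exists>S. S \<subseteq> fst (Trip H) \<and> hg_iso (induced (Trip H) S) G)"

definition U_graph :: "nat \<Rightarrow> (nat + nat set) set \<times> (nat + nat set) set \<times> ((nat + nat set) \<times> (nat + nat set)) set" where
  "U_graph k = (Inl ` {1..k}, Inr ` Pow {1..k},
     {(Inl i, Inr S) | i S. i \<in> {1..k} \<and> S \<subseteq> {1..k} \<and> i \<in> S})"

definition tensor :: "nat \<Rightarrow> 'a set \<times> 'a set \<times> ('a \<times> 'a) set \<Rightarrow> ('a + nat) hgraph" where
  "tensor n G = (case G of (U, W, E) \<Rightarrow>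
     (Inl ` (U \<union> W) \<union> Inr ` {1..n},
      {{Inr i, Inl u, Inl w} | i u w. i \<in> {1..n} \<and> (u, w) \<in> E}))"

end

theory Submission
  imports Defs "HOL-Library.FuncSet"
begin

text \<open>The upper bound is the usual energy increment: if a partition is not regular, refining it by the
  witness sets lowers the squared distance of the edge indicator from its box averages by
  \<open>\<epsilon>^6 |V|^3\<close>, at the cost of an exponential in the number of parts.

  For the lower bound, the hypothesis puts \<open>C \<otimes> G\<close> into \<open>\<H>\<close> for every bipartite graph \<open>G\<close>, on vertex
  classes of any size, up to edges inside \<open>A \<union> B\<close>, \<open>B \<union> C\<close> and \<open>A \<union> C\<close>. Averaging over \<open>C\<close> turns a regular
  partition of the 3-graph into one of \<open>G\<close>, so Gowers' lower bound for graphs applies. It is proved in the style of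
  Moshkovitz and Shapira: \<open>A\<close> and \<open>B\<close> carry nested partitions, each exponentially finer than the one before.
  At level \<open>r\<close> every pair of cells \<open>(i, j)\<close> is split into halves by codewords, and
  \<open>g_lev r\<close> is \<open>1\<close> or \<open>-1\<close> according to whether the halves agree. \<open>G\<close> has edge density proportional to
  \<open>s + (\<Sum>r<s. g_lev r)\<close>. If a part of a regular partition lies mostly in one level-\<open>r\<close> cell, then testing it
  against the halves of the cells on the other side, where all other levels cancel, forces it to lie mostly
  in one level-\<open>(r+1)\<close> cell. So after \<open>s\<close> steps there are at least half as many parts as cells of level \<open>s\<close>.\<close>

subsection \<open>Regular partitions of tower size\<close>

text \<open>The obstacle in the lower bound is that a regular partition need not refine any of the
  nested partitions; it can only be compared with them on average. Progress is therefore measured by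
  summing, over all parts, the size of the largest intersection with a level-\<open>r\<close> cell.
  Passing to the next level lowers this sum only by an additive error. Two devices keep that error
  independent of the number of cells. A cell on the other side is tested only against the parts
  whose own majority lies in it, so each regularity error is spent on one cell. The points lost by
  this restriction are few as long as the other side is already aligned, which is why both sides
  advance together. The number \<open>s\<close> of levels is limited by the size of
  \<open>s ^ 3 * \<epsilon>\<close>: one factor \<open>s\<close> comes from rescaling densities to
  \<open>h_sum\<close>, one from the bound \<open>s\<close> on \<open>h_sum\<close> at lost points,
  and one from the accumulation over levels. With \<open>s\<close> of order
  \<open>\<epsilon> powr (-(1/4))\<close> this product still tends to \<open>0\<close>.\<close>

definition mean :: "('a \<Rightarrow> real) \<Rightarrow> 'a set \<Rightarrow> real" where
  "mean f S = sum f S / real (card S)"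

definition edge_ind :: "'a hgraph \<Rightarrow> 'a \<times> 'a \<times> 'a \<Rightarrow> real" where
  "edge_ind H = (\<lambda>(x, y, z). of_bool ({x, y, z} \<in> snd H))"

lemma edge_ind_bounds: "0 \<le> edge_ind H t" "edge_ind H t \<le> 1"
  by (auto simp: edge_ind_def split: prod.split)

lemma card_edges_eq_sum:
  assumes "finite X" "finite Y" "finite Z"
  shows "real (card {(x,y,z). x \<in> X \<and> y \<in> Y \<and> z \<in> Z \<and> {x,y,z} \<in> snd H})
           = sum (edge_ind H) (X \<times> Y \<times> Z)"
proof -
  have "sum (edge_ind H) (X \<times> Y \<times> Z)
      = (\<Sum>t\<in>X \<times> Y \<times> Z. if t \<in> {(x,y,z). {x,y,z} \<in> snd H} then 1 else 0)"
    by (intro sum.cong) (auto simp: edge_ind_def)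
  also have "\<dots> = real (card (X \<times> Y \<times> Z \<inter> {(x,y,z). {x,y,z} \<in> snd H}))"
    using assms by (subst sum.inter_restrict [symmetric]) auto
  also have "X \<times> Y \<times> Z \<inter> {(x,y,z). {x,y,z} \<in> snd H}
      = {(x,y,z). x \<in> X \<and> y \<in> Y \<and> z \<in> Z \<and> {x,y,z} \<in> snd H}" by auto
  finally show ?thesis by simp
qed

lemma density_eq_mean:
  assumes "finite X" "finite Y" "finite Z"
  shows "density H X Y Z = mean (edge_ind H) (X \<times> Y \<times> Z)"
  unfolding density_def mean_def card_edges_eq_sum [OF assms] by (simp add: card_cartesian_product)

text \<open>The parallel axis identity. It makes the mean the best constant approximation on a cell,
  and with \<open>c = 0\<close> it gives Cauchy-Schwarz in \<open>square_sum_le\<close>.\<close>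

lemma sum_sq_diff_const:
  assumes "finite S"
  shows "(\<Sum>t\<in>S. (f t - c)\<^sup>2) = (\<Sum>t\<in>S. (f t - mean f S)\<^sup>2) + real (card S) * (mean f S - c)\<^sup>2"
proof (cases "S = {}")
  case False
  then have "sum f S = mean f S * real (card S)" using assms by (simp add: mean_def)
  then show ?thesis
    by (simp add: power2_diff sum.distrib sum_subtractf flip: sum_distrib_left sum_distrib_right)
       (simp add: algebra_simps power2_eq_square)
qed (simp add: mean_def)

lemma sum_over_cells:
  fixes \<phi> :: "'a \<Rightarrow> real"
  assumes "finite \<Omega>" and "\<And>t. t \<in> \<Omega> \<Longrightarrow> t \<in> B t \<and> B t \<subseteq> \<Omega>"
    and "\<And>t u. t \<in> \<Omega> \<Longrightarrow> u \<in> B t \<Longrightarrow> B u = B t"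
  shows "sum \<phi> \<Omega> = (\<Sum>C\<in>B ` \<Omega>. sum \<phi> C)"
proof -
  have "sum \<phi> \<Omega> = (\<Sum>C\<in>B ` \<Omega>. sum \<phi> {t \<in> \<Omega>. B t = C})"
    using assms(1) by (rule sum.image_gen)
  also have "\<dots> = (\<Sum>C\<in>B ` \<Omega>. sum \<phi> C)"
  proof (rule sum.cong [OF refl])
    fix C assume "C \<in> B ` \<Omega>"
    then have "{t \<in> \<Omega>. B t = C} = C" using assms(2,3) by blast
    then show "sum \<phi> {t \<in> \<Omega>. B t = C} = sum \<phi> C" by simp
  qed
  finally show ?thesis .
qed

text \<open>On each cell the mean beats every other constant. So the averages over a new partition
  never have to be computed: any test function constant on its cells bounds the residual from
  above.\<close>

lemma mean_minimises_residual:
  fixes f g :: "'a \<Rightarrow> real"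
  assumes "finite \<Omega>" and "\<And>t. t \<in> \<Omega> \<Longrightarrow> t \<in> B t \<and> B t \<subseteq> \<Omega>"
    and "\<And>t u. t \<in> \<Omega> \<Longrightarrow> u \<in> B t \<Longrightarrow> B u = B t"
    and "\<And>t u. t \<in> \<Omega> \<Longrightarrow> u \<in> B t \<Longrightarrow> g u = g t"
  shows "(\<Sum>t\<in>\<Omega>. (f t - mean f (B t))\<^sup>2) \<le> (\<Sum>t\<in>\<Omega>. (f t - g t)\<^sup>2)"
proof -
  have "(\<Sum>t\<in>C. (f t - mean f (B t))\<^sup>2) \<le> (\<Sum>t\<in>C. (f t - g t)\<^sup>2)" if C: "C \<in> B ` \<Omega>" for C
  proof -
    obtain u where u: "u \<in> \<Omega>" "C = B u" using C by blast
    then have fin: "finite C" using assms(1,2) finite_subset by metis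
    have "(\<Sum>t\<in>C. (f t - mean f (B t))\<^sup>2) = (\<Sum>t\<in>C. (f t - mean f C)\<^sup>2)"
      using u assms(3) by (intro sum.cong) auto
    also have "\<dots> \<le> (\<Sum>t\<in>C. (f t - g u)\<^sup>2)"
      unfolding sum_sq_diff_const [OF fin, of f "g u"] by simp
    also have "\<dots> = (\<Sum>t\<in>C. (f t - g t)\<^sup>2)"
      using u assms(4) by (intro sum.cong) auto
    finally show ?thesis .
  qed
  moreover have cells: "sum \<phi> \<Omega> = (\<Sum>C\<in>B ` \<Omega>. sum \<phi> C)" for \<phi> :: "'a \<Rightarrow> real"
    by (rule sum_over_cells) (fact assms)+
  ultimately show ?thesis by (simp only: cells sum_mono)
qed

text \<open>Off \<open>C'\<close> the old mean of \<open>C\<close> is kept in place of the mean of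
  \<open>C - C'\<close>. This is not optimal, but only the terms in \<open>C'\<close> change, so the
  gain is exact.\<close>

lemma residual_drop_on_cell:
  assumes "finite C" "C' \<subseteq> C"
  shows "(\<Sum>t\<in>C. (f t - (if t \<in> C' then mean f C' else mean f C))\<^sup>2)
     = (\<Sum>t\<in>C. (f t - mean f C)\<^sup>2) - real (card C') * (mean f C' - mean f C)\<^sup>2"
proof -
  have fin: "finite C'" using assms finite_subset by blast
  have split: "sum \<phi> C = sum \<phi> (C - C') + sum \<phi> C'" for \<phi> :: "'a \<Rightarrow> real"
    using assms by (metis sum.subset_diff)
  have "(\<Sum>t\<in>C. (f t - (if t \<in> C' then mean f C' else mean f C))\<^sup>2)
      = (\<Sum>t\<in>C - C'. (f t - mean f C)\<^sup>2) + (\<Sum>t\<in>C'. (f t - mean f C')\<^sup>2)"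
    unfolding split by (intro arg_cong2 [where f="(+)"] sum.cong) auto
  also have "(\<Sum>t\<in>C'. (f t - mean f C')\<^sup>2)
      = (\<Sum>t\<in>C'. (f t - mean f C)\<^sup>2) - real (card C') * (mean f C' - mean f C)\<^sup>2"
    using sum_sq_diff_const [OF fin, of f "mean f C"] by simp
  finally show ?thesis unfolding split by simp
qed

definition block :: "'a set set \<Rightarrow> 'a \<Rightarrow> 'a set" where
  "block P x = \<Union>{X \<in> P. x \<in> X}"

definition box :: "'a set set \<Rightarrow> 'a \<times> 'a \<times> 'a \<Rightarrow> ('a \<times> 'a \<times> 'a) set" where
  "box P = (\<lambda>(x, y, z). block P x \<times> block P y \<times> block P z)"

lemma block_eq:
  assumes "is_partition P V" "X \<in> P" "x \<in> X"
  shows "block P x = X"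
proof -
  have "Y = X" if "Y \<in> P" "x \<in> Y" for Y
    using assms that unfolding is_partition_def disjoint_def by blast
  then show ?thesis using assms(2,3) unfolding block_def by blast
qed

lemma block_props:
  assumes "is_partition P V" "x \<in> V"
  shows "block P x \<in> P" "x \<in> block P x" "block P x \<subseteq> V" "\<And>y. y \<in> block P x \<Longrightarrow> block P y = block P x"
proof -
  obtain X where X: "X \<in> P" "x \<in> X" using assms unfolding is_partition_def by blast
  have e: "block P x = X" using block_eq [OF assms(1) X] .
  show "block P x \<in> P" "x \<in> block P x" using e X by auto
  show "block P x \<subseteq> V" using e X assms unfolding is_partition_def by blast
  show "\<And>y. y \<in> block P x \<Longrightarrow> block P y = block P x" using e X block_eq [OF assms(1)] by auto
qed

lemma box_props:
  assumes "is_partition P V" "t \<in> V \<times> V \<times> V"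
  shows "t \<in> box P t \<and> box P t \<subseteq> V \<times> V \<times> V" "\<And>u. u \<in> box P t \<Longrightarrow> box P u = box P t"
proof -
  obtain x y z where t: "t = (x, y, z)" "x \<in> V" "y \<in> V" "z \<in> V" using assms(2) by auto
  note b = block_props [OF assms(1) t(2)] block_props [OF assms(1) t(3)] block_props [OF assms(1) t(4)]
  show "t \<in> box P t \<and> box P t \<subseteq> V \<times> V \<times> V" using b(2,3,6,7,10,11) unfolding box_def t(1) by auto
  show "box P u = box P t" if u: "u \<in> box P t" for u
  proof -
    obtain x' y' z' where u': "u = (x', y', z')" "x' \<in> block P x" "y' \<in> block P y" "z' \<in> block P z"
      using u unfolding box_def t(1) by auto
    show ?thesis unfolding u'(1) t(1) box_def prod.case
      using b(4) [OF u'(2)] b(8) [OF u'(3)] b(12) [OF u'(4)] by (simp only:)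
  qed
qed

text \<open>The cells of the Venn diagram of \<open>\<S>\<close>, taken as an image of
  \<open>V\<close> so that all of them are nonempty, as \<open>is_partition\<close> demands.\<close>

definition atoms :: "'a set \<Rightarrow> 'a set set \<Rightarrow> 'a set set" where
  "atoms V \<S> = (\<lambda>x. {y \<in> V. \<forall>S\<in>\<S>. y \<in> S \<longleftrightarrow> x \<in> S}) ` V"

lemma is_partition_atoms: "is_partition (atoms V \<S>) V"
  unfolding is_partition_def atoms_def disjoint_def by fastforce

lemma block_atoms: "x \<in> V \<Longrightarrow> block (atoms V \<S>) x = {y \<in> V. \<forall>S\<in>\<S>. y \<in> S \<longleftrightarrow> x \<in> S}"
  by (rule block_eq [OF is_partition_atoms]) (auto simp: atoms_def)

lemma card_atoms_le:
  assumes "finite \<S>"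
  shows "card (atoms V \<S>) \<le> 2 ^ card \<S>"
proof -
  have "atoms V \<S> \<subseteq> (\<lambda>R. {y \<in> V. \<forall>S\<in>\<S>. y \<in> S \<longleftrightarrow> S \<in> R}) ` Pow \<S>"
  proof
    fix X assume "X \<in> atoms V \<S>"
    then obtain x where "X = {y \<in> V. \<forall>S\<in>\<S>. y \<in> S \<longleftrightarrow> x \<in> S}" by (auto simp: atoms_def)
    then have "X = {y \<in> V. \<forall>S\<in>\<S>. y \<in> S \<longleftrightarrow> S \<in> {S\<in>\<S>. x \<in> S}}" by auto
    then show "X \<in> (\<lambda>R. {y \<in> V. \<forall>S\<in>\<S>. y \<in> S \<longleftrightarrow> S \<in> R}) ` Pow \<S>" by blast
  qed
  then have "card (atoms V \<S>) \<le> card (Pow \<S>)"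
    using assms by (meson finite_Pow_iff card_mono card_image_le finite_imageI le_trans)
  then show ?thesis using assms by (simp add: card_Pow)
qed

text \<open>For a partition this is the sum of squares of \<open>edge_ind\<close> minus the usual
  energy. An energy increment appears as a decrease, and nonnegativity ends the iteration.\<close>

definition residual :: "'a hgraph \<Rightarrow> 'a set set \<Rightarrow> real" where
  "residual H P = (\<Sum>t\<in>fst H \<times> fst H \<times> fst H. (edge_ind H t - mean (edge_ind H) (box P t))\<^sup>2)"

lemma residual_le:
  assumes "finite (fst H)" "is_partition P (fst H)"
    and "\<And>t u. t \<in> fst H \<times> fst H \<times> fst H \<Longrightarrow> u \<in> box P t \<Longrightarrow> g u = g t"
  shows "residual H P \<le> (\<Sum>t\<in>fst H \<times> fst H \<times> fst H. (edge_ind H t - g t)\<^sup>2)"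
  unfolding residual_def
  using assms(1) by (intro mean_minimises_residual box_props [OF assms(2)] assms(3)) auto

lemma residual_le_card:
  assumes "finite (fst H)" "is_partition P (fst H)"
  shows "residual H P \<le> real (card (fst H)) ^ 3"
proof -
  have "residual H P \<le> (\<Sum>t\<in>fst H \<times> fst H \<times> fst H. (edge_ind H t - 0)\<^sup>2)"
    using assms by (rule residual_le) auto
  also have "\<dots> \<le> (\<Sum>t\<in>fst H \<times> fst H \<times> fst H. 1)"
    by (intro sum_mono) (simp add: power_le_one edge_ind_bounds)
  also have "\<dots> = real (card (fst H)) ^ 3"
    by (simp add: card_cartesian_product power3_eq_cube)
  finally show ?thesis .
qed

text \<open>Refine by the old parts and by three witness sets for each irregular triple. Per unit
  volume of an irregular box the gain is \<open>\<epsilon> ^ 3\<close> for the relative size of the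
  witness box times \<open>\<epsilon> ^ 2\<close> for the squared density gap. Irregular boxes fill
  at least an \<open>\<epsilon>\<close> fraction of all triples, which supplies the sixth
  factor.\<close>

lemma residual_increment:
  fixes H :: "'a hgraph"
  assumes fin: "finite (fst H)" and P: "is_partition P (fst H)" "card P \<le> p" and \<epsilon>: "\<epsilon> > 0"
    and irr: "\<not> eps_regular_partition \<epsilon> H P"
  shows "\<exists>Q. is_partition Q (fst H) \<and> card Q \<le> 2 ^ (p + 3 * p ^ 3) \<and>
            residual H Q \<le> residual H P - \<epsilon> ^ 6 * real (card (fst H)) ^ 3"
proof -
  define V where "V = fst H"
  define f where "f = edge_ind H"
  define \<Omega> where "\<Omega> = V \<times> V \<times> V"
  define R where "R = {(X, Y, Z). (X, Y, Z) \<in> P \<times> P \<times> P \<and> \<not> eps_regular_triple \<epsilon> H X Y Z}"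
  have finV: "finite V" and finO: "finite \<Omega>" using fin by (auto simp: V_def \<Omega>_def)
  have finP: "finite P" using P(1) finV unfolding is_partition_def V_def
    by (metis finite_UnionD)
  have finX: "finite X" "X \<noteq> {}" "X \<subseteq> V" if "X \<in> P" for X
    using P(1) that finV unfolding is_partition_def V_def by (auto intro: finite_subset)
  define wit where "wit T T' \<longleftrightarrow> (case T of (X, Y, Z) \<Rightarrow> case T' of (X', Y', Z') \<Rightarrow>
      X' \<subseteq> X \<and> Y' \<subseteq> Y \<and> Z' \<subseteq> Z \<and>
      real (card X') \<ge> \<epsilon> * real (card X) \<and> real (card Y') \<ge> \<epsilon> * real (card Y) \<and>
      real (card Z') \<ge> \<epsilon> * real (card Z) \<and>
      \<bar>density H X Y Z - density H X' Y' Z'\<bar> > \<epsilon>)" for T T' :: "'a set \<times> 'a set \<times> 'a set"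
  have "\<exists>T'. wit T T'" if "T \<in> R" for T
  proof -
    obtain X Y Z where T: "T = (X, Y, Z)" by (metis prod.exhaust)
    then have "\<not> eps_regular_triple \<epsilon> H X Y Z" using that by (simp add: R_def)
    then obtain X' Y' Z' where "wit T (X', Y', Z')"
      unfolding eps_regular_triple_def wit_def T prod.case not_all not_imp not_le by blast
    then show ?thesis by blast
  qed
  then obtain \<omega> where \<omega>: "\<And>T. T \<in> R \<Longrightarrow> wit T (\<omega> T)" by metis
  define \<omega>1 where "\<omega>1 T = fst (\<omega> T)" for T
  define \<omega>2 where "\<omega>2 T = fst (snd (\<omega> T))" for T
  define \<omega>3 where "\<omega>3 T = snd (snd (\<omega> T))" for T
  define sub where "sub T = \<omega>1 T \<times> \<omega>2 T \<times> \<omega>3 T" for T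
  define \<S> where "\<S> = P \<union> (\<omega>1 ` R \<union> \<omega>2 ` R \<union> \<omega>3 ` R)"
  define Q where "Q = atoms V \<S>"
  define tri where "tri = (\<lambda>(x, y, z). (block P x, block P y, block P z))"
  have RP: "R \<subseteq> P \<times> P \<times> P" by (auto simp: R_def)
  have finR: "finite R" using RP finP by (meson finite_SigmaI finite_subset)
  have "card R \<le> card P ^ 3"
    using card_mono [OF _ RP] finP by (simp add: card_cartesian_product power3_eq_cube)
  then have cR: "card R \<le> p ^ 3" using P(2) by (meson le_trans power_mono zero_le)
  have finS: "finite \<S>" using finP finR by (auto simp: \<S>_def)
  have "card \<S> \<le> card P + (card (\<omega>1 ` R) + card (\<omega>2 ` R) + card (\<omega>3 ` R))"
    unfolding \<S>_def by (meson card_Un_le add_mono le_refl le_trans)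
  also have "\<dots> \<le> card P + (card R + card R + card R)"
    using finR by (intro add_mono card_image_le) auto
  also have "\<dots> \<le> p + 3 * p ^ 3" using P(2) cR by simp
  finally have cS: "card \<S> \<le> p + 3 * p ^ 3" .
  have cQ: "card Q \<le> 2 ^ (p + 3 * p ^ 3)"
    unfolding Q_def by (rule le_trans [OF card_atoms_le [OF finS] power_increasing [OF cS]]) simp
  have Qpart: "is_partition Q (fst H)" unfolding Q_def V_def by (rule is_partition_atoms)
  have tri_P: "tri t \<in> P \<times> P \<times> P" if "t \<in> \<Omega>" for t
    using that block_props(1) [OF P(1)] unfolding \<Omega>_def V_def tri_def by auto
  \<comment> \<open>The test function for \<open>Q\<close>. It is constant on boxes of
    \<open>Q\<close> because these do not cross old parts or witness sets, and on an irregular box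
    it takes the two values of \<open>residual_drop_on_cell\<close>.\<close>
  define g where "g t = (if tri t \<in> R \<and> t \<in> sub (tri t) then mean f (sub (tri t)) else mean f (box P t))" for t
  have gQ: "g u = g t" if t: "t \<in> \<Omega>" and u: "u \<in> box Q t" for t u
  proof -
    obtain x y z x' y' z' where tu: "t = (x,y,z)" "u = (x',y',z')" by (metis prod.exhaust)
    have V: "x \<in> V" "y \<in> V" "z \<in> V" using t tu by (auto simp: \<Omega>_def)
    have V': "x' \<in> V" "y' \<in> V" "z' \<in> V"
      and sx: "\<And>S. S \<in> \<S> \<Longrightarrow> x' \<in> S \<longleftrightarrow> x \<in> S"
      and sy: "\<And>S. S \<in> \<S> \<Longrightarrow> y' \<in> S \<longleftrightarrow> y \<in> S"
      and sz: "\<And>S. S \<in> \<S> \<Longrightarrow> z' \<in> S \<longleftrightarrow> z \<in> S"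
      using u V by (auto simp: tu box_def Q_def block_atoms)
    have bl: "block P x' = block P x" "block P y' = block P y" "block P z' = block P z"
      using sx sy sz unfolding block_def \<S>_def by blast+
    then have tri: "tri u = tri t" "box P u = box P t" by (auto simp: tri_def tu box_def)
    moreover have "u \<in> sub (tri t) \<longleftrightarrow> t \<in> sub (tri t)" if "tri t \<in> R"
    proof -
      have "\<omega>1 (tri t) \<in> \<S>" "\<omega>2 (tri t) \<in> \<S>" "\<omega>3 (tri t) \<in> \<S>" using that by (auto simp: \<S>_def)
      then show ?thesis using sx sy sz by (auto simp: sub_def tu)
    qed
    ultimately show ?thesis by (auto simp: g_def)
  qed
  have bx: "\<And>t. t \<in> \<Omega> \<Longrightarrow> t \<in> box P t \<and> box P t \<subseteq> \<Omega>" "\<And>t u. t \<in> \<Omega> \<Longrightarrow> u \<in> box P t \<Longrightarrow> box P u = box P t"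
    using box_props [OF P(1)] unfolding \<Omega>_def V_def by blast+
  have cells: "sum \<phi> \<Omega> = (\<Sum>C\<in>box P ` \<Omega>. sum \<phi> C)" for \<phi> :: "'a \<times> 'a \<times> 'a \<Rightarrow> real"
    by (rule sum_over_cells) (fact finO bx)+
  define Ir where "Ir = {t \<in> \<Omega>. tri t \<in> R}"
  have tri_box: "tri u = tri t" if "t \<in> \<Omega>" "u \<in> box P t" for t u
  proof -
    obtain x y z x' y' z' where tu: "t = (x,y,z)" "u = (x',y',z')" by (metis prod.exhaust)
    have "x \<in> fst H" "y \<in> fst H" "z \<in> fst H" using that tu by (auto simp: \<Omega>_def V_def)
    moreover have "x' \<in> block P x" "y' \<in> block P y" "z' \<in> block P z" using that tu by (auto simp: box_def)
    ultimately show ?thesis unfolding tu tri_def prod.case by (metis block_props(4) [OF P(1)])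
  qed
  have cell: "(\<Sum>t\<in>C. (f t - g t)\<^sup>2) \<le> (\<Sum>t\<in>C. (f t - mean f (box P t))\<^sup>2 - \<epsilon> ^ 5 * of_bool (tri t \<in> R))"
    if C: "C \<in> box P ` \<Omega>" for C
  proof -
    obtain u where u: "u \<in> \<Omega>" "C = box P u" using C by blast
    have finC: "finite C" using u bx finO finite_subset by metis
    have same: "tri t = tri u" "box P t = C" if "t \<in> C" for t
      using that tri_box [OF u(1)] bx(2) [OF u(1)] unfolding u(2) by blast+
    show ?thesis
    proof (cases "tri u \<in> R")
      case False
      then show ?thesis by (intro sum_mono) (simp add: g_def same)
    next
      case True
      obtain X Y Z where T: "tri u = (X, Y, Z)" by (metis prod.exhaust)
      have XP: "X \<in> P" "Y \<in> P" "Z \<in> P" using tri_P [OF u(1)] T by auto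
      have CX: "C = X \<times> Y \<times> Z" using T unfolding u(2) tri_def box_def by (auto split: prod.splits)
      define X' where "X' = \<omega>1 (tri u)"
      define Y' where "Y' = \<omega>2 (tri u)"
      define Z' where "Z' = \<omega>3 (tri u)"
      define C' where "C' = X' \<times> Y' \<times> Z'"
      have subC: "sub (tri u) = C'" by (simp add: sub_def C'_def X'_def Y'_def Z'_def)
      have w: "X' \<subseteq> X" "Y' \<subseteq> Y" "Z' \<subseteq> Z" "real (card X') \<ge> \<epsilon> * real (card X)"
          "real (card Y') \<ge> \<epsilon> * real (card Y)" "real (card Z') \<ge> \<epsilon> * real (card Z)"
          "\<bar>density H X Y Z - density H X' Y' Z'\<bar> > \<epsilon>"
        using \<omega> [OF True] by (auto simp: wit_def T X'_def Y'_def Z'_def \<omega>1_def \<omega>2_def \<omega>3_def split: prod.splits)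
      have C'C: "C' \<subseteq> C" using w by (auto simp: CX C'_def)
      have fX: "finite X" "finite Y" "finite Z" "finite X'" "finite Y'" "finite Z'"
        using XP finX w(1-3) finite_subset by metis+
      have d: "\<bar>mean f C - mean f C'\<bar> > \<epsilon>"
        using w(7) by (simp add: density_eq_mean fX CX C'_def f_def)
      have "\<epsilon> * real (card X) * (\<epsilon> * real (card Y)) * (\<epsilon> * real (card Z)) \<le> real (card X') * real (card Y') * real (card Z')"
        using w(4-6) \<epsilon> by (intro mult_mono) auto
      then have cc: "\<epsilon> ^ 3 * real (card C) \<le> real (card C')"
        by (simp add: CX C'_def card_cartesian_product power3_eq_cube mult_ac)
      have "\<epsilon>\<^sup>2 \<le> (mean f C' - mean f C)\<^sup>2"
        using d \<epsilon> by (subst abs_le_square_iff [symmetric]) auto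
      then have "\<epsilon> ^ 3 * real (card C) * \<epsilon>\<^sup>2 \<le> real (card C') * (mean f C' - mean f C)\<^sup>2"
        using cc \<epsilon> by (intro mult_mono) auto
      moreover have "\<epsilon> ^ 3 * real (card C) * \<epsilon>\<^sup>2 = real (card C) * \<epsilon> ^ 5"
        by (simp add: power_numeral_reduce)
      moreover have "(\<Sum>t\<in>C. (f t - g t)\<^sup>2) = (\<Sum>t\<in>C. (f t - (if t \<in> C' then mean f C' else mean f C))\<^sup>2)"
        by (intro sum.cong) (auto simp: g_def same True subC)
      moreover have "(\<Sum>t\<in>C. (f t - mean f (box P t))\<^sup>2 - \<epsilon> ^ 5 * of_bool (tri t \<in> R))
         = (\<Sum>t\<in>C. (f t - mean f C)\<^sup>2 - \<epsilon> ^ 5)"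
        by (intro sum.cong) (auto simp: same True)
      ultimately show ?thesis
        unfolding residual_drop_on_cell [OF finC C'C] by (simp add: sum_subtractf)
    qed
  qed
  have "residual H Q \<le> (\<Sum>t\<in>\<Omega>. (f t - g t)\<^sup>2)"
    unfolding f_def \<Omega>_def V_def by (rule residual_le [OF fin Qpart]) (use gQ in \<open>auto simp: \<Omega>_def V_def\<close>)
  also have "\<dots> \<le> (\<Sum>t\<in>\<Omega>. (f t - mean f (box P t))\<^sup>2 - \<epsilon> ^ 5 * of_bool (tri t \<in> R))"
    by (simp only: cells sum_mono cell)
  also have "\<dots> = residual H P - \<epsilon> ^ 5 * (\<Sum>t\<in>\<Omega>. of_bool (tri t \<in> R))"
    by (simp add: residual_def f_def \<Omega>_def V_def sum_subtractf sum_distrib_left)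
  also have "(\<Sum>t\<in>\<Omega>. of_bool (tri t \<in> R)) = real (card Ir)"
    using finO by (simp add: Ir_def of_bool_def Int_def flip: sum.inter_filter)
  finally have res: "residual H Q \<le> residual H P - \<epsilon> ^ 5 * real (card Ir)" .
  define Rg where "Rg = {(x,y,z). x \<in> V \<and> y \<in> V \<and> z \<in> V \<and>
        (\<exists>X\<in>P. \<exists>Y\<in>P. \<exists>Z\<in>P. x \<in> X \<and> y \<in> Y \<and> z \<in> Z \<and> eps_regular_triple \<epsilon> H X Y Z)}"
  \<comment> \<open>A triple outside \<open>Ir\<close> lies in the regular box formed by its own
    blocks, so the failure of regularity makes \<open>Ir\<close> large.\<close>
  have "\<Omega> \<subseteq> Rg \<union> Ir"
  proof
    fix t assume t: "t \<in> \<Omega>"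
    obtain x y z where xyz: "t = (x,y,z)" by (metis prod.exhaust)
    show "t \<in> Rg \<union> Ir"
    proof (cases "tri t \<in> R")
      case False
      have V: "x \<in> V" "y \<in> V" "z \<in> V" using t xyz by (auto simp: \<Omega>_def)
      note b = block_props(1,2) [OF P(1), folded V_def]
      have "eps_regular_triple \<epsilon> H (block P x) (block P y) (block P z)"
        using False b V by (auto simp: tri_def R_def xyz)
      then show ?thesis using b V xyz unfolding Rg_def by blast
    qed (use t in \<open>simp add: Ir_def\<close>)
  qed
  moreover have "finite Rg" by (rule finite_subset [OF _ finO]) (auto simp: Rg_def \<Omega>_def)
  moreover have "finite Ir" using finO by (simp add: Ir_def)
  ultimately have "card \<Omega> \<le> card Rg + card Ir"
    by (meson card_Un_le card_mono finite_UnI le_trans)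
  moreover have "card \<Omega> = card V ^ 3" by (simp add: \<Omega>_def card_cartesian_product power3_eq_cube)
  moreover have "real (card Rg) < (1 - \<epsilon>) * real (card V) ^ 3"
    using irr P(1) unfolding eps_regular_partition_def Rg_def V_def by simp
  ultimately have "real (card V) ^ 3 < (1 - \<epsilon>) * real (card V) ^ 3 + real (card Ir)"
    by (metis add_strict_right_mono of_nat_add of_nat_le_iff of_nat_power order_le_less_trans)
  then have "\<epsilon> * real (card V) ^ 3 \<le> real (card Ir)" by (simp add: algebra_simps)
  then have "\<epsilon> ^ 5 * (\<epsilon> * real (card V) ^ 3) \<le> \<epsilon> ^ 5 * real (card Ir)"
    using \<epsilon> by (intro mult_left_mono) auto
  moreover have "\<epsilon> ^ 5 * (\<epsilon> * real (card V) ^ 3) = \<epsilon> ^ 6 * real (card V) ^ 3"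
    by (simp add: power_numeral_reduce)
  ultimately show ?thesis using res Qpart cQ unfolding V_def by (intro exI [of _ Q]) auto
qed

section \<open>Tower arithmetic and the iteration\<close>

lemma Tw_pos: "1 \<le> Tw n"
  by (induction n rule: Tw.induct) auto

lemma Tw_le_Suc: "Tw n \<le> Tw (Suc n)"
  by (cases n) (auto intro: less_imp_le less_exp)

lemma Tw_mono: "m \<le> n \<Longrightarrow> Tw m \<le> Tw n"
  by (rule lift_Suc_mono_le [of Tw]) (auto simp: Tw_le_Suc)

lemma add_2_le_power_2: "2 \<le> n \<Longrightarrow> 2 + n \<le> (2::nat) ^ n"
  by (induction n rule: nat_induct_at_least) auto

text \<open>Four exponentials swallow the polynomial \<open>p + 3 * p ^ 3\<close> with room to
  spare, and the fifth is the refinement itself. The index \<open>Suc n\<close> avoids the repeated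
  initial value \<open>Tw 0 = Tw 1\<close>.\<close>

lemma Tw_absorbs_refinement:
  assumes "p \<le> Tw (Suc n)"
  shows "2 ^ (p + 3 * p ^ 3) \<le> Tw (Suc (n + 5))"
proof -
  define T where "T = Tw (Suc n)"
  have T: "1 \<le> T" "p \<le> T" using assms Tw_pos by (auto simp: T_def)
  have "p + 3 * p ^ 3 \<le> T + 3 * T ^ 3" using T by (intro add_mono mult_mono power_mono) auto
  also have "\<dots> \<le> 4 * T ^ 3" using self_le_power [of T 3] T by simp
  also have "\<dots> \<le> 2 ^ 2 * (2 ^ T) ^ 3" using less_exp [of T] by (intro mult_mono power_mono) auto
  also have "\<dots> = 2 ^ (2 + 3 * T)" by (simp add: power_add power_mult [symmetric] mult.commute)
  also have "\<dots> \<le> 2 ^ (2 ^ 2 ^ 2 ^ T)"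
  proof (rule power_increasing)
    have "2 + 3 * T \<le> 8 * T" using T by simp
    also have "\<dots> \<le> 2 ^ 3 * 2 ^ T" using less_exp [of T] by simp
    also have "\<dots> = 2 ^ (3 + T)" by (simp add: power_add)
    also have "\<dots> \<le> 2 ^ 2 ^ 2 ^ T"
    proof (rule power_increasing)
      show "3 + T \<le> 2 ^ 2 ^ T"
      \<comment> \<open>\<open>2 + T \<le> 2 ^ T\<close> fails at \<open>T = 1\<close>, where the
        claim reads \<open>4 \<le> 4\<close>.\<close>
      proof (cases "T = 1")
        case False
        have "3 + T \<le> 4 * T" using T by simp
        also have "\<dots> \<le> 2 ^ (2 + T)" using less_exp [of T] by (simp add: power_add)
        also have "\<dots> \<le> 2 ^ 2 ^ T"
          using T False by (intro power_increasing add_2_le_power_2) auto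
        finally show ?thesis .
      qed simp
    qed simp
    finally show "2 + 3 * T \<le> 2 ^ 2 ^ 2 ^ T" .
  qed simp
  finally have "p + 3 * p ^ 3 \<le> Tw (Suc (n + 4))"
    by (simp add: T_def numeral_eq_Suc)
  then have "2 ^ (p + 3 * p ^ 3) \<le> (2::nat) ^ Tw (Suc (n + 4))" by (rule power_increasing) simp
  also have "\<dots> = Tw (Suc (n + 5))" by (simp add: numeral_eq_Suc)
  finally show ?thesis .
qed

text \<open>Iterate from the one-part partition: until a regular partition appears, each refinement
  costs five tower levels and lowers the residual by \<open>\<epsilon> ^ 6\<close> times its trivial
  bound.\<close>

lemma regular_partition_or_small_residual:
  fixes H :: "'a hgraph"
  assumes "finite (fst H)" "fst H \<noteq> {}" "\<epsilon> > 0"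
  shows "(\<exists>P. eps_regular_partition \<epsilon> H P \<and> card P \<le> Tw (Suc (5 * n))) \<or>
         (\<exists>P. is_partition P (fst H) \<and> card P \<le> Tw (Suc (5 * n)) \<and>
              residual H P \<le> (1 - real n * \<epsilon> ^ 6) * real (card (fst H)) ^ 3)"
proof (induction n)
  case 0
  have "is_partition {fst H} (fst H)" using assms by (simp add: is_partition_def)
  then show ?case using residual_le_card [OF assms(1)] by (intro disjI2 exI [of _ "{fst H}"]) auto
next
  case (Suc n)
  show ?case
  proof (cases "\<exists>P. eps_regular_partition \<epsilon> H P \<and> card P \<le> Tw (Suc (5 * n))")
    case True
    moreover have "Tw (Suc (5 * n)) \<le> Tw (Suc (5 * Suc n))" by (rule Tw_mono) simp
    ultimately show ?thesis using le_trans by blast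
  next
    case False
    then obtain P where P: "is_partition P (fst H)" "card P \<le> Tw (Suc (5 * n))"
       "residual H P \<le> (1 - real n * \<epsilon> ^ 6) * real (card (fst H)) ^ 3" "\<not> eps_regular_partition \<epsilon> H P"
      using Suc by blast
    from residual_increment [OF assms(1) P(1,2) assms(3) P(4)] obtain Q where
      Q: "is_partition Q (fst H)" "card Q \<le> 2 ^ (Tw (Suc (5 * n)) + 3 * Tw (Suc (5 * n)) ^ 3)"
         "residual H Q \<le> residual H P - \<epsilon> ^ 6 * real (card (fst H)) ^ 3" by blast
    have "card Q \<le> Tw (Suc (5 * Suc n))"
      using le_trans [OF Q(2) Tw_absorbs_refinement [OF le_refl]] by (simp only: mult_Suc_right add.commute)
    moreover have "residual H Q \<le> (1 - real (Suc n) * \<epsilon> ^ 6) * real (card (fst H)) ^ 3"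
      using Q(3) P(3) by (simp add: algebra_simps)
    ultimately show ?thesis using Q(1) by blast
  qed
qed

text \<open>More than \<open>1 / \<epsilon> ^ 6\<close> refinements would make the residual
  negative. The number of parts is bounded independently of \<open>H\<close>.\<close>

lemma regular_partition_exists:
  fixes H :: "'a hgraph"
  assumes "finite (fst H)" "\<epsilon> > 0" "real n * \<epsilon> ^ 6 > 1"
  shows "\<exists>P. eps_regular_partition \<epsilon> H P \<and> card P \<le> Tw (Suc (5 * n))"
proof (cases "fst H = {}")
  case True
  then have "eps_regular_partition \<epsilon> H {}"
    by (auto simp: eps_regular_partition_def is_partition_def)
  then show ?thesis by (metis card.empty zero_le)
next
  case False
  have "0 \<le> residual H P" for P by (simp add: residual_def sum_nonneg)
  moreover have "(1 - real n * \<epsilon> ^ 6) * real (card (fst H)) ^ 3 < 0"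
    using assms(1,3) False by (intro mult_neg_pos) (auto simp: card_gt_0_iff)
  ultimately show ?thesis
    using regular_partition_or_small_residual [OF assms(1) False assms(2), of n] by (meson not_less order.trans)
qed

subsection \<open>Tripartite patterns in the hereditary class\<close>

lemma three_colours_cases:
  assumes "{x, y, z} = {0, 1, 2::nat}"
  shows "x = 0 \<and> y = 1 \<and> z = 2 \<or> x = 0 \<and> y = 2 \<and> z = 1 \<or> x = 1 \<and> y = 0 \<and> z = 2
    \<or> x = 1 \<and> y = 2 \<and> z = 0 \<or> x = 2 \<and> y = 0 \<and> z = 1 \<or> x = 2 \<and> y = 1 \<and> z = 0"
proof -
  have "x \<in> {x, y, z}" by simp
  then have 1: "x \<in> {0, 1, 2}" unfolding assms .
  have "0 \<in> {0, 1, 2::nat}" "1 \<in> {0, 1, 2::nat}" "2 \<in> {0, 1, 2::nat}" by simp_all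
  then have 2: "0 \<in> {x, y, z}" "1 \<in> {x, y, z}" "2 \<in> {x, y, z}" unfolding assms .
  consider "x = 0" | "x = 1" | "x = 2" using 1(1) by blast
  then show ?thesis by cases (use 2 in \<open>auto\<close>)
qed

text \<open>A vertex of \<open>Trip H\<close> is a colour with an underlying vertex, and the edges
  are the rainbow lifts of edges of \<open>H\<close>. Since the order of the three vertices is
  arbitrary here, a copy of a pattern can be read off before its colours are known.\<close>

lemma Trip_edge_iff:
  "{p, q, r} \<in> snd (Trip H) \<longleftrightarrow> {fst p, fst q, fst r} = {0, 1, 2} \<and> {snd p, snd q, snd r} \<in> snd H"
proof
  assume "{p, q, r} \<in> snd (Trip H)"
  then obtain v v' v'' where e: "{p, q, r} = {(0, v), (1, v'), (2, v'')}" "{v, v', v''} \<in> snd H"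
    by (auto simp: Trip_def)
  have "fst ` {p, q, r} = fst ` {(0, v), (1, v'), (2, v'')}" "snd ` {p, q, r} = snd ` {(0, v), (1, v'), (2::nat, v'')}"
    using e(1) by simp_all
  then show "{fst p, fst q, fst r} = {0, 1, 2} \<and> {snd p, snd q, snd r} \<in> snd H"
    using e(2) by (simp del: One_nat_def)
next
  assume asm: "{fst p, fst q, fst r} = {0, 1, 2} \<and> {snd p, snd q, snd r} \<in> snd H"
  have in_Trip: "{(0, v), (1, v'), (2, v'')} \<in> snd (Trip H)" if "{v, v', v''} \<in> snd H" for v v' v''
    using that by (auto simp: Trip_def)
  obtain x u y v z w where pqr: "p = (x, u)" "q = (y, v)" "r = (z, w)" by (metis prod.exhaust)
  have xyz: "{x, y, z} = {0, 1, 2}" and e: "{u, v, w} \<in> snd H" using asm by (simp_all add: pqr)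
  from three_colours_cases [OF xyz] consider "x = 0" "y = 1" "z = 2" | "x = 0" "y = 2" "z = 1" | "x = 1" "y = 0" "z = 2"
    | "x = 1" "y = 2" "z = 0" | "x = 2" "y = 0" "z = 1" | "x = 2" "y = 1" "z = 0"
    by blast
  then show "{p, q, r} \<in> snd (Trip H)"
    using e in_Trip [of u v w] in_Trip [of u w v] in_Trip [of v u w]
      in_Trip [of w u v] in_Trip [of v w u] in_Trip [of w v u]
    by cases (simp_all add: pqr insert_commute)
qed

lemma third_colour_unique:
  assumes "{x, y, z} = {0, 1, 2::nat}" "{x, y, z'} = {0, 1, 2}"
  shows "z = z'"
proof -
  have "card {x, y, z} = 3" using assms(1) by simp
  then have "z \<noteq> x" "z \<noteq> y" by (auto simp: card_insert_if split: if_splits)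
  moreover have "z \<in> {x, y, z'}" using assms by blast
  ultimately show ?thesis by auto
qed

text \<open>An isomorphism may scatter the \<open>a_i\<close> and the \<open>c_i\<close> over the
  three colours; passing to a popular colour costs a factor \<open>3\<close>.\<close>

lemma majority_colour:
  fixes f :: "nat \<Rightarrow> nat"
  assumes "\<And>i. i \<in> {1..3 * q} \<Longrightarrow> f i < 3"
  obtains c where "c < 3" "q \<le> card {i \<in> {1..3 * q}. f i = c}"
proof -
  have "3 * q = (\<Sum>c<3. card {i \<in> {1..3 * q}. f i = c})"
  proof -
    have "(\<Sum>i\<in>{1..3*q}. 1) = (\<Sum>c<3. \<Sum>i | i \<in> {1..3*q} \<and> f i = c. (1::nat))"
      by (rule sum.group [symmetric]) (use assms in auto)
    then show ?thesis by simp
  qed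
  moreover have "(\<Sum>c<3. card {i \<in> {1..3 * q}. f i = c}) < 3 * q"
    if "\<And>c. c < 3 \<Longrightarrow> card {i \<in> {1..3 * q}. f i = c} < q"
    using that [of 0] that [of 1] that [of 2] by (simp add: numeral_3_eq_3 numeral_2_eq_2)
  ultimately have "\<exists>c<3. \<not> card {i \<in> {1..3 * q}. f i = c} < q" by (metis less_irrefl)
  then show ?thesis using that not_less by blast
qed

lemma tensor_U_edge_iff:
  assumes "i \<in> {1..k}" "j \<in> {1..k}" "S \<subseteq> {1..k}"
  shows "{Inr i, Inl (Inl j), Inl (Inr S)} \<in> snd (tensor k (U_graph k)) \<longleftrightarrow> j \<in> S"
proof
  assume "{Inr i, Inl (Inl j), Inl (Inr S)} \<in> snd (tensor k (U_graph k))"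
  then obtain i' j' S' where e: "{Inr i, Inl (Inl j), Inl (Inr S)} = {Inr i', Inl (Inl j'), Inl (Inr S')}"
     "j' \<in> S'"
    by (auto simp: tensor_def U_graph_def)
  have "Inl (Inl j) \<in> {Inr i, Inl (Inl j), Inl (Inr S)}" "Inl (Inr S) \<in> {Inr i, Inl (Inl j), Inl (Inr S)}"
    by simp_all
  then show "j \<in> S" unfolding e(1) using e(2) by simp
next
  assume "j \<in> S"
  then show "{Inr i, Inl (Inl j), Inl (Inr S)} \<in> snd (tensor k (U_graph k))"
    unfolding tensor_def U_graph_def prod.case snd_conv mem_Collect_eq
    using assms by (intro exI [of _ i] exI [of _ "Inl j"] exI [of _ "Inr S"]) simp
qed

lemma tensor_U_vertices:
  "fst (tensor k (U_graph k)) = Inl ` (Inl ` {1..k} \<union> Inr ` Pow {1..k}) \<union> Inr ` {1..k}"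
  by (simp add: tensor_def U_graph_def)

text \<open>Each vertex of \<open>B\<close> is sent to some \<open>b_S\<close> where \<open>S\<close> is its neighbourhood plus one marker
  index. The marker keeps twins apart, makes \<open>S\<close> nonempty, and is chosen so that the underlying vertex of
  \<open>b_S\<close> is not also the underlying vertex of some \<open>a_i\<close>.\<close>

lemma hereditary_contains_tripartite:
  fixes A :: "'a set" and B :: "'b set" and C :: "'c set" and E :: "'a \<Rightarrow> 'b \<Rightarrow> bool"
  assumes hered: "hereditary \<H>"
    and trip: "\<And>k. k \<ge> 1 \<Longrightarrow> in_Trip_class \<H> (tensor k (U_graph k))"
    and fin: "finite A" "finite B" "finite C"
  obtains H \<phi> \<psi> \<chi> where "H \<in> \<H>" "inj_on \<phi> A" "inj_on \<psi> B" "inj_on \<chi> C"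
    "\<phi> ` A \<inter> \<psi> ` B = {}" "\<phi> ` A \<inter> \<chi> ` C = {}" "\<psi> ` B \<inter> \<chi> ` C = {}"
    "fst H = \<phi> ` A \<union> \<psi> ` B \<union> \<chi> ` C"
    "\<And>a b c. a \<in> A \<Longrightarrow> b \<in> B \<Longrightarrow> c \<in> C \<Longrightarrow> {\<phi> a, \<psi> b, \<chi> c} \<in> snd H \<longleftrightarrow> E a b"
proof -
  \<comment> \<open>Room among the \<open>c_i\<close> for \<open>C\<close>, and among the
    \<open>a_i\<close> for \<open>A\<close>, for up to \<open>card A\<close> unusable markers and
    for the markers of \<open>B\<close>. The final \<open>1\<close> keeps both index sets
    nonempty.\<close>
  define q where "q = card C + 2 * card A + card B + 1"
  define k where "k = 3 * q"
  define T where "T = tensor k (U_graph k)"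
  have "k \<ge> 1" by (simp add: k_def q_def)
  from trip [OF this] obtain H S f where H: "H \<in> \<H>" and S: "S \<subseteq> fst (Trip H)"
    and f: "bij_betw f S (fst T)" "\<And>e. e \<subseteq> S \<Longrightarrow> e \<in> snd (Trip H) \<longleftrightarrow> f ` e \<in> snd T"
    unfolding in_Trip_class_def hg_iso_def induced_def T_def by auto
  define g where "g = inv_into S f"
  have g: "bij_betw g (fst T) S" unfolding g_def by (rule bij_betw_inv_into [OF f(1)])
  have ginj: "inj_on g (fst T)" using g by (simp add: bij_betw_def)
  have gS: "g x \<in> fst (Trip H)" if "x \<in> fst T" for x
    using bij_betwE [OF g] that S by blast
  have ge: "e \<in> snd T \<longleftrightarrow> g ` e \<in> snd (Trip H)" if "e \<subseteq> fst T" for e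
  proof -
    have "f ` g ` e = e"
      using that f(1) unfolding g_def by (simp add: bij_betw_def image_inv_into_cancel)
    moreover have "g ` e \<subseteq> S" using that bij_betwE [OF g] by blast
    ultimately show ?thesis using f(2) [of "g ` e"] by simp
  qed
  define a where "a j = g (Inl (Inl j))" for j
  define b where "b R = g (Inl (Inr R))" for R
  define c where "c i = g (Inr i)" for i
  have inT: "Inl (Inl j) \<in> fst T" "Inr j \<in> fst T" if "j \<in> {1..k}" for j
    using that by (auto simp: T_def tensor_U_vertices)
  have inT': "Inl (Inr R) \<in> fst T" if "R \<subseteq> {1..k}" for R
    using that by (auto simp: T_def tensor_U_vertices)
  have edge: "{c i, a j, b R} \<in> snd (Trip H) \<longleftrightarrow> j \<in> R"
    if "i \<in> {1..k}" "j \<in> {1..k}" "R \<subseteq> {1..k}" for i j R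
    using tensor_U_edge_iff [OF that] ge [of "{Inr i, Inl (Inl j), Inl (Inr R)}"] inT inT' that
    by (simp add: T_def a_def b_def c_def)
  have fst3: "fst x < 3" "snd x \<in> fst H" if "x \<in> fst (Trip H)" for x
    using that by (auto simp: Trip_def)
  obtain \<gamma> where \<gamma>: "q \<le> card {i \<in> {1..k}. fst (c i) = \<gamma>}"
    using majority_colour [of q "\<lambda>i. fst (c i)"] fst3(1) gS inT unfolding c_def k_def by metis
  obtain \<alpha> where \<alpha>: "q \<le> card {j \<in> {1..k}. fst (a j) = \<alpha>}"
    using majority_colour [of q "\<lambda>i. fst (a i)"] fst3(1) gS inT unfolding a_def k_def by metis
  define I where "I = {i \<in> {1..k}. fst (c i) = \<gamma>}"
  define J where "J = {j \<in> {1..k}. fst (a j) = \<alpha>}"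
  have finIJ: "finite I" "finite J" by (auto simp: I_def J_def)
  have cI: "q \<le> card I" and cJ: "q \<le> card J" using \<gamma> \<alpha> by (auto simp: I_def J_def)
  have "I \<noteq> {}" using cI by (auto simp: q_def)
  then obtain i0 where i0: "i0 \<in> I" by blast
  have "J \<noteq> {}" using cJ by (auto simp: q_def)
  then obtain j0 where j0: "j0 \<in> J" by blast
  define \<beta> where "\<beta> = fst (b {j0})"
  have rainbow: "{\<gamma>, \<alpha>, fst (b R)} = {0, 1, 2} \<and> {snd (c i), snd (a j), snd (b R)} \<in> snd H"
    if "i \<in> I" "j \<in> J" "R \<subseteq> {1..k}" "j \<in> R" for i j R
    using edge [of i j R] that unfolding Trip_edge_iff I_def J_def by auto
  have cols: "{\<gamma>, \<alpha>, \<beta>} = {0, 1, 2}"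
    using rainbow [OF i0 j0, of "{j0}"] j0 by (auto simp: \<beta>_def J_def)
  \<comment> \<open>Such a \<open>b_R\<close> lies in an edge with one vertex of each popular
    colour, so its colour is forced and its underlying vertex determines it.\<close>
  have bcol: "fst (b R) = \<beta>" if "R \<subseteq> {1..k}" "j \<in> R" "j \<in> J" for R j
    using third_colour_unique [OF cols] rainbow [OF i0 that(3,1,2)] by metis
  have is3: "card e = 3" "e \<subseteq> fst H" if "e \<in> snd H" for e
    using hered H that by (auto simp: hereditary_def is_3graph_def)
  \<comment> \<open>This separates \<open>C\<close> from \<open>A\<close> and from \<open>B\<close>,
    because suitable edges exist. A vertex of \<open>A\<close> and one of \<open>B\<close> that are
    not adjacent might still share their underlying vertex; excluding this is the purpose of
    \<open>Bad\<close>.\<close>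
  have diff3: "x \<noteq> y \<and> x \<noteq> z \<and> y \<noteq> z" if "{x, y, z} \<in> snd H" for x y z
    using is3(1) [OF that] by (auto simp: card_insert_if split: if_splits)
  have "card C \<le> card I" using cI by (simp add: q_def)
  then obtain \<iota>C where \<iota>C: "\<iota>C ` C \<subseteq> I" "inj_on \<iota>C C" using card_le_inj fin(3) finIJ(1) by metis
  have "card A \<le> card J" using cJ by (simp add: q_def)
  then obtain \<iota>A where \<iota>A: "\<iota>A ` A \<subseteq> J" "inj_on \<iota>A A" using card_le_inj fin(1) finIJ(2) by metis
  define J2 where "J2 = J - \<iota>A ` A"
  have "card J2 = card J - card A"
    using \<iota>A fin by (simp add: J2_def card_Diff_subset card_image)
  then have cJ2: "card J2 \<ge> card A + card B" using cJ by (simp add: q_def)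
  define UA where "UA = (\<lambda>x. snd (a (\<iota>A x))) ` A"
  \<comment> \<open>A marker is bad if some set with this trace on \<open>J2\<close> lands on a
    vertex already used for \<open>A\<close>. Distinct bad markers give distinct sets, hence
    distinct vertices of \<open>UA\<close>, so there are at most \<open>card A\<close> of
    them.\<close>
  define Bad where "Bad = {j \<in> J2. \<exists>R \<subseteq> {1..k}. R \<inter> J2 = {j} \<and> snd (b R) \<in> UA}"
  define W where "W j = (SOME R. R \<subseteq> {1..k} \<and> R \<inter> J2 = {j} \<and> snd (b R) \<in> UA)" for j
  have W: "W j \<subseteq> {1..k}" "W j \<inter> J2 = {j}" "snd (b (W j)) \<in> UA" if "j \<in> Bad" for j
    using someI_ex [of "\<lambda>R. R \<subseteq> {1..k} \<and> R \<inter> J2 = {j} \<and> snd (b R) \<in> UA"] that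
    unfolding W_def [symmetric] by (auto simp: Bad_def)
  have b_eq: "R = R'" if "R \<subseteq> {1..k}" "R' \<subseteq> {1..k}" "j \<in> R" "j \<in> J" "j' \<in> R'" "j' \<in> J" "snd (b R) = snd (b R')" for R R' j j'
  proof -
    have "b R = b R'" using that bcol by (metis prod.expand)
    then show ?thesis using inj_onD [OF ginj] inT' that(1,2) unfolding b_def by blast
  qed
  have "inj_on (\<lambda>j. snd (b (W j))) Bad"
  proof (rule inj_onI)
    fix j j' assume j: "j \<in> Bad" "j' \<in> Bad" "snd (b (W j)) = snd (b (W j'))"
    have "j \<in> W j" "j \<in> J" "j' \<in> W j'" "j' \<in> J" using W(2) j(1,2) by (auto simp: J2_def)
    then have "W j = W j'" using b_eq W(1) j by blast
    then show "j = j'" using W(2) j(1,2) by (metis singleton_inject)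
  qed
  then have "card Bad \<le> card UA"
    by (rule card_inj_on_le) (use W(3) fin in \<open>auto simp: UA_def\<close>)
  also have "\<dots> \<le> card A" using fin by (simp add: UA_def card_image_le)
  finally have "card Bad \<le> card A" .
  moreover have "card (J2 - Bad) \<ge> card J2 - card Bad" by (rule diff_card_le_card_Diff) (auto simp: Bad_def J2_def finIJ)
  ultimately have "card B \<le> card (J2 - Bad)" using cJ2 by linarith
  then obtain \<mu> where \<mu>: "\<mu> ` B \<subseteq> J2 - Bad" "inj_on \<mu> B"
    using card_le_inj fin(2) finIJ(2) by (metis J2_def finite_Diff)
  define N where "N y = insert (\<mu> y) {\<iota>A x | x. x \<in> A \<and> E x y}" for y
  define \<phi> where "\<phi> x = snd (a (\<iota>A x))" for x
  define \<psi> where "\<psi> y = snd (b (N y))" for y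
  define \<chi> where "\<chi> z = snd (c (\<iota>C z))" for z
  have Jk: "J \<subseteq> {1..k}" "I \<subseteq> {1..k}" by (auto simp: J_def I_def)
  have \<iota>J: "\<iota>A x \<in> J" if "x \<in> A" for x using \<iota>A that by blast
  have \<iota>I: "\<iota>C z \<in> I" if "z \<in> C" for z using \<iota>C that by blast
  have \<mu>J: "\<mu> y \<in> J" "\<mu> y \<in> J2" "\<mu> y \<notin> Bad" if "y \<in> B" for y using \<mu> that by (auto simp: J2_def)
  have N: "N y \<subseteq> {1..k}" "N y \<inter> J2 = {\<mu> y}" "\<mu> y \<in> N y" if "y \<in> B" for y
  proof -
    have "N y \<subseteq> J" using \<mu>J(1) [OF that] \<iota>J by (auto simp: N_def)
    then show "N y \<subseteq> {1..k}" using Jk by blast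
    show "N y \<inter> J2 = {\<mu> y}" using \<mu>J(2) [OF that] by (auto simp: N_def J2_def)
  qed (simp add: N_def)
  have iN: "\<iota>A x \<in> N y \<longleftrightarrow> E x y" if "x \<in> A" "y \<in> B" for x y
  proof -
    have "\<iota>A x \<noteq> \<mu> y" using that \<mu>J(2) by (force simp: J2_def)
    then show ?thesis using that by (auto simp: N_def dest: inj_onD [OF \<iota>A(2)])
  qed
  have i\<phi>: "inj_on \<phi> A"
  proof (rule inj_onI)
    fix x y assume xy: "x \<in> A" "y \<in> A" "\<phi> x = \<phi> y"
    have "a (\<iota>A x) = a (\<iota>A y)"
      using xy \<iota>J unfolding \<phi>_def J_def by (intro prod_eqI) auto
    moreover have "\<iota>A x \<in> {1..k}" "\<iota>A y \<in> {1..k}" using \<iota>J Jk xy by blast+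
    ultimately have "\<iota>A x = \<iota>A y"
      using inj_onD [OF ginj _ inT(1) inT(1)] unfolding a_def by blast
    then show "x = y" using inj_onD [OF \<iota>A(2)] xy by blast
  qed
  have i\<chi>: "inj_on \<chi> C"
  proof (rule inj_onI)
    fix x y assume xy: "x \<in> C" "y \<in> C" "\<chi> x = \<chi> y"
    have "c (\<iota>C x) = c (\<iota>C y)"
      using xy \<iota>I unfolding \<chi>_def I_def by (intro prod_eqI) auto
    moreover have "\<iota>C x \<in> {1..k}" "\<iota>C y \<in> {1..k}" using \<iota>I Jk xy by blast+
    ultimately have "\<iota>C x = \<iota>C y"
      using inj_onD [OF ginj _ inT(2) inT(2)] unfolding c_def by blast
    then show "x = y" using inj_onD [OF \<iota>C(2)] xy by blast
  qed
  have i\<psi>: "inj_on \<psi> B"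
  proof (rule inj_onI)
    fix x y assume xy: "x \<in> B" "y \<in> B" "\<psi> x = \<psi> y"
    have "N x = N y"
      using b_eq [OF N(1) [OF xy(1)] N(1) [OF xy(2)] N(3) [OF xy(1)] \<mu>J(1) [OF xy(1)]
          N(3) [OF xy(2)] \<mu>J(1) [OF xy(2)]] xy(3) unfolding \<psi>_def by simp
    then have "{\<mu> x} = {\<mu> y}" using N(2) [OF xy(1)] N(2) [OF xy(2)] by simp
    then show "x = y" using inj_onD [OF \<mu>(2) _ xy(1,2)] by simp
  qed
  have AB: "\<phi> ` A \<inter> \<psi> ` B = {}"
  proof -
    have "\<psi> y \<notin> UA" if "y \<in> B" for y
    proof
      assume "\<psi> y \<in> UA"
      then have "\<exists>R\<subseteq>{1..k}. R \<inter> J2 = {\<mu> y} \<and> snd (b R) \<in> UA"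
        using N(1,2) [OF that] unfolding \<psi>_def by (intro exI [of _ "N y"] conjI)
      then show False using \<mu>J(2,3) [OF that] unfolding Bad_def by simp
    qed
    then have "\<psi> ` B \<inter> UA = {}" by blast
    moreover have "UA = \<phi> ` A" unfolding UA_def \<phi>_def ..
    ultimately show ?thesis by (simp add: Int_commute)
  qed
  have AC: "\<phi> x \<noteq> \<chi> z" if "x \<in> A" "z \<in> C" for x z
  proof -
    have "{\<iota>A x} \<subseteq> {1..k}" using \<iota>J [OF that(1)] Jk by blast
    from diff3 [OF conjunct2 [OF rainbow [OF \<iota>I [OF that(2)] \<iota>J [OF that(1)] this singletonI]]]
    show ?thesis unfolding \<phi>_def \<chi>_def by simp
  qed
  have BC: "\<psi> y \<noteq> \<chi> z" if "y \<in> B" "z \<in> C" for y z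
    using diff3 [OF conjunct2 [OF rainbow [OF \<iota>I [OF that(2)] \<mu>J(1) N(1) N(3), OF that(1) that(1) that(1)]]]
    unfolding \<psi>_def \<chi>_def by simp
  define X where "X = \<phi> ` A \<union> \<psi> ` B \<union> \<chi> ` C"
  have "\<phi> x \<in> fst H" if "x \<in> A" for x
    unfolding \<phi>_def a_def using \<iota>J [OF that] Jk by (intro fst3(2) gS inT) blast
  moreover have "\<psi> y \<in> fst H" if "y \<in> B" for y
    unfolding \<psi>_def b_def using N(1) [OF that] by (intro fst3(2) gS inT')
  moreover have "\<chi> z \<in> fst H" if "z \<in> C" for z
    unfolding \<chi>_def c_def using \<iota>I [OF that] Jk by (intro fst3(2) gS inT) blast
  ultimately have "X \<subseteq> fst H" by (auto simp: X_def)
  then have "induced H X \<in> \<H>" using hered H by (simp add: hereditary_def)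
  moreover have "{\<phi> x, \<psi> y, \<chi> z} \<in> snd (induced H X) \<longleftrightarrow> E x y"
    if "x \<in> A" "y \<in> B" "z \<in> C" for x y z
  proof -
    have "{\<phi> x, \<psi> y, \<chi> z} \<in> snd (induced H X) \<longleftrightarrow> {\<chi> z, \<phi> x, \<psi> y} \<in> snd H"
      using that by (auto simp: induced_def X_def insert_commute)
    also have "\<dots> \<longleftrightarrow> {c (\<iota>C z), a (\<iota>A x), b (N y)} \<in> snd (Trip H)"
    proof -
      have "fst (c (\<iota>C z)) = \<gamma>" "fst (a (\<iota>A x)) = \<alpha>" "fst (b (N y)) = \<beta>"
        using \<iota>I \<iota>J bcol [OF N(1) N(3) \<mu>J(1)] that by (auto simp: I_def J_def)
      then show ?thesis unfolding Trip_edge_iff using cols by (simp add: \<phi>_def \<psi>_def \<chi>_def)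
    qed
    also have "\<dots> \<longleftrightarrow> E x y"
      using edge [OF _ _ N(1) [OF that(2)], of "\<iota>C z" "\<iota>A x"] \<iota>I [OF that(3)] \<iota>J [OF that(1)]
        Jk iN [OF that(1,2)] by blast
    finally show ?thesis .
  qed
  moreover have "fst (induced H X) = X" by (simp add: induced_def)
  ultimately show ?thesis
    using i\<phi> i\<psi> i\<chi> AB AC BC by (intro that [of "induced H X" \<phi> \<psi> \<chi>]) (auto simp: X_def)
qed

subsection \<open>Separated codes and nested partitions\<close>

definition hamming :: "'a set \<Rightarrow> 'a set \<Rightarrow> nat" where
  "hamming R S = card ((R - S) \<union> (S - R))"

text \<open>Symmetric difference with \<open>f\<close> is an isometric involution that moves the
  centre of the ball to the empty set.\<close>

lemma card_hamming_ball:
  assumes "f \<subseteq> J"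
  shows "card {w \<in> Pow J. 8 * hamming w f < m} = card {R \<in> Pow J. 8 * card R < m}"
proof -
  define t where "t w = (w - f) \<union> (f - w)" for w
  have tt: "t (t w) = w" for w by (auto simp: t_def)
  have "t ` {w \<in> Pow J. 8 * hamming w f < m} = {R \<in> Pow J. 8 * card R < m}"
  proof (intro equalityI subsetI)
    fix R assume "R \<in> t ` {w \<in> Pow J. 8 * hamming w f < m}"
    then show "R \<in> {R \<in> Pow J. 8 * card R < m}" using assms by (auto simp: t_def hamming_def)
  next
    fix R assume R: "R \<in> {R \<in> Pow J. 8 * card R < m}"
    have "t R \<subseteq> J" using R assms by (auto simp: t_def)
    moreover have "hamming (t R) f = card R" using tt [of R] by (simp add: hamming_def t_def)
    ultimately show "R \<in> t ` {w \<in> Pow J. 8 * hamming w f < m}"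
      using R tt [of R] by (intro image_eqI [of _ _ "t R"]) auto
  qed
  moreover have "inj_on t {w \<in> Pow J. 8 * hamming w f < m}" by (rule inj_on_inverseI [of _ t]) (rule tt)
  ultimately show ?thesis using card_image by fastforce
qed

text \<open>Chernoff bound with tilting parameter \<open>c = 5/4\<close>: a set of size below \<open>m/8\<close> has weight
  \<open>c^(m - 8|R|) \<ge> 1\<close>, and the total weight is \<open>(c + c^(-7))^m\<close>.\<close>

lemma hamming_ball_volume:
  "real (card {R \<in> Pow {..<m}. 8 * card R < m}) \<le> (3 / 2) ^ m"
proof -
  define c :: real where "c = 5 / 4"
  have "real (card {R \<in> Pow {..<m}. 8 * card R < m}) = (\<Sum>R | R \<in> Pow {..<m} \<and> 8 * card R < m. 1)" by simp
  also have "\<dots> \<le> (\<Sum>R | R \<in> Pow {..<m} \<and> 8 * card R < m. c ^ m * (1 / c ^ 8) ^ card R)"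
  proof (rule sum_mono)
    fix R assume "R \<in> {R. R \<in> Pow {..<m} \<and> 8 * card R < m}"
    then have R: "8 * card R \<le> m" by simp
    have "c ^ m * (1 / c ^ 8) ^ card R = c ^ (m - 8 * card R)"
    proof -
      have "c \<noteq> 0" by (simp add: c_def)
      from power_diff [OF this R] have "c ^ (m - 8 * card R) = c ^ m * (1 / c ^ (8 * card R))" by simp
      also have "1 / c ^ (8 * card R) = (1 / c ^ 8) ^ card R" by (simp only: power_one_over power_mult)
      finally show ?thesis ..
    qed
    also have "\<dots> \<ge> 1" by (rule one_le_power) (simp add: c_def)
    finally show "1 \<le> c ^ m * (1 / c ^ 8) ^ card R" .
  qed
  also have "\<dots> \<le> (\<Sum>R\<in>Pow {..<m}. c ^ m * (1 / c ^ 8) ^ card R)"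
    by (intro sum_mono2) (auto simp: c_def)
  also have "\<dots> = c ^ m * (\<Sum>R\<in>Pow {..<m}. \<Prod>i\<in>R. 1 / c ^ 8)"
    by (simp add: sum_distrib_left)
  also have "\<dots> = c ^ m * (\<Prod>i<m. 1 + 1 / c ^ 8)"
    using prod_add [of "{..<m}" "\<lambda>_. 1 / c ^ 8" "\<lambda>_. 1"] by (simp add: add.commute)
  also have "\<dots> = (c * (1 + 1 / c ^ 8)) ^ m" by (simp only: prod_constant card_lessThan power_mult_distrib)
  also have "\<dots> \<le> (3 / 2) ^ m" by (intro power_mono) (auto simp: c_def field_simps)
  finally show ?thesis .
qed

text \<open>The exponent is small enough for a greedy construction; the extra \<open>1\<close> makes
  the size even and at least \<open>2\<close>, so that words come in complementary pairs even at
  lengths below \<open>8\<close>.\<close>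

definition code_size :: "nat \<Rightarrow> nat" where
  "code_size m = 2 ^ (m div 8 + 1)"

lemma code_size_pos [simp]: "0 < code_size m"
  by (simp add: code_size_def)

text \<open>With \<open>k = m div 8\<close> the size is at most \<open>4 ^ k\<close>, and
  \<open>4 \<le> (4 / 3) ^ 8\<close>. Hence fewer than \<open>code_size m\<close> balls leave part
  of the cube uncovered.\<close>

lemma code_room:
  assumes "8 \<le> m"
  shows "real (code_size m) * (3 / 2) ^ m \<le> 2 ^ m"
proof -
  define k where "k = m div 8"
  have k: "1 \<le> k" "8 * k \<le> m" using assms by (auto simp: k_def)
  have "real (code_size m) = 2 * 2 ^ k" by (simp add: code_size_def k_def)
  also have "\<dots> \<le> 2 ^ k * 2 ^ k" using k self_le_power[of "2::real" k] by (intro mult_right_mono) auto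
  also have "\<dots> = 4 ^ k" by (simp flip: power_mult_distrib)
  also have "\<dots> \<le> ((4 / 3) ^ 8) ^ k" by (intro power_mono) (auto simp: field_simps)
  also have "\<dots> \<le> (4 / 3) ^ m" using k by (simp flip: power_mult)
  finally have "real (code_size m) * (3 / 2) ^ m \<le> (4 / 3) ^ m * (3 / 2) ^ m"
    by (intro mult_right_mono) auto
  also have "\<dots> = 2 ^ m" by (simp flip: power_mult_distrib)
  finally show ?thesis .
qed

text \<open>Closure under complement is what makes every coordinate take both values equally often;
  separation alone does not give this.\<close>

definition sep_family :: "nat \<Rightarrow> nat set set \<Rightarrow> bool" where
  "sep_family m F \<longleftrightarrow> F \<subseteq> Pow {..<m} \<and> (\<forall>R\<in>F. {..<m} - R \<in> F) \<and>
     (\<forall>R\<in>F. \<forall>S\<in>F. R \<noteq> S \<longrightarrow> m \<le> 8 * hamming R S)"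

lemma hamming_commute: "hamming R S = hamming S R"
  by (simp add: hamming_def Un_commute)

lemma hamming_complement:
  assumes "R \<subseteq> J" "S \<subseteq> J"
  shows "hamming (J - R) S = hamming R (J - S)"
proof -
  have "(J - R - S) \<union> (S - (J - R)) = (R - (J - S)) \<union> (J - S - R)" using assms by auto
  then show ?thesis by (simp add: hamming_def)
qed

text \<open>The Gilbert-Varshamov argument, two words at a time. If \<open>w\<close> avoids all
  balls then so does its complement, because the distance from \<open>J - w\<close> to
  \<open>f\<close> is the distance from \<open>w\<close> to \<open>J - f\<close>, which is again in
  the family.\<close>

lemma sep_family_extend:
  assumes F: "sep_family m F" and m: "1 \<le> m" and room: "real (card F) * (3 / 2) ^ m < 2 ^ m"
  shows "\<exists>G. sep_family m G \<and> card G = card F + 2"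
proof -
  define J where "J = {..<m}"
  have FJ: "F \<subseteq> Pow J" using F by (simp add: sep_family_def J_def)
  have finF: "finite F" using FJ by (rule finite_subset) (simp add: J_def)
  define N where "N = (\<Union>f\<in>F. {w \<in> Pow J. 8 * hamming w f < m})"
  have "card N \<le> (\<Sum>f\<in>F. card {w \<in> Pow J. 8 * hamming w f < m})"
    unfolding N_def by (rule card_UN_le [OF finF])
  also have "\<dots> = card F * card {R \<in> Pow J. 8 * card R < m}"
  proof -
    have "card {w \<in> Pow J. 8 * hamming w f < m} = card {R \<in> Pow J. 8 * card R < m}" if "f \<in> F" for f
      using FJ that by (intro card_hamming_ball) blast
    then have "(\<Sum>f\<in>F. card {w \<in> Pow J. 8 * hamming w f < m}) = (\<Sum>f\<in>F. card {R \<in> Pow J. 8 * card R < m})"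
      by (intro sum.cong refl)
    then show ?thesis by (simp only: sum_constant of_nat_id)
  qed
  finally have "real (card N) \<le> real (card F) * real (card {R \<in> Pow J. 8 * card R < m})"
    by (metis of_nat_le_iff of_nat_mult)
  also have "\<dots> \<le> real (card F) * (3 / 2) ^ m"
    unfolding J_def by (intro mult_left_mono hamming_ball_volume) auto
  also have "\<dots> < 2 ^ m" by (rule room)
  also have "\<dots> = real (card (Pow J))" by (simp add: card_Pow J_def)
  finally have "card N < card (Pow J)" by simp
  moreover have "N \<subseteq> Pow J" by (auto simp: N_def)
  ultimately obtain w where w: "w \<in> Pow J" "w \<notin> N" by (metis less_irrefl subsetI subset_antisym)
  have dist: "m \<le> 8 * hamming w f" if "f \<in> F" for f
    using w that by (fastforce simp: N_def)
  have dist': "m \<le> 8 * hamming (J - w) f" if "f \<in> F" for f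
  proof -
    have "J - f \<in> F" using F that by (simp add: sep_family_def J_def)
    then show ?thesis using dist [of "J - f"] hamming_complement [of w J f] w FJ that by auto
  qed
  have self: "hamming f f = 0" for f :: "nat set" by (simp add: hamming_def)
  have new: "w \<notin> F" "J - w \<notin> F" using dist [of w] dist' [of "J - w"] m by (auto simp: self)
  have "(w - (J - w)) \<union> (J - w - w) = J" using w by auto
  then have hw: "hamming w (J - w) = m" by (simp add: hamming_def J_def)
  have ww: "w \<noteq> J - w" using hw m self by (metis not_one_le_zero)
  define G where "G = insert w (insert (J - w) F)"
  have "card G = card F + 2" using new ww finF by (simp add: G_def)
  moreover have "sep_family m G"
    unfolding sep_family_def J_def [symmetric]
  proof (intro conjI ballI impI)
    show "G \<subseteq> Pow J" using FJ w by (auto simp: G_def)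
    show "J - R \<in> G" if "R \<in> G" for R
      using that F w by (auto simp: G_def sep_family_def J_def double_diff)
    fix R S assume RS: "R \<in> G" "S \<in> G" "R \<noteq> S"
    have FF: "m \<le> 8 * hamming R S" if "R \<in> F" "S \<in> F"
      using F that RS(3) by (simp add: sep_family_def)
    have rev: "m \<le> 8 * hamming f w" "m \<le> 8 * hamming f (J - w)" if "f \<in> F" for f
      using dist [OF that] dist' [OF that] by (simp_all add: hamming_commute)
    have hw': "hamming (J - w) w = m" using hw by (simp add: hamming_commute)
    from RS show "m \<le> 8 * hamming R S" unfolding G_def insert_iff
      by (elim disjE) (simp_all add: dist dist' rev hw hw' FF)
  qed
  ultimately show ?thesis by blast
qed

lemma sep_family_exists:
  assumes "1 \<le> m" "1 \<le> k" "2 * k \<le> code_size m"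
  shows "\<exists>F. sep_family m F \<and> card F = 2 * k"
  using assms(2,3)
proof (induction k rule: nat_induct_at_least)
  case base
  define J where "J = {..<m}"
  have J: "J \<noteq> {}" "card J = m" "finite J" using assms by (auto simp: J_def lessThan_empty_iff)
  have "sep_family m {{}, J}"
    unfolding sep_family_def J_def [symmetric] using J by (auto simp: hamming_def)
  moreover have "card {{}, J} = 2" using J by auto
  ultimately show ?case by auto
next
  case (Suc k)
  then obtain F where F: "sep_family m F" "card F = 2 * k" by auto
  \<comment> \<open>At lengths below \<open>8\<close> nothing beyond the pair \<open>{}\<close>,
    \<open>J\<close> of the base case is asked for.\<close>
  have "8 \<le> m"
  proof (rule ccontr)
    assume "\<not> 8 \<le> m"
    then have "code_size m = 2" by (simp add: code_size_def)
    then show False using Suc by simp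
  qed
  have "real (card F) * (3 / 2) ^ m < real (code_size m) * (3 / 2) ^ m"
    using Suc.prems F(2) by (intro mult_strict_right_mono) auto
  also have "\<dots> \<le> 2 ^ m" using \<open>8 \<le> m\<close> by (rule code_room)
  finally show ?case using sep_family_extend [OF F(1) assms(1)] F(2) by auto
qed

definition is_code :: "nat \<Rightarrow> (nat \<Rightarrow> nat set) \<Rightarrow> bool" where
  "is_code m w \<longleftrightarrow> (\<forall>t<code_size m. w t \<subseteq> {..<m}) \<and>
     (\<forall>t<code_size m. \<forall>t'<code_size m. t \<noteq> t' \<longrightarrow> m \<le> 8 * hamming (w t) (w t')) \<and>
     (\<forall>j<m. 2 * card {t. t < code_size m \<and> j \<in> w t} = code_size m)"

text \<open>Balance holds because complementation is a bijection between the words that contain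
  \<open>j\<close> and those that avoid it.\<close>

lemma is_code_exists:
  assumes "1 \<le> m"
  shows "\<exists>w. is_code m w"
proof -
  have "2 * 2 ^ (m div 8) = code_size m" by (simp add: code_size_def)
  then obtain F where F: "sep_family m F" "card F = code_size m"
    using sep_family_exists [OF assms, of "2 ^ (m div 8)"] by auto
  have finF: "finite F" using F(2) by (metis card.infinite code_size_pos less_irrefl)
  obtain w where w: "bij_betw w {..<code_size m} F"
    using ex_bij_betw_nat_finite [OF finF] F(2) by (auto simp: atLeast0LessThan)
  have wF: "w t \<in> F" if "t < code_size m" for t using w that by (auto simp: bij_betw_def)
  have sep: "m \<le> 8 * hamming (w t) (w t')" if "t < code_size m" "t' < code_size m" "t \<noteq> t'" for t t'
  proof -
    have "w t \<noteq> w t'" using w that by (auto simp: bij_betw_def inj_on_def)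
    then show ?thesis using F(1) wF [OF that(1)] wF [OF that(2)] unfolding sep_family_def by simp
  qed
  have bal: "2 * card {t. t < code_size m \<and> j \<in> w t} = code_size m" if j: "j < m" for j
  proof -
    have "w ` {t. t < code_size m \<and> j \<in> w t} = {R \<in> F. j \<in> R}"
    proof -
      have "w ` {..<code_size m} = F" using w by (simp add: bij_betw_def)
      then show ?thesis by blast
    qed
    moreover have "inj_on w {t. t < code_size m \<and> j \<in> w t}"
      by (rule inj_on_subset [OF bij_betw_imp_inj_on [OF w]]) auto
    ultimately have 1: "card {t. t < code_size m \<and> j \<in> w t} = card {R \<in> F. j \<in> R}"
      using card_image by fastforce
    have comp: "{..<m} - R \<in> F" "{..<m} - ({..<m} - R) = R" if "R \<in> F" for R
      using F(1) that by (auto simp: sep_family_def)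
    have "(\<lambda>R. {..<m} - R) ` {R \<in> F. j \<in> R} = {R \<in> F. j \<notin> R}"
    proof (intro equalityI subsetI)
      fix R assume "R \<in> {R \<in> F. j \<notin> R}"
      then show "R \<in> (\<lambda>R. {..<m} - R) ` {R \<in> F. j \<in> R}"
        using comp [of R] j by (intro image_eqI [of _ _ "{..<m} - R"]) auto
    qed (use comp in auto)
    moreover have "inj_on (\<lambda>R. {..<m} - R) {R \<in> F. j \<in> R}"
      by (rule inj_on_inverseI [of _ "\<lambda>R. {..<m} - R"]) (use comp in auto)
    ultimately have 2: "card {R \<in> F. j \<in> R} = card {R \<in> F. j \<notin> R}" using card_image by fastforce
    have "card F = card {R \<in> F. j \<in> R} + card {R \<in> F. j \<notin> R}"
      using finF by (subst card_Un_disjoint [symmetric]) (auto intro: arg_cong [where f=card])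
    then show ?thesis using 1 2 F(2) by simp
  qed
  have "F \<subseteq> Pow {..<m}" using F(1) by (simp add: sep_family_def)
  then have "w t \<subseteq> {..<m}" if "t < code_size m" for t using wF [OF that] by blast
  then have "is_code m w" unfolding is_code_def using sep bal by simp
  then show ?thesis by blast
qed

section \<open>Nested cells as mixed-radix labels, and their sign functions\<close>

definition word :: "nat \<Rightarrow> nat \<Rightarrow> nat set" where
  "word m = (SOME w. is_code m w)"

lemma is_code_word: "1 \<le> m \<Longrightarrow> is_code m (word m)"
  unfolding word_def by (rule someI_ex [OF is_code_exists])

text \<open>Each level-\<open>r\<close> cell has one subcell per codeword of length
  \<open>lev r\<close>, with one bit for each level-\<open>r\<close> cell on the other side. This is
  the source of the exponential growth from level to level.\<close>

fun lev :: "nat \<Rightarrow> nat" where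
  "lev 0 = 1"
| "lev (Suc r) = code_size (lev r) * lev r"

lemma lev_pos [simp]: "0 < lev r" "Suc 0 \<le> lev r" "lev r \<noteq> 0"
proof -
  show "0 < lev r" by (induction r) auto
  then show "Suc 0 \<le> lev r" "lev r \<noteq> 0" by auto
qed

lemma lev_dvd: "r \<le> r' \<Longrightarrow> lev r dvd lev r'"
  by (induction r' rule: dec_induct) auto

definition sgn_bit :: "nat \<Rightarrow> nat \<Rightarrow> nat \<Rightarrow> real" where
  "sgn_bit r t j = (if j \<in> word (lev r) t then 1 else -1)"

lemma abs_sgn_bit [simp]: "\<bar>sgn_bit r t j\<bar> = 1"
  by (simp add: sgn_bit_def)

lemma sum_sgn_bit:
  assumes "j < lev r"
  shows "(\<Sum>t<code_size (lev r). sgn_bit r t j) = 0"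
proof -
  let ?M = "code_size (lev r)"
  have "(\<Sum>t<?M. sgn_bit r t j) = (\<Sum>t<?M. 2 * of_bool (j \<in> word (lev r) t) - 1)"
    by (intro sum.cong) (auto simp: sgn_bit_def)
  also have "\<dots> = 2 * (\<Sum>t<?M. of_bool (j \<in> word (lev r) t)) - real ?M"
    by (simp add: sum_subtractf sum_distrib_left)
  also have "(\<Sum>t<?M. of_bool (j \<in> word (lev r) t)) = real (card {t. t < ?M \<and> j \<in> word (lev r) t})"
    by (simp add: of_bool_def flip: sum.inter_filter)
  also have "2 * \<dots> = real ?M"
    using is_code_word [of "lev r"] assms unfolding is_code_def
    by (metis lev_pos(2) One_nat_def of_nat_mult of_nat_numeral)
  finally show ?thesis by simp
qed

text \<open>Labels are read in mixed radix: \<open>part r\<close> keeps the lowest \<open>r\<close>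
  digits, naming the level-\<open>r\<close> cell, and \<open>sub r\<close> is the next digit, naming
  the subcell.\<close>

definition part :: "nat \<Rightarrow> nat \<Rightarrow> nat" where
  "part r x = x mod lev r"

definition sub :: "nat \<Rightarrow> nat \<Rightarrow> nat" where
  "sub r x = (x div lev r) mod code_size (lev r)"

lemma part_less [simp]: "part r x < lev r"
  by (simp add: part_def)

lemma sub_less [simp]: "sub r x < code_size (lev r)"
  by (simp add: sub_def)

lemma part_Suc: "part (Suc r) x = part r x + lev r * sub r x"
  by (simp add: part_def sub_def mult.commute mod_mult2_eq)

lemma part_part: "r \<le> r' \<Longrightarrow> part r (part r' x) = part r x"
  by (simp add: part_def lev_dvd mod_mod_cancel)

lemma sub_part: "r < r' \<Longrightarrow> sub r (part r' x) = sub r x"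
proof -
  assume "r < r'"
  have "part (Suc r) (part r' x) = part (Suc r) x" "part r (part r' x) = part r x"
    using \<open>r < r'\<close> by (simp_all add: part_part)
  then show ?thesis unfolding part_Suc by simp
qed

text \<open>Bit \<open>j\<close> of the codeword for the subcell of \<open>x\<close> times bit
  \<open>i\<close> of the one for \<open>y\<close>, where \<open>i\<close> and \<open>j\<close> are
  their cells. Each factor averages to \<open>0\<close> over the subcells of its own point, and the
  product is symmetric.\<close>

definition g_lev :: "nat \<Rightarrow> nat \<Rightarrow> nat \<Rightarrow> real" where
  "g_lev r x y = sgn_bit r (sub r x) (part r y) * sgn_bit r (sub r y) (part r x)"

definition h_sum :: "nat \<Rightarrow> nat \<Rightarrow> nat \<Rightarrow> real" where
  "h_sum s x y = (\<Sum>r<s. g_lev r x y)"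

lemma g_lev_commute: "g_lev r x y = g_lev r y x"
  by (simp add: g_lev_def)

lemma h_sum_commute: "h_sum s x y = h_sum s y x"
  by (simp add: h_sum_def g_lev_commute)

lemma abs_g_lev [simp]: "\<bar>g_lev r x y\<bar> = 1"
  by (simp add: g_lev_def abs_mult)

lemma abs_h_sum_le: "\<bar>h_sum s x y\<bar> \<le> real s"
proof -
  have "\<bar>h_sum s x y\<bar> \<le> (\<Sum>r<s. \<bar>g_lev r x y\<bar>)" unfolding h_sum_def by (rule sum_abs)
  then show ?thesis by simp
qed

lemma sum_mod_periodic:
  fixes \<phi> :: "nat \<Rightarrow> real"
  shows "(\<Sum>x<k * m. \<phi> (x mod m)) = real k * (\<Sum>x<m. \<phi> x)"
proof -
  have "(\<Sum>x<k * m. \<phi> (x mod m)) = (\<Sum>i<k. \<Sum>x = i * m..<i * m + m. \<phi> (x mod m))"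
    by (rule sum.nat_group [symmetric])
  also have "\<dots> = (\<Sum>i<k. \<Sum>x<m. \<phi> x)"
  proof (rule sum.cong [OF refl])
    fix i
    show "(\<Sum>x = i * m..<i * m + m. \<phi> (x mod m)) = (\<Sum>x<m. \<phi> x)"
      using sum.shift_bounds_nat_ivl [of "\<lambda>x. \<phi> (x mod m)" 0 "i * m" m]
      by (simp add: add.commute atLeast0LessThan)
  qed
  finally show ?thesis by simp
qed

section \<open>Averages over equidistributed labels\<close>

definition uniform :: "nat \<Rightarrow> 'a set \<Rightarrow> ('a \<Rightarrow> nat) \<Rightarrow> bool" where
  "uniform s A l \<longleftrightarrow> finite A \<and> (\<forall>u\<in>A. l u < lev s) \<and>
     (\<forall>x<lev s. card {u \<in> A. l u = x} * lev s = card A)"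

lemma uniform_sum_part:
  fixes \<phi> :: "nat \<Rightarrow> real"
  assumes "uniform s A l" "r \<le> s"
  shows "real (lev r) * (\<Sum>u\<in>A. \<phi> (part r (l u))) = real (card A) * (\<Sum>x<lev r. \<phi> x)"
proof -
  have A: "finite A" "\<And>u. u \<in> A \<Longrightarrow> l u < lev s" "\<And>x. x < lev s \<Longrightarrow> real (card {u \<in> A. l u = x}) * real (lev s) = real (card A)"
    using assms(1) unfolding uniform_def by (auto simp flip: of_nat_mult)
  obtain k where k: "lev s = k * lev r" using lev_dvd [OF assms(2)] by (metis dvd_def mult.commute)
  have "(\<Sum>u\<in>A. \<phi> (part r (l u))) = (\<Sum>x<lev s. \<Sum>u | u \<in> A \<and> l u = x. \<phi> (part r (l u)))"
    by (rule sum.group [symmetric]) (use A in auto)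
  also have "\<dots> = (\<Sum>x<lev s. real (card {u \<in> A. l u = x}) * \<phi> (part r x))"
    by (intro sum.cong refl) simp
  finally have "real (lev s) * (\<Sum>u\<in>A. \<phi> (part r (l u)))
      = (\<Sum>x<lev s. (real (card {u \<in> A. l u = x}) * real (lev s)) * \<phi> (part r x))"
    by (simp add: sum_distrib_left mult_ac)
  also have "\<dots> = (\<Sum>x<lev s. real (card A) * \<phi> (part r x))"
    using A(3) by (intro sum.cong) auto
  also have "\<dots> = real (card A) * (\<Sum>x<k * lev r. \<phi> (x mod lev r))"
    by (simp add: sum_distrib_left part_def k)
  also have "\<dots> = real k * (real (card A) * (\<Sum>x<lev r. \<phi> x))"
    unfolding sum_mod_periodic by simp
  finally have "real k * (real (lev r) * (\<Sum>u\<in>A. \<phi> (part r (l u)))) = real k * (real (card A) * (\<Sum>x<lev r. \<phi> x))"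
    by (simp add: k mult_ac)
  moreover have "k \<noteq> 0" using k lev_pos(1) [of s] by (metis less_irrefl mult_0)
  ultimately show ?thesis by simp
qed

text \<open>The digit \<open>sub r\<close> is equidistributed and independent of the lower digits
  collected in \<open>part r\<close>.\<close>

lemma uniform_sum_part_sub:
  fixes \<psi> \<theta> :: "nat \<Rightarrow> real"
  assumes "uniform s A l" "r < s"
  shows "real (lev (Suc r)) * (\<Sum>u\<in>A. \<psi> (part r (l u)) * \<theta> (sub r (l u)))
     = real (card A) * ((\<Sum>x<lev r. \<psi> x) * (\<Sum>t<code_size (lev r). \<theta> t))"
proof -
  define \<phi> where "\<phi> x = \<psi> (part r x) * \<theta> (sub r x)" for x
  have "real (lev (Suc r)) * (\<Sum>u\<in>A. \<phi> (part (Suc r) (l u))) = real (card A) * (\<Sum>x<lev (Suc r). \<phi> x)"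
    using assms by (intro uniform_sum_part) auto
  also have "(\<Sum>x<lev (Suc r). \<phi> x) = (\<Sum>t<code_size (lev r). \<Sum>x = t * lev r..<t * lev r + lev r. \<phi> x)"
    by (simp add: sum.nat_group)
  also have "\<dots> = (\<Sum>t<code_size (lev r). \<Sum>x<lev r. \<psi> x * \<theta> t)"
  proof (rule sum.cong [OF refl])
    fix t assume t: "t \<in> {..<code_size (lev r)}"
    have "(\<Sum>x = t * lev r..<t * lev r + lev r. \<phi> x) = (\<Sum>x<lev r. \<phi> (x + t * lev r))"
      using sum.shift_bounds_nat_ivl [of \<phi> 0 "t * lev r" "lev r"]
      by (simp add: add.commute atLeast0LessThan)
    also have "\<dots> = (\<Sum>x<lev r. \<psi> x * \<theta> t)"
      using t by (intro sum.cong) (auto simp: \<phi>_def part_def sub_def)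
    finally show "(\<Sum>x = t * lev r..<t * lev r + lev r. \<phi> x) = (\<Sum>x<lev r. \<psi> x * \<theta> t)" .
  qed
  also have "\<dots> = (\<Sum>x<lev r. \<psi> x) * (\<Sum>t<code_size (lev r). \<theta> t)"
    by (simp add: sum_distrib_left sum_distrib_right)
  finally show ?thesis by (simp add: \<phi>_def part_part sub_part)
qed

definition half_cell :: "'b set \<Rightarrow> ('b \<Rightarrow> nat) \<Rightarrow> nat \<Rightarrow> nat \<Rightarrow> nat \<Rightarrow> 'b set" where
  "half_cell B l r i j = {v \<in> B. part r (l v) = j \<and> i \<in> word (lev r) (sub r (l v))}"

lemma card_half_cell:
  assumes "uniform s B l" "r < s" "i < lev r" "j < lev r"
  shows "2 * real (lev r) * real (card (half_cell B l r i j)) = real (card B)"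
proof -
  let ?M = "code_size (lev r)"
  have fin: "finite B" using assms(1) by (simp add: uniform_def)
  have c: "2 * card {t. t < ?M \<and> i \<in> word (lev r) t} = ?M"
    using is_code_word [of "lev r"] assms(3) unfolding is_code_def by simp
  have "real (card (half_cell B l r i j))
      = (\<Sum>u\<in>B. of_bool (part r (l u) = j) * of_bool (i \<in> word (lev r) (sub r (l u))))"
    using fin unfolding half_cell_def of_bool_conj [symmetric] by (simp add: of_bool_def flip: sum.inter_filter)
  then have "real (lev (Suc r)) * real (card (half_cell B l r i j))
     = real (card B) * ((\<Sum>x<lev r. of_bool (x = j)) * (\<Sum>t<?M. of_bool (i \<in> word (lev r) t)))"
    using uniform_sum_part_sub [OF assms(1,2), of "\<lambda>x. of_bool (x = j)" "\<lambda>t. of_bool (i \<in> word (lev r) t)"] by simp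
  also have "(\<Sum>x<lev r. of_bool (x = j)) = (1::real)"
    using assms(4) by (simp add: of_bool_def)
  also have "(\<Sum>t<?M. of_bool (i \<in> word (lev r) t)) = real (card {t. t < ?M \<and> i \<in> word (lev r) t})"
    by (simp add: of_bool_def flip: sum.inter_filter)
  finally have "real ?M * (2 * real (lev r) * real (card (half_cell B l r i j)))
     = real (card B) * real (2 * card {t. t < ?M \<and> i \<in> word (lev r) t})" by simp
  then show ?thesis unfolding c by (simp add: code_size_def)
qed

text \<open>A level-\<open>r\<close> half cell is a union of cells of any higher level
  \<open>r'\<close>, and within each of these the bits of the subcell codewords are
  balanced.\<close>

lemma sum_g_lev_half_cell_above:
  assumes "uniform s B l" "r < r'" "r' < s"
  shows "(\<Sum>v\<in>half_cell B l r i j. g_lev r' x (l v)) = 0"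
proof -
  have fin: "finite B" using assms(1) by (simp add: uniform_def)
  define \<psi> where "\<psi> y = of_bool (part r y = j \<and> i \<in> word (lev r) (sub r y)) * sgn_bit r' (sub r' x) y" for y
  have "(\<Sum>v\<in>half_cell B l r i j. g_lev r' x (l v))
      = (\<Sum>v\<in>B. of_bool (part r (l v) = j \<and> i \<in> word (lev r) (sub r (l v))) * g_lev r' x (l v))"
    unfolding half_cell_def sum.inter_filter [OF fin] by (intro sum.cong) auto
  also have "\<dots> = (\<Sum>v\<in>B. \<psi> (part r' (l v)) * sgn_bit r' (sub r' (l v)) (part r' x))"
    using assms(2) by (intro sum.cong) (auto simp: \<psi>_def g_lev_def part_part sub_part)
  finally have "real (lev (Suc r')) * (\<Sum>v\<in>half_cell B l r i j. g_lev r' x (l v)) = 0"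
    using uniform_sum_part_sub [OF assms(1,3), of \<psi> "\<lambda>t. sgn_bit r' t (part r' x)"] by (simp add: sum_sgn_bit)
  then show ?thesis by (simp del: lev.simps)
qed

lemma g_lev_below:
  assumes "part r x = part r x'" "r' < r"
  shows "g_lev r' x y = g_lev r' x' y"
proof -
  have "part r' x = part r' x'" "sub r' x = sub r' x'"
    using assms part_part [of r' r] sub_part [of r' r] by (metis less_imp_le)+
  then show ?thesis by (simp add: g_lev_def)
qed

text \<open>Levels below \<open>r\<close> do not distinguish \<open>x\<close> from \<open>x'\<close>, levels above \<open>r\<close> average out over the half cell.\<close>

lemma h_sum_half_cell_diff:
  assumes B: "uniform s B l" and r: "r < s" and x: "part r x = i" "part r x' = i" and j: "j < lev r"
    and "j \<in> word (lev r) (sub r x)" "j \<notin> word (lev r) (sub r x')"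
  shows "(\<Sum>v\<in>half_cell B l r i j. h_sum s x (l v) - h_sum s x' (l v)) = real (card B) / real (lev r)"
proof -
  let ?T = "half_cell B l r i j"
  have "(\<Sum>v\<in>?T. g_lev r' x (l v) - g_lev r' x' (l v)) = (if r' = r then 2 * real (card ?T) else 0)"
    if "r' < s" for r'
  proof (cases r' r rule: linorder_cases)
    case less
    then show ?thesis using g_lev_below [of r x x' r'] x by simp
  next
    case equal
    have "(\<Sum>v\<in>?T. g_lev r x (l v) - g_lev r x' (l v)) = (\<Sum>v\<in>?T. 2)"
      using assms by (intro sum.cong) (auto simp: half_cell_def g_lev_def sgn_bit_def)
    then show ?thesis using equal by simp
  next
    case greater
    then show ?thesis using sum_g_lev_half_cell_above [OF B greater that] by (simp add: sum_subtractf)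
  qed
  then have "(\<Sum>r'<s. \<Sum>v\<in>?T. g_lev r' x (l v) - g_lev r' x' (l v)) = (\<Sum>r'<s. if r' = r then 2 * real (card ?T) else 0)"
    by (intro sum.cong) auto
  also have "\<dots> = 2 * real (card ?T)" using r by simp
  also have "\<dots> = real (card B) / real (lev r)"
    using card_half_cell [OF B r _ j, of i] x by (auto simp: field_simps)
  also have "(\<Sum>r'<s. \<Sum>v\<in>?T. g_lev r' x (l v) - g_lev r' x' (l v)) = (\<Sum>v\<in>?T. h_sum s x (l v) - h_sum s x' (l v))"
    unfolding h_sum_def by (subst sum.swap) (simp add: sum_subtractf)
  finally show ?thesis .
qed

subsection \<open>Regular partitions follow the nested partitions\<close>

definition cell :: "nat \<Rightarrow> 'a set \<Rightarrow> ('a \<Rightarrow> nat) \<Rightarrow> nat \<Rightarrow> 'a set" where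
  "cell r Z l i = {u \<in> Z. part r (l u) = i}"

text \<open>Alignment of \<open>Z\<close> with the level-\<open>r\<close> partition, as a size and
  not a proportion, so that it can be added up over the parts.\<close>

definition plurality :: "nat \<Rightarrow> 'a set \<Rightarrow> ('a \<Rightarrow> nat) \<Rightarrow> nat" where
  "plurality r Z l = Max ((\<lambda>i. card (cell r Z l i)) ` {..<lev r})"

lemma card_cell_le_plurality: "i < lev r \<Longrightarrow> card (cell r Z l i) \<le> plurality r Z l"
  unfolding plurality_def by (rule Max_ge) auto

lemma plurality_attained: "\<exists>i<lev r. plurality r Z l = card (cell r Z l i)"
proof -
  have "plurality r Z l \<in> (\<lambda>i. card (cell r Z l i)) ` {..<lev r}"
    unfolding plurality_def by (rule Max_in) (auto simp: lessThan_empty_iff)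
  then show ?thesis by auto
qed

lemma plurality_le_card: "finite Z \<Longrightarrow> plurality r Z l \<le> card Z"
  using plurality_attained [of r Z l] by (auto simp: cell_def intro!: card_mono)

lemma plurality_le_uniform:
  assumes "uniform s A l" "Z \<subseteq> A"
  shows "plurality s Z l * lev s \<le> card A"
proof -
  have fin: "finite A" using assms(1) by (simp add: uniform_def)
  obtain i where i: "i < lev s" "plurality s Z l = card (cell s Z l i)"
    using plurality_attained by blast
  have "cell s Z l i \<subseteq> {u \<in> A. l u = i}"
    using assms unfolding uniform_def cell_def part_def by auto
  then have "card (cell s Z l i) \<le> card {u \<in> A. l u = i}" using fin by (intro card_mono) auto
  then have "plurality s Z l * lev s \<le> card {u \<in> A. l u = i} * lev s" using i by simp
  also have "\<dots> = card A" using assms(1) i(1) unfolding uniform_def by blast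
  finally show ?thesis .
qed

text \<open>Double counting: two points in different subcells are separated by at least \<open>m/8\<close> of the \<open>m\<close> bits.\<close>

lemma sum_split_products:
  fixes P :: "'a set" and t :: "'a \<Rightarrow> nat"
  assumes fin: "finite P" and m: "1 \<le> m" and t: "\<And>u. u \<in> P \<Longrightarrow> t u < code_size m"
    and a: "\<And>c. card {u \<in> P. t u = c} \<le> a"
  shows "real m * (real (card P) * (real (card P) - real a))
    \<le> 16 * (\<Sum>j<m. real (card {u \<in> P. j \<in> word m (t u)}) * real (card {u \<in> P. j \<notin> word m (t u)}))"
proof -
  define W where "W u = word m (t u)" for u
  have code: "is_code m (word m)" using is_code_word m by simp
  have Wm: "W u \<subseteq> {..<m}" if "u \<in> P" for u using code t [OF that] by (simp add: is_code_def W_def)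
  have dist: "real m \<le> 8 * real (hamming (W u) (W u'))" if "u \<in> P" "u' \<in> P" "t u \<noteq> t u'" for u u'
  proof -
    have "m \<le> 8 * hamming (W u) (W u')"
      using code t [OF that(1)] t [OF that(2)] that(3) unfolding is_code_def W_def by blast
    then show ?thesis by linarith
  qed
  have ham: "(\<Sum>j<m. of_bool (j \<in> W u \<and> j \<notin> W u') + of_bool (j \<in> W u' \<and> j \<notin> W u)) = real (hamming (W u) (W u'))"
    if "u \<in> P" "u' \<in> P" for u u'
  proof -
    have "(\<Sum>j<m. of_bool (j \<in> W u \<and> j \<notin> W u') + of_bool (j \<in> W u' \<and> j \<notin> W u))
        = (\<Sum>j<m. if j \<in> (W u - W u') \<union> (W u' - W u) then 1 else (0::real))"
      by (intro sum.cong) auto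
    also have "\<dots> = real (card ({..<m} \<inter> ((W u - W u') \<union> (W u' - W u))))"
      by (subst sum.inter_restrict [symmetric]) auto
    also have "{..<m} \<inter> ((W u - W u') \<union> (W u' - W u)) = (W u - W u') \<union> (W u' - W u)"
      using Wm that by blast
    finally show ?thesis by (simp add: hamming_def)
  qed
  have prod: "real (card {u \<in> P. j \<in> W u}) * real (card {u \<in> P. j \<notin> W u})
      = (\<Sum>u\<in>P. \<Sum>u'\<in>P. of_bool (j \<in> W u \<and> j \<notin> W u'))" for j
  proof -
    have "(\<Sum>u\<in>P. \<Sum>u'\<in>P. of_bool (j \<in> W u \<and> j \<notin> W u') :: real)
       = (\<Sum>u\<in>P. of_bool (j \<in> W u)) * (\<Sum>u'\<in>P. of_bool (j \<notin> W u'))"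
      by (simp only: sum_product of_bool_conj)
    then show ?thesis using fin by (simp add: of_bool_def flip: sum.inter_filter)
  qed
  define \<Sigma> where "\<Sigma> = (\<Sum>j<m. real (card {u \<in> P. j \<in> W u}) * real (card {u \<in> P. j \<notin> W u}))"
  have "2 * \<Sigma> = (\<Sum>j<m. \<Sum>u\<in>P. \<Sum>u'\<in>P. of_bool (j \<in> W u \<and> j \<notin> W u'))
     + (\<Sum>j<m. \<Sum>u\<in>P. \<Sum>u'\<in>P. of_bool (j \<in> W u' \<and> j \<notin> W u))"
  proof -
    have "(\<Sum>u\<in>P. \<Sum>u'\<in>P. of_bool (j \<in> W u' \<and> j \<notin> W u))
        = (\<Sum>u\<in>P. \<Sum>u'\<in>P. of_bool (j \<in> W u \<and> j \<notin> W u') :: real)" for j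
      by (rule sum.swap)
    then show ?thesis by (simp add: \<Sigma>_def prod)
  qed
  also have "\<dots> = (\<Sum>u\<in>P. \<Sum>u'\<in>P. \<Sum>j<m. of_bool (j \<in> W u \<and> j \<notin> W u') + of_bool (j \<in> W u' \<and> j \<notin> W u))"
    unfolding sum.distrib by (subst (1 2) sum.swap, subst (1 2) sum.swap [of _ P "{..<m}"]) simp
  also have "\<dots> = (\<Sum>u\<in>P. \<Sum>u'\<in>P. real (hamming (W u) (W u')))"
    using ham by (intro sum.cong) auto
  finally have sig: "2 * \<Sigma> = (\<Sum>u\<in>P. \<Sum>u'\<in>P. real (hamming (W u) (W u')))" .
  have "real m * (real (card P) - real a) \<le> 8 * (\<Sum>u'\<in>P. real (hamming (W u) (W u')))" if u: "u \<in> P" for u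
  proof -
    have "real (card P) - real a \<le> real (card P) - real (card {u' \<in> P. t u' = t u})" using a by simp
    also have "\<dots> = (\<Sum>u'\<in>P. 1 - of_bool (t u' = t u))"
      using fin by (simp add: sum_subtractf of_bool_def flip: sum.inter_filter)
    finally have "real m * (real (card P) - real a) \<le> real m * (\<Sum>u'\<in>P. 1 - of_bool (t u' = t u))"
      by (intro mult_left_mono) auto
    also have "\<dots> \<le> (\<Sum>u'\<in>P. 8 * real (hamming (W u) (W u')))"
      unfolding sum_distrib_left
      by (intro sum_mono) (use dist [OF u] in \<open>auto simp: of_bool_def\<close>)
    finally show ?thesis by (simp add: sum_distrib_left)
  qed
  then have "(\<Sum>u\<in>P. real m * (real (card P) - real a)) \<le> (\<Sum>u\<in>P. 8 * (\<Sum>u'\<in>P. real (hamming (W u) (W u'))))"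
    by (rule sum_mono)
  also have "\<dots> = 16 * \<Sigma>" using sig by (simp add: sum_distrib_left [symmetric])
  finally show ?thesis by (simp add: \<Sigma>_def W_def mult_ac)
qed

text \<open>One side of the split contains the subcell \<open>c\<close>, so the other has at most
  \<open>card P - a\<close> points. The factor \<open>card P - a\<close> matches the one in
  \<open>sum_split_products\<close>, which lets the cost of displaced points be absorbed
  there.\<close>

lemma split_product_le:
  fixes P :: "'a set" and t :: "'a \<Rightarrow> nat"
  assumes fin: "finite P" and c: "card {u \<in> P. t u = c} = a"
  shows "real (card {u \<in> P. Q (t u)}) * real (card {u \<in> P. \<not> Q (t u)}) \<le> real (card P) * (real (card P) - real a)"
proof -
  have tot: "card {u \<in> P. Q (t u)} + card {u \<in> P. \<not> Q (t u)} = card P"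
    using fin by (subst card_Un_disjoint [symmetric]) (auto intro: arg_cong [where f=card])
  have "a \<le> card {u \<in> P. Q (t u)}" if "Q c"
    unfolding c [symmetric] using fin that by (intro card_mono) auto
  moreover have "a \<le> card {u \<in> P. \<not> Q (t u)}" if "\<not> Q c"
    unfolding c [symmetric] using fin that by (intro card_mono) auto
  ultimately consider "a \<le> card {u \<in> P. Q (t u)}" | "a \<le> card {u \<in> P. \<not> Q (t u)}" by blast
  then show ?thesis
  proof cases
    case 1
    then show ?thesis using tot by (intro mult_mono) linarith+
  next
    case 2
    then have "real (card {u \<in> P. \<not> Q (t u)}) * real (card {u \<in> P. Q (t u)}) \<le> real (card P) * (real (card P) - real a)"
      using tot by (intro mult_mono) linarith+
    then show ?thesis by (simp add: mult.commute)
  qed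
qed

definition plur_index :: "nat \<Rightarrow> 'a set \<Rightarrow> ('a \<Rightarrow> nat) \<Rightarrow> nat" where
  "plur_index r Z l = (SOME i. i < lev r \<and> plurality r Z l = card (cell r Z l i))"

lemma plur_index: "plur_index r Z l < lev r" "card (cell r Z l (plur_index r Z l)) = plurality r Z l"
  using someI_ex [OF plurality_attained [of r Z l]] unfolding plur_index_def by simp_all

text \<open>Indexed families are used because the preimages of distinct parts may both be empty and
  because both sides have to share the index set.\<close>

definition family_on :: "'k set \<Rightarrow> ('k \<Rightarrow> 'a set) \<Rightarrow> 'a set \<Rightarrow> bool" where
  "family_on K W B \<longleftrightarrow> finite K \<and> finite B \<and> (\<Union>k\<in>K. W k) = B \<and> disjoint_family_on W K"

definition displaced :: "nat \<Rightarrow> 'k set \<Rightarrow> ('k \<Rightarrow> 'b set) \<Rightarrow> 'b set \<Rightarrow> ('b \<Rightarrow> nat) \<Rightarrow> nat \<Rightarrow> 'b set" where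
  "displaced r K W B l j = {v \<in> B. part r (l v) = j \<and> (\<forall>k\<in>K. v \<in> W k \<longrightarrow> plur_index r (W k) l \<noteq> j)}"

lemma sum_card_displaced:
  assumes "family_on K W B"
  shows "(\<Sum>j<lev r. real (card (displaced r K W B l j))) = real (card B) - (\<Sum>k\<in>K. real (plurality r (W k) l))"
proof -
  have fin: "finite K" "finite B" "\<And>k. k \<in> K \<Longrightarrow> W k \<subseteq> B" "disjoint_family_on W K" "(\<Union>k\<in>K. W k) = B"
    using assms unfolding family_on_def by auto
  define C where "C k = cell r (W k) l (plur_index r (W k) l)" for k
  have CW: "C k \<subseteq> W k" for k by (auto simp: C_def cell_def)
  have CB: "(\<Union>k\<in>K. C k) \<subseteq> B" using CW fin(3) by blast
  have finC: "finite (C k)" if "k \<in> K" for k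
    using CW [of k] fin(3) [OF that] fin(2) by (meson finite_subset)
  have "(\<Sum>j<lev r. card (displaced r K W B l j)) = card (\<Union>j<lev r. displaced r K W B l j)"
    using fin(2) by (intro card_UN_disjoint [symmetric]) (auto simp: displaced_def)
  also have "(\<Union>j<lev r. displaced r K W B l j) = B - (\<Union>k\<in>K. C k)"
  proof (intro equalityI subsetI)
    fix v assume "v \<in> (\<Union>j<lev r. displaced r K W B l j)"
    then show "v \<in> B - (\<Union>k\<in>K. C k)" by (auto simp: displaced_def C_def cell_def)
  next
    fix v assume v: "v \<in> B - (\<Union>k\<in>K. C k)"
    then have "v \<in> displaced r K W B l (part r (l v))" by (auto simp: displaced_def C_def cell_def)
    then show "v \<in> (\<Union>j<lev r. displaced r K W B l j)" by auto
  qed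
  also have "card (B - (\<Union>k\<in>K. C k)) = card B - card (\<Union>k\<in>K. C k)"
    by (rule card_Diff_subset [OF finite_subset [OF CB fin(2)] CB])
  also have "card (\<Union>k\<in>K. C k) = (\<Sum>k\<in>K. card (C k))"
  proof (rule card_UN_disjoint [OF fin(1)])
    show "\<forall>k\<in>K. \<forall>k'\<in>K. k \<noteq> k' \<longrightarrow> C k \<inter> C k' = {}"
      using fin(4) CW unfolding disjoint_family_on_def by blast
  qed (use finC in blast)
  finally have "(\<Sum>j<lev r. card (displaced r K W B l j)) = card B - (\<Sum>k\<in>K. plurality r (W k) l)"
    by (simp add: C_def plur_index(2))
  moreover have "(\<Sum>k\<in>K. plurality r (W k) l) \<le> card B"
  proof -
    have "(\<Sum>k\<in>K. plurality r (W k) l) \<le> (\<Sum>k\<in>K. card (W k))"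
      using fin by (intro sum_mono plurality_le_card) (auto intro: finite_subset)
    also have "\<dots> = card (\<Union>k\<in>K. W k)"
      using fin by (intro card_UN_disjoint [symmetric]) (auto simp: disjoint_family_on_def intro: finite_subset)
    finally show ?thesis using fin by simp
  qed
  ultimately show ?thesis by (simp add: of_nat_diff flip: of_nat_sum)
qed

text \<open>\<open>P\<close> is tested against the half cell \<open>T\<close>. Two points of
  \<open>P\<close> that differ in bit \<open>j\<close> have totals over \<open>T\<close> differing
  by \<open>card B / lev r\<close>. On a single part, however, the totals of the two halves of
  \<open>P\<close>, each weighted by the size of the other half, cancel up to
  \<open>card P * D k\<close>, because \<open>d k\<close> is common to both. Only parts with
  plurality cell \<open>j\<close> are used; the remaining points of \<open>T\<close> are displaced
  and cost at most \<open>2 * s\<close> each.\<close>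

lemma split_cell_bound:
  fixes d D :: "'k \<Rightarrow> real" and P :: "'a set" and B :: "'b set"
  assumes B: "uniform s B lb" and r: "r < s" and W: "family_on K W B"
    and P: "finite P" "\<And>u. u \<in> P \<Longrightarrow> part r (la u) = i" and j: "j < lev r"
    and reg: "\<And>k S T. k \<in> K \<Longrightarrow> S \<subseteq> P \<Longrightarrow> T \<subseteq> W k \<Longrightarrow>
        \<bar>(\<Sum>u\<in>S. \<Sum>v\<in>T. h_sum s (la u) (lb v)) - d k * real (card S) * real (card T)\<bar> \<le> D k"
  shows "real (card {u \<in> P. j \<in> word (lev r) (sub r (la u))}) * real (card {u \<in> P. j \<notin> word (lev r) (sub r (la u))})
      * (real (card B) / real (lev r) - 2 * real s * real (card (displaced r K W B lb j)))
      \<le> real (card P) * (\<Sum>k | k \<in> K \<and> plur_index r (W k) lb = j. D k)"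
proof -
  define Pp where "Pp = {u \<in> P. j \<in> word (lev r) (sub r (la u))}"
  define Pm where "Pm = {u \<in> P. j \<notin> word (lev r) (sub r (la u))}"
  define T where "T = half_cell B lb r i j"
  define Kj where "Kj = {k \<in> K. plur_index r (W k) lb = j}"
  define Mis where "Mis = displaced r K W B lb j"
  define h where "h u v = h_sum s (la u) (lb v)" for u v
  have finB: "finite B" and finK: "finite K" and UW: "(\<Union>k\<in>K. W k) = B" and dW: "disjoint_family_on W K"
    using W unfolding family_on_def by auto
  have finKj: "finite Kj" using finK by (simp add: Kj_def)
  have finT: "finite T" using finB by (simp add: T_def half_cell_def)
  have cP: "card Pp + card Pm = card P"
    unfolding Pp_def Pm_def using P(1) by (subst card_Un_disjoint [symmetric]) (auto intro: arg_cong [where f=card])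
  have split: "(\<Sum>v\<in>T. \<phi> v) = (\<Sum>k\<in>Kj. \<Sum>v\<in>T \<inter> W k. \<phi> v) + (\<Sum>v\<in>T \<inter> Mis. \<phi> v)" for \<phi> :: "'b \<Rightarrow> real"
  proof -
    have TU: "T = (\<Union>k\<in>Kj. T \<inter> W k) \<union> (T \<inter> Mis)"
    proof (intro equalityI subsetI)
      fix v assume v: "v \<in> T"
      then have vB: "v \<in> B" "part r (lb v) = j" by (auto simp: T_def half_cell_def)
      show "v \<in> (\<Union>k\<in>Kj. T \<inter> W k) \<union> (T \<inter> Mis)"
        using v vB unfolding Kj_def Mis_def displaced_def by auto
    qed auto
    have disj: "(\<Union>k\<in>Kj. T \<inter> W k) \<inter> (T \<inter> Mis) = {}"
      unfolding Kj_def Mis_def displaced_def by auto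
    have "(\<Sum>v\<in>T. \<phi> v) = (\<Sum>v\<in>(\<Union>k\<in>Kj. T \<inter> W k). \<phi> v) + (\<Sum>v\<in>T \<inter> Mis. \<phi> v)"
      by (subst TU, rule sum.union_disjoint [OF _ _ disj]) (use finKj finT in auto)
    also have "(\<Sum>v\<in>(\<Union>k\<in>Kj. T \<inter> W k). \<phi> v) = (\<Sum>k\<in>Kj. \<Sum>v\<in>T \<inter> W k. \<phi> v)"
      by (rule sum.UNION_disjoint) (use finKj finT dW in \<open>auto simp: disjoint_family_on_def Kj_def\<close>)
    finally show ?thesis .
  qed
  have pair: "real (card B) / real (lev r) - 2 * real s * real (card Mis) \<le> (\<Sum>k\<in>Kj. \<Sum>v\<in>T \<inter> W k. h u v - h u' v)"
    if "u \<in> Pp" "u' \<in> Pm" for u u'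
  proof -
    have "(\<Sum>v\<in>T. h u v - h u' v) = real (card B) / real (lev r)"
      unfolding T_def h_def
      by (rule h_sum_half_cell_diff [OF B r _ _ j]) (use that P(2) in \<open>auto simp: Pp_def Pm_def\<close>)
    moreover have "(\<Sum>v\<in>T \<inter> Mis. h u v - h u' v) \<le> (\<Sum>v\<in>T \<inter> Mis. 2 * real s)"
    proof (rule sum_mono)
      fix v
      show "h u v - h u' v \<le> 2 * real s"
        using abs_h_sum_le [of s "la u" "lb v"] abs_h_sum_le [of s "la u'" "lb v"] unfolding h_def by linarith
    qed
    moreover have "(\<Sum>v\<in>T \<inter> Mis. 2 * real s) \<le> 2 * real s * real (card Mis)"
    proof -
      have "card (T \<inter> Mis) \<le> card Mis" using finB by (intro card_mono) (auto simp: Mis_def displaced_def)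
      then show ?thesis by (simp add: mult_left_mono mult.commute)
    qed
    ultimately show ?thesis using split [of "\<lambda>v. h u v - h u' v"] by linarith
  qed
  have one: "(\<Sum>u\<in>Pp. \<Sum>u'\<in>Pm. \<Sum>v\<in>T \<inter> W k. h u v - h u' v) \<le> real (card P) * D k" if k: "k \<in> Kj" for k
  proof -
    define X where "X S = (\<Sum>u\<in>S. \<Sum>v\<in>T \<inter> W k. h u v)" for S
    define n where "n = real (card (T \<inter> W k))"
    have sub: "Pp \<subseteq> P" "Pm \<subseteq> P" "T \<inter> W k \<subseteq> W k" "k \<in> K" using k by (auto simp: Pp_def Pm_def Kj_def)
    have 1: "\<bar>X Pp - d k * real (card Pp) * n\<bar> \<le> D k" "\<bar>X Pm - d k * real (card Pm) * n\<bar> \<le> D k"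
      using reg [OF sub(4,1,3)] reg [OF sub(4,2,3)] by (simp_all add: X_def n_def h_def)
    have "(\<Sum>u\<in>Pp. \<Sum>u'\<in>Pm. \<Sum>v\<in>T \<inter> W k. h u v - h u' v) = real (card Pm) * X Pp - real (card Pp) * X Pm"
      by (simp add: X_def sum_subtractf sum_distrib_left)
    also have "\<dots> \<le> real (card Pm) * (d k * real (card Pp) * n + D k) - real (card Pp) * (d k * real (card Pm) * n - D k)"
      using 1 by (intro diff_mono mult_left_mono) linarith+
    also have "\<dots> = real (card Pp + card Pm) * D k" by (simp add: algebra_simps)
    finally show ?thesis unfolding cP .
  qed
  have "real (card Pp) * real (card Pm) * (real (card B) / real (lev r) - 2 * real s * real (card Mis))
     = (\<Sum>u\<in>Pp. \<Sum>u'\<in>Pm. real (card B) / real (lev r) - 2 * real s * real (card Mis))" by simp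
  also have "\<dots> \<le> (\<Sum>u\<in>Pp. \<Sum>u'\<in>Pm. \<Sum>k\<in>Kj. \<Sum>v\<in>T \<inter> W k. h u v - h u' v)"
    using pair by (intro sum_mono)
  also have "\<dots> = (\<Sum>u\<in>Pp. \<Sum>k\<in>Kj. \<Sum>u'\<in>Pm. \<Sum>v\<in>T \<inter> W k. h u v - h u' v)"
    by (intro sum.cong refl sum.swap)
  also have "\<dots> = (\<Sum>k\<in>Kj. \<Sum>u\<in>Pp. \<Sum>u'\<in>Pm. \<Sum>v\<in>T \<inter> W k. h u v - h u' v)"
    by (rule sum.swap)
  also have "\<dots> \<le> (\<Sum>k\<in>Kj. real (card P) * D k)"
    using one by (intro sum_mono)
  finally show ?thesis by (simp add: Pp_def Pm_def Kj_def Mis_def sum_distrib_left)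
qed

text \<open>\<open>P\<close> is the plurality cell of \<open>Z\<close> and \<open>a\<close> the size
  of its largest subcell, which lies in a level-\<open>(r+1)\<close> cell. Summing the split bounds
  over all bits bounds \<open>p - a\<close>; by \<open>mis\<close> the displaced points account for
  at most half of the left side, and moving that half over turns \<open>16\<close> into
  \<open>32\<close>.\<close>

lemma refine_single_part:
  fixes d D :: "'k \<Rightarrow> real"
  assumes B: "uniform s B lb" and r: "r < s" and W: "family_on K W B" and Z: "finite Z"
    and reg: "\<And>k S T. k \<in> K \<Longrightarrow> S \<subseteq> Z \<Longrightarrow> T \<subseteq> W k \<Longrightarrow>
        \<bar>(\<Sum>u\<in>S. \<Sum>v\<in>T. h_sum s (la u) (lb v)) - d k * real (card S) * real (card T)\<bar> \<le> D k"
    and mis: "64 * real s * (real (card B) - (\<Sum>k\<in>K. real (plurality r (W k) lb))) \<le> real (card B)"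
  shows "(real (plurality r Z la) - real (plurality (Suc r) Z la)) * real (card B) \<le> 32 * (\<Sum>k\<in>K. D k)"
proof -
  have D0: "0 \<le> D k" if "k \<in> K" for k using reg [OF that, of "{}" "{}"] by simp
  define i where "i = plur_index r Z la"
  define P where "P = cell r Z la i"
  define m where "m = lev r"
  define a where "a = Max ((\<lambda>c. card {u \<in> P. sub r (la u) = c}) ` {..<code_size m})"
  have finP: "finite P" using Z by (simp add: P_def cell_def)
  have cP: "card P = plurality r Z la" by (simp add: P_def i_def plur_index(2))
  have im: "i < m" by (simp add: i_def m_def plur_index(1))
  have "a \<in> (\<lambda>c. card {u \<in> P. sub r (la u) = c}) ` {..<code_size m}"
    unfolding a_def by (rule Max_in) (auto simp: lessThan_empty_iff)
  then obtain c where c: "c < code_size m" "card {u \<in> P. sub r (la u) = c} = a" by auto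
  have a_max: "card {u \<in> P. sub r (la u) = c'} \<le> a" for c'
  proof (cases "c' < code_size m")
    case True
    then show ?thesis unfolding a_def by (intro Max_ge) auto
  next
    case False
    then have "{u \<in> P. sub r (la u) = c'} = {}" using sub_less by (auto simp: m_def)
    then show ?thesis by (simp only: card.empty zero_le)
  qed
  have "a \<le> card (cell (Suc r) Z la (i + m * c))"
    unfolding c(2) [symmetric]
    by (intro card_mono) (use Z in \<open>auto simp: P_def cell_def part_Suc m_def\<close>)
  also have "\<dots> \<le> plurality (Suc r) Z la"
  proof (rule card_cell_le_plurality)
    have "i + m * c < m + m * c" using im by simp
    also have "\<dots> = m * Suc c" by simp
    also have "\<dots> \<le> m * code_size m" using c(1) by (intro mult_le_mono2) simp
    finally show "i + m * c < lev (Suc r)" by (simp add: m_def mult.commute)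
  qed
  finally have a_le: "a \<le> plurality (Suc r) Z la" .
  define p where "p = real (card P)"
  define N where "N = real (card B)"
  define Mis where "Mis j = real (card (displaced r K W B lb j))" for j
  define pp where "pp j = real (card {u \<in> P. j \<in> word m (sub r (la u))}) * real (card {u \<in> P. j \<notin> word m (sub r (la u))})" for j
  have ap: "real a \<le> p" unfolding p_def c(2) [symmetric] using finP by (auto intro!: card_mono)
  have finK: "finite K" using W by (simp add: family_on_def)
  have pp_le: "pp j \<le> p * (p - real a)" for j
    unfolding pp_def p_def by (rule split_product_le [OF finP c(2)])
  have lower: "real m * (p * (p - real a)) \<le> 16 * (\<Sum>j<m. pp j)"
    unfolding pp_def p_def using finP a_max by (intro sum_split_products) (auto simp: m_def)
  have each: "pp j * (N / real m - 2 * real s * Mis j) \<le> p * (\<Sum>k | k \<in> K \<and> plur_index r (W k) lb = j. D k)" if "j < m" for j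
    unfolding pp_def N_def Mis_def p_def m_def
  proof (rule split_cell_bound [OF B r W finP, where i = i and d = d])
    show "part r (la u) = i" if "u \<in> P" for u using that by (simp add: P_def cell_def)
    show "j < lev r" using that by (simp add: m_def)
    fix k S T assume kST: "k \<in> K" "S \<subseteq> P" "T \<subseteq> W k"
    have "S \<subseteq> Z" using kST(2) by (auto simp: P_def cell_def)
    from reg [OF kST(1) this kST(3)]
    show "\<bar>(\<Sum>u\<in>S. \<Sum>v\<in>T. h_sum s (la u) (lb v)) - d k * real (card S) * real (card T)\<bar> \<le> D k" .
  qed
  have "p * (p - real a) * N = (real m * (p * (p - real a))) * (N / real m)" by (simp add: m_def)
  also have "\<dots> \<le> 16 * (\<Sum>j<m. pp j) * (N / real m)"
    by (intro mult_right_mono lower) (simp add: N_def)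
  also have "\<dots> = 16 * (\<Sum>j<m. pp j * (N / real m))" by (simp only: sum_distrib_right mult.assoc)
  also have "\<dots> \<le> 16 * (\<Sum>j<m. p * (\<Sum>k | k \<in> K \<and> plur_index r (W k) lb = j. D k) + p * (p - real a) * (2 * real s * Mis j))"
  proof (intro mult_left_mono sum_mono)
    fix j assume j: "j \<in> {..<m}"
    have "pp j * (2 * real s * Mis j) \<le> p * (p - real a) * (2 * real s * Mis j)"
      by (intro mult_right_mono pp_le) (simp add: Mis_def)
    then show "pp j * (N / real m) \<le> p * (\<Sum>k | k \<in> K \<and> plur_index r (W k) lb = j. D k) + p * (p - real a) * (2 * real s * Mis j)"
      using each [of j] j by (simp add: right_diff_distrib)
  qed simp
  also have "\<dots> = 16 * (p * (\<Sum>j<m. \<Sum>k | k \<in> K \<and> plur_index r (W k) lb = j. D k)) + p * (p - real a) * (32 * real s * (\<Sum>j<m. Mis j))"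
    by (simp only: sum.distrib sum_distrib_left [symmetric]) (simp add: algebra_simps)
  \<comment> \<open>Every part has exactly one plurality cell, so no factor \<open>m\<close> appears
    here.\<close>
  also have "(\<Sum>j<m. \<Sum>k | k \<in> K \<and> plur_index r (W k) lb = j. D k) = (\<Sum>k\<in>K. D k)"
    by (rule sum.group) (use finK plur_index(1) in \<open>auto simp: m_def\<close>)
  also have "p * (p - real a) * (32 * real s * (\<Sum>j<m. Mis j)) \<le> p * (p - real a) * (N / 2)"
  proof (rule mult_left_mono)
    have "64 * real s * (\<Sum>j<m. Mis j) \<le> N"
      using mis unfolding Mis_def m_def sum_card_displaced [OF W] N_def .
    then show "32 * real s * (\<Sum>j<m. Mis j) \<le> N / 2" by simp
    show "0 \<le> p * (p - real a)" using ap by (simp add: p_def)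
  qed
  finally have fin: "p * ((p - real a) * N) \<le> p * (32 * (\<Sum>k\<in>K. D k))" by (simp add: algebra_simps)
  have "(p - real a) * N \<le> 32 * (\<Sum>k\<in>K. D k)"
  proof (cases "p = 0")
    case True
    then have "(p - real a) * N \<le> 0" by (simp add: N_def)
    also have "0 \<le> 32 * (\<Sum>k\<in>K. D k)" using D0 by (simp add: sum_nonneg)
    finally show ?thesis .
  next
    case False
    then have "0 < p" by (simp add: p_def)
    then show ?thesis using fin by simp
  qed
  moreover have "(real (plurality r Z la) - real (plurality (Suc r) Z la)) * N \<le> (p - real a) * N"
    using a_le cP by (intro mult_right_mono) (auto simp: p_def N_def)
  ultimately show ?thesis unfolding N_def by linarith
qed

lemma family_on_card_sum:
  assumes "family_on K Z A"
  shows "(\<Sum>k\<in>K. card (Z k)) = card A"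
proof -
  have "finite (Z k)" if "k \<in> K" for k
    using assms that unfolding family_on_def by (metis UN_upper finite_subset)
  then have "card (\<Union>k\<in>K. Z k) = (\<Sum>k\<in>K. card (Z k))"
    using assms by (intro card_UN_disjoint) (auto simp: family_on_def disjoint_family_on_def)
  then show ?thesis using assms by (simp add: family_on_def)
qed

lemma plurality_0: "plurality 0 Z l = card Z"
proof -
  obtain i where i: "i < lev 0" "plurality 0 Z l = card (cell 0 Z l i)"
    using plurality_attained by blast
  have "cell 0 Z l i = Z" using i(1) by (auto simp: cell_def part_def)
  then show ?thesis using i(2) by simp
qed

lemma refine_step:
  fixes d D :: "'k \<Rightarrow> 'k \<Rightarrow> real"
  assumes B: "uniform s B lb" and r: "r < s" and ZA: "family_on K ZA A" and ZB: "family_on K ZB B"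
    and reg: "\<And>k k' S T. k \<in> K \<Longrightarrow> k' \<in> K \<Longrightarrow> S \<subseteq> ZA k \<Longrightarrow> T \<subseteq> ZB k' \<Longrightarrow>
        \<bar>(\<Sum>u\<in>S. \<Sum>v\<in>T. h_sum s (la u) (lb v)) - d k k' * real (card S) * real (card T)\<bar> \<le> D k k'"
    and mis: "64 * real s * (real (card B) - (\<Sum>k\<in>K. real (plurality r (ZB k) lb))) \<le> real (card B)"
    and Dsum: "(\<Sum>k\<in>K. \<Sum>k'\<in>K. D k k') \<le> \<delta> * real (card B)" and pos: "0 < card B"
  shows "(\<Sum>k\<in>K. real (plurality r (ZA k) la)) - (\<Sum>k\<in>K. real (plurality (Suc r) (ZA k) la)) \<le> 32 * \<delta>"
proof -
  have finZ: "finite (ZA k)" if "k \<in> K" for k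
    using ZA that unfolding family_on_def by (metis UN_upper finite_subset)
  have "((\<Sum>k\<in>K. real (plurality r (ZA k) la)) - (\<Sum>k\<in>K. real (plurality (Suc r) (ZA k) la))) * real (card B)
      = (\<Sum>k\<in>K. (real (plurality r (ZA k) la) - real (plurality (Suc r) (ZA k) la)) * real (card B))"
    by (simp only: sum_subtractf [symmetric] sum_distrib_right)
  also have "\<dots> \<le> (\<Sum>k\<in>K. 32 * (\<Sum>k'\<in>K. D k k'))"
  proof (rule sum_mono)
    fix k assume k: "k \<in> K"
    show "(real (plurality r (ZA k) la) - real (plurality (Suc r) (ZA k) la)) * real (card B) \<le> 32 * (\<Sum>k'\<in>K. D k k')"
      by (rule refine_single_part [OF B r ZB finZ [OF k], where d = "d k"]) (use reg [OF k] mis in simp_all)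
  qed
  also have "\<dots> = 32 * (\<Sum>k\<in>K. \<Sum>k'\<in>K. D k k')" by (simp add: sum_distrib_left)
  also have "\<dots> \<le> (32 * \<delta>) * real (card B)" using Dsum by simp
  finally show ?thesis using pos by simp
qed

text \<open>The induction treats both sides simultaneously, since \<open>refine_step\<close> for one
  side assumes alignment of the other. At level \<open>0\<close> there is one cell and nothing is
  lost. The constant \<open>2048 = 64 * 32\<close> keeps the accumulated loss within what
  \<open>mis\<close> permits.\<close>

lemma pluralities_survive:
  fixes d D :: "'k \<Rightarrow> 'k \<Rightarrow> real"
  assumes A: "uniform s A la" and B: "uniform s B lb" and n: "card A = n" "card B = n" "0 < n"
    and ZA: "family_on K ZA A" and ZB: "family_on K ZB B"
    and reg: "\<And>k k' S T. k \<in> K \<Longrightarrow> k' \<in> K \<Longrightarrow> S \<subseteq> ZA k \<Longrightarrow> T \<subseteq> ZB k' \<Longrightarrow>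
        \<bar>(\<Sum>u\<in>S. \<Sum>v\<in>T. h_sum s (la u) (lb v)) - d k k' * real (card S) * real (card T)\<bar> \<le> D k k'"
    and Dsum: "(\<Sum>k\<in>K. \<Sum>k'\<in>K. D k k') \<le> \<delta> * real n" and small: "2048 * real s ^ 2 * \<delta> \<le> real n"
    and \<delta>: "0 \<le> \<delta>" and r: "r \<le> s"
  shows "real n - (\<Sum>k\<in>K. real (plurality r (ZA k) la)) \<le> 32 * real r * \<delta> \<and>
         real n - (\<Sum>k\<in>K. real (plurality r (ZB k) lb)) \<le> 32 * real r * \<delta>"
  using r
proof (induction r)
  case 0
  show ?case
    using family_on_card_sum [OF ZA] family_on_card_sum [OF ZB] n
    by (simp add: plurality_0 flip: of_nat_sum)
next
  case (Suc r)
  then have r: "r < s" and IH: "real n - (\<Sum>k\<in>K. real (plurality r (ZA k) la)) \<le> 32 * real r * \<delta>"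
       "real n - (\<Sum>k\<in>K. real (plurality r (ZB k) lb)) \<le> 32 * real r * \<delta>" by auto
  have mis: "64 * real s * X \<le> real n" if "X \<le> 32 * real r * \<delta>" for X
  proof -
    have "64 * real s * X \<le> 64 * real s * (32 * real r * \<delta>)" using that by (intro mult_left_mono) auto
    also have "\<dots> \<le> 64 * real s * (32 * real s * \<delta>)" using r \<delta> by (intro mult_left_mono mult_right_mono) auto
    also have "\<dots> = 2048 * real s ^ 2 * \<delta>" by (simp add: power2_eq_square)
    finally show ?thesis using small by linarith
  qed
  have 1: "(\<Sum>k\<in>K. real (plurality r (ZA k) la)) - (\<Sum>k\<in>K. real (plurality (Suc r) (ZA k) la)) \<le> 32 * \<delta>"
    by (rule refine_step [OF B r ZA ZB, where d = d and D = D]) (use reg mis IH Dsum n in auto)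
  have reg': "\<bar>(\<Sum>u\<in>S. \<Sum>v\<in>T. h_sum s (lb u) (la v)) - d k' k * real (card S) * real (card T)\<bar> \<le> D k' k"
    if "k \<in> K" "k' \<in> K" "S \<subseteq> ZB k" "T \<subseteq> ZA k'" for k k' S T
  proof -
    have "(\<Sum>u\<in>S. \<Sum>v\<in>T. h_sum s (lb u) (la v)) = (\<Sum>v\<in>T. \<Sum>u\<in>S. h_sum s (la v) (lb u))"
      by (subst sum.swap) (simp add: h_sum_commute)
    then show ?thesis using reg [OF that(2,1,4,3)] by (simp add: mult_ac)
  qed
  have 2: "(\<Sum>k\<in>K. real (plurality r (ZB k) lb)) - (\<Sum>k\<in>K. real (plurality (Suc r) (ZB k) lb)) \<le> 32 * \<delta>"
  proof (rule refine_step [OF A r ZB ZA, where d = "\<lambda>k k'. d k' k" and D = "\<lambda>k k'. D k' k"])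
    show "(\<Sum>k\<in>K. \<Sum>k'\<in>K. D k' k) \<le> \<delta> * real (card A)" using Dsum n by (subst sum.swap) simp
  qed (use reg' mis IH n in auto)
  show ?case using 1 2 IH by (simp add: algebra_simps)
qed

text \<open>A level-\<open>s\<close> cell has only \<open>n / lev s\<close> points, which caps the
  plurality of every part, yet the pluralities still add up to at least
  \<open>n / 2\<close>.\<close>

lemma many_parts:
  fixes d D :: "'k \<Rightarrow> 'k \<Rightarrow> real"
  assumes A: "uniform s A la" and B: "uniform s B lb" and n: "card A = n" "card B = n" "0 < n" and s: "1 \<le> s"
    and ZA: "family_on K ZA A" and ZB: "family_on K ZB B"
    and reg: "\<And>k k' S T. k \<in> K \<Longrightarrow> k' \<in> K \<Longrightarrow> S \<subseteq> ZA k \<Longrightarrow> T \<subseteq> ZB k' \<Longrightarrow>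
        \<bar>(\<Sum>u\<in>S. \<Sum>v\<in>T. h_sum s (la u) (lb v)) - d k k' * real (card S) * real (card T)\<bar> \<le> D k k'"
    and Dsum: "(\<Sum>k\<in>K. \<Sum>k'\<in>K. D k k') \<le> \<delta> * real n" and small: "2048 * real s ^ 2 * \<delta> \<le> real n"
    and \<delta>: "0 \<le> \<delta>"
  shows "lev s \<le> 2 * card K"
proof -
  have "real n - (\<Sum>k\<in>K. real (plurality s (ZA k) la)) \<le> 32 * real s * \<delta>"
    using pluralities_survive [OF A B n ZA ZB reg Dsum small \<delta> le_refl] by blast
  also have "32 * real s * \<delta> \<le> 32 * (real s * real s) * \<delta>"
    using s \<delta> by (intro mult_right_mono mult_left_mono) (auto simp: mult_le_cancel_left1)
  also have "\<dots> \<le> real n / 2" using small \<delta> by (simp add: power2_eq_square)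
  finally have "real n \<le> 2 * (\<Sum>k\<in>K. real (plurality s (ZA k) la))" by simp
  then have "real n * real (lev s) \<le> 2 * (\<Sum>k\<in>K. real (plurality s (ZA k) la)) * real (lev s)"
    by (intro mult_right_mono) auto
  also have "\<dots> = 2 * (\<Sum>k\<in>K. real (plurality s (ZA k) la * lev s))"
    by (simp add: sum_distrib_right)
  also have "\<dots> \<le> 2 * (\<Sum>k\<in>K. real n)"
  proof (intro mult_left_mono sum_mono)
    fix k assume "k \<in> K"
    then have "ZA k \<subseteq> A" using ZA unfolding family_on_def by blast
    from plurality_le_uniform [OF A this] n(1)
    show "real (plurality s (ZA k) la * lev s) \<le> real n" by (simp only: of_nat_le_iff)
  qed simp
  finally have "real n * real (lev s) \<le> real n * real (2 * card K)" by (simp add: mult_ac)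
  then show ?thesis using n(3) by simp
qed

subsection \<open>Realisation as a graph and transfer to 3-graphs\<close>

text \<open>Distinct coordinates of a function in \<open>PiE\<close> are independent: the sum
  factorises, and the factor at \<open>a\<close> vanishes.\<close>

lemma sum_PiE_pairwise_orthogonal:
  fixes f f' :: "'b \<Rightarrow> real"
  assumes "finite I" "a \<in> I" "a' \<in> I" "a \<noteq> a'" "finite J" "(\<Sum>c\<in>J. f c) = 0"
  shows "(\<Sum>b\<in>PiE I (\<lambda>_. J). f (b a) * f' (b a')) = 0"
proof -
  define \<phi> where "\<phi> i = (if i = a then f else if i = a' then f' else (\<lambda>_. 1))" for i
  have "(\<Prod>i\<in>I. \<phi> i (b i)) = f (b a) * f' (b a')" for b
  proof -
    have "(\<Prod>i\<in>I. \<phi> i (b i)) = \<phi> a (b a) * (\<phi> a' (b a') * (\<Prod>i\<in>I - {a} - {a'}. \<phi> i (b i)))"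
      using assms by (simp add: prod.remove [of I a] prod.remove [of "I - {a}" a'])
    also have "(\<Prod>i\<in>I - {a} - {a'}. \<phi> i (b i)) = 1"
      by (intro prod.neutral) (auto simp: \<phi>_def)
    finally show ?thesis using assms(4) by (simp add: \<phi>_def)
  qed
  then have "(\<Sum>b\<in>PiE I (\<lambda>_. J). f (b a) * f' (b a')) = (\<Prod>i\<in>I. \<Sum>c\<in>J. \<phi> i c)"
    using prod_sum_PiE [of I "\<lambda>_. J" \<phi>] assms by simp
  also have "\<dots> = 0" using assms by (intro prod_zero) (auto simp: \<phi>_def intro!: bexI [of _ a])
  finally show ?thesis .
qed

lemma square_sum_le:
  fixes f :: "'a \<Rightarrow> real"
  shows "(sum f T)\<^sup>2 \<le> real (card T) * (\<Sum>v\<in>T. (f v)\<^sup>2)"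
proof (cases "finite T \<and> T \<noteq> {}")
  case True
  then have "real (card T) * (mean f T)\<^sup>2 \<le> (\<Sum>v\<in>T. (f v)\<^sup>2)"
    using sum_sq_diff_const [of T f 0] by (simp add: sum_nonneg)
  then have "real (card T) * (real (card T) * (mean f T)\<^sup>2) \<le> real (card T) * (\<Sum>v\<in>T. (f v)\<^sup>2)"
    by (rule mult_left_mono) simp
  moreover have "sum f T = real (card T) * mean f T" using True by (simp add: mean_def)
  ultimately show ?thesis by (simp add: power2_eq_square mult_ac)
qed auto

text \<open>Cauchy-Schwarz over \<open>v\<close>, then expansion of the square. Only pairs of rows
  in the same class of \<open>\<kappa>\<close> leave a contribution.\<close>

lemma bilinear_discrepancy:
  fixes F :: "'a \<Rightarrow> 'b \<Rightarrow> real"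
  assumes fin: "finite A" "finite B"
    and orth: "\<And>u u'. u \<in> A \<Longrightarrow> u' \<in> A \<Longrightarrow> (\<Sum>v\<in>B. F u v * F u' v) \<le> (if \<kappa> u = \<kappa> u' then c else 0)"
    and c: "0 \<le> c" and ST: "S \<subseteq> A" "T \<subseteq> B"
  shows "(\<Sum>u\<in>S. \<Sum>v\<in>T. F u v)\<^sup>2 \<le> real (card B) * (c * (\<Sum>u\<in>A. real (card {u' \<in> A. \<kappa> u = \<kappa> u'})))"
proof -
  have "(\<Sum>u\<in>S. \<Sum>v\<in>T. F u v)\<^sup>2 = (\<Sum>v\<in>T. \<Sum>u\<in>S. F u v)\<^sup>2"
    by (subst sum.swap) simp
  also have "\<dots> \<le> real (card T) * (\<Sum>v\<in>T. (\<Sum>u\<in>S. F u v)\<^sup>2)"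
    by (rule square_sum_le)
  also have "\<dots> \<le> real (card B) * (\<Sum>v\<in>B. (\<Sum>u\<in>S. F u v)\<^sup>2)"
    using fin ST by (intro mult_mono sum_mono2) (auto intro!: sum_nonneg card_mono)
  also have "(\<Sum>v\<in>B. (\<Sum>u\<in>S. F u v)\<^sup>2) = (\<Sum>u\<in>S. \<Sum>u'\<in>S. \<Sum>v\<in>B. F u v * F u' v)"
  proof -
    have "(\<Sum>v\<in>B. (\<Sum>u\<in>S. F u v)\<^sup>2) = (\<Sum>v\<in>B. \<Sum>u\<in>S. \<Sum>u'\<in>S. F u v * F u' v)"
      by (simp add: power2_eq_square sum_product)
    also have "\<dots> = (\<Sum>u\<in>S. \<Sum>v\<in>B. \<Sum>u'\<in>S. F u v * F u' v)" by (rule sum.swap)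
    also have "\<dots> = (\<Sum>u\<in>S. \<Sum>u'\<in>S. \<Sum>v\<in>B. F u v * F u' v)" by (intro sum.cong refl sum.swap)
    finally show ?thesis .
  qed
  also have "real (card B) * \<dots> \<le> real (card B) * (\<Sum>u\<in>S. \<Sum>u'\<in>S. if \<kappa> u = \<kappa> u' then c else 0)"
    by (intro mult_left_mono sum_mono orth) (use ST(1) in auto)
  also have "\<dots> \<le> real (card B) * (\<Sum>u\<in>A. \<Sum>u'\<in>A. if \<kappa> u = \<kappa> u' then c else 0)"
    using fin ST c
    by (intro mult_left_mono order.trans [OF sum_mono sum_mono2] sum_mono2) (auto intro!: sum_nonneg)
  also have "(\<Sum>u\<in>A. \<Sum>u'\<in>A. if \<kappa> u = \<kappa> u' then c else 0) = c * (\<Sum>u\<in>A. real (card {u' \<in> A. \<kappa> u = \<kappa> u'}))"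
    using fin by (simp add: sum_distrib_left mult.commute flip: sum.inter_filter)
  finally show ?thesis .
qed

text \<open>A vertex \<open>(x, a, b)\<close> carries a label \<open>x\<close>, an index \<open>a\<close> (used on the left side) and a function
  \<open>b\<close> from indices to levels (used on the right side). The pair of indices selects which level decides
  adjacency; distinct left indices see independent levels, so the graph has about the right weights.\<close>

definition blowup :: "nat \<Rightarrow> nat \<Rightarrow> (nat \<times> nat \<times> (nat \<Rightarrow> nat)) set" where
  "blowup s L = {..<lev s} \<times> {..<L} \<times> PiE {..<L} (\<lambda>_. {..<s})"

text \<open>The level is the value of the function of \<open>v\<close> at the index of
  \<open>u\<close>. Its average over these functions is \<open>h_sum / s\<close>, so fractional
  weights are realised by an explicit graph.\<close>

definition g_sel :: "nat \<times> nat \<times> (nat \<Rightarrow> nat) \<Rightarrow> nat \<times> nat \<times> (nat \<Rightarrow> nat) \<Rightarrow> real" where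
  "g_sel u v = g_lev (snd (snd v) (fst (snd u))) (fst u) (fst v)"

lemma finite_blowup [simp]: "finite (blowup s L)"
  by (auto simp: blowup_def intro!: finite_PiE)

lemma card_blowup: "card (blowup s L) = lev s * (L * s ^ L)"
  by (simp add: blowup_def card_cartesian_product card_PiE)

lemma fibre_fst: "x \<in> X \<Longrightarrow> {u \<in> X \<times> Y. fst u = x} = {x} \<times> Y"
  by auto

lemma fibre_fst_snd: "y \<in> Y \<Longrightarrow> {u \<in> X \<times> Y \<times> W. y = fst (snd u)} = X \<times> {y} \<times> W"
  by auto

lemma uniform_blowup: "uniform s (blowup s L) fst"
  unfolding uniform_def
proof (intro conjI ballI allI impI)
  show "fst u < lev s" if "u \<in> blowup s L" for u using that unfolding blowup_def mem_Times_iff by simp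
  fix x assume "x < lev s"
  then have "x \<in> {..<lev s}" by simp
  then have "card {u \<in> blowup s L. fst u = x} = L * s ^ L"
    by (simp only: blowup_def fibre_fst card_cartesian_product) (simp add: card_PiE)
  then show "card {u \<in> blowup s L. fst u = x} * lev s = card (blowup s L)"
    by (simp add: card_blowup)
qed simp

lemma card_same_index:
  assumes "a < L"
  shows "card {u \<in> blowup s L. a = fst (snd u)} * L = card (blowup s L)"
proof -
  have "a \<in> {..<L}" using assms by simp
  then have "card {u \<in> blowup s L. a = fst (snd u)} = lev s * s ^ L"
    by (simp only: blowup_def fibre_fst_snd card_cartesian_product) (simp add: card_PiE)
  then show ?thesis by (simp add: card_blowup)
qed

text \<open>Rows with different indices read different coordinates of the function of
  \<open>v\<close>, so their deviations from the average are orthogonal. Rows with the same index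
  form a \<open>1 / L\<close> fraction of all pairs and contribute at most \<open>4\<close> per
  column; the bound is the square root of \<open>4 * n ^ 4 / L\<close>.\<close>

lemma blowup_discrepancy:
  assumes s: "1 \<le> s" and L: "1 \<le> L" and ST: "S \<subseteq> blowup s L" "T \<subseteq> blowup s L"
  shows "\<bar>\<Sum>u\<in>S. \<Sum>v\<in>T. g_sel u v - h_sum s (fst u) (fst v) / real s\<bar>
    \<le> 2 * real (card (blowup s L)) ^ 2 / sqrt (real L)"
proof -
  define \<Omega> where "\<Omega> = blowup s L"
  define n where "n = real (card \<Omega>)"
  define F where "F u v = g_sel u v - h_sum s (fst u) (fst v) / real s" for u v
  have F2: "\<bar>F u v\<bar> \<le> 2" for u v
  proof -
    have "\<bar>h_sum s (fst u) (fst v) / real s\<bar> \<le> 1"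
      using s abs_h_sum_le [of s "fst u" "fst v"] by (simp add: divide_le_eq)
    moreover have "\<bar>g_sel u v\<bar> = 1" by (simp add: g_sel_def)
    ultimately show ?thesis unfolding F_def by linarith
  qed
  have orth: "(\<Sum>v\<in>\<Omega>. F u v * F u' v) \<le> (if fst (snd u) = fst (snd u') then 4 * n else 0)"
    if u: "u \<in> \<Omega>" "u' \<in> \<Omega>" for u u'
  proof (cases "fst (snd u) = fst (snd u')")
    case True
    have "F u v * F u' v \<le> 4" for v
    proof -
      have "\<bar>F u v\<bar> * \<bar>F u' v\<bar> \<le> 2 * 2" using F2 by (intro mult_mono) auto
      then show ?thesis using abs_ge_self [of "F u v * F u' v"] by (simp add: abs_mult)
    qed
    then have "(\<Sum>v\<in>\<Omega>. F u v * F u' v) \<le> (\<Sum>v\<in>\<Omega>. 4)" by (intro sum_mono)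
    then show ?thesis using True by (simp add: n_def)
  next
    case False
    have idx: "fst (snd u) \<in> {..<L}" "fst (snd u') \<in> {..<L}"
      using u unfolding \<Omega>_def blowup_def mem_Times_iff by simp_all
    define f where "f x y c = g_lev c x y - h_sum s x y / real s" for x y c
    have f0: "(\<Sum>c<s. f x y c) = 0" for x y
      using s by (simp add: f_def sum_subtractf h_sum_def)
    have "(\<Sum>v\<in>\<Omega>. F u v * F u' v)
        = (\<Sum>y<lev s. \<Sum>a<L. \<Sum>b\<in>PiE {..<L} (\<lambda>_. {..<s}). f (fst u) y (b (fst (snd u))) * f (fst u') y (b (fst (snd u'))))"
      unfolding \<Omega>_def blowup_def sum.cartesian_product
      by (simp only: split_def fst_conv snd_conv F_def g_sel_def f_def)
    also have "\<dots> = 0"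
      by (intro sum.neutral ballI sum_PiE_pairwise_orthogonal finite_lessThan idx False f0)
    finally show ?thesis using False by simp
  qed
  have "(\<Sum>u\<in>S. \<Sum>v\<in>T. F u v)\<^sup>2 \<le> n * (4 * n * (\<Sum>u\<in>\<Omega>. real (card {u' \<in> \<Omega>. fst (snd u) = fst (snd u')})))"
    unfolding n_def
    by (rule bilinear_discrepancy [OF _ _ orth [unfolded n_def] _ ST [folded \<Omega>_def]]) (simp_all add: \<Omega>_def)
  also have "(\<Sum>u\<in>\<Omega>. real (card {u' \<in> \<Omega>. fst (snd u) = fst (snd u')})) = (\<Sum>u\<in>\<Omega>. n / real L)"
  proof (rule sum.cong [OF refl])
    fix u assume "u \<in> \<Omega>"
    then have "fst (snd u) < L" unfolding \<Omega>_def blowup_def mem_Times_iff by simp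
    from card_same_index [OF this, of s]
    have "real (card {u' \<in> \<Omega>. fst (snd u) = fst (snd u')}) * real L = n"
      unfolding \<Omega>_def n_def of_nat_mult [symmetric] by (simp only:)
    then show "real (card {u' \<in> \<Omega>. fst (snd u) = fst (snd u')}) = n / real L" using L by (simp add: field_simps)
  qed
  also have "n * (4 * n * (\<Sum>u\<in>\<Omega>. n / real L)) = (2 * n ^ 2 / sqrt (real L))\<^sup>2"
    by (simp add: n_def power2_eq_square real_sqrt_mult_self)
  finally have "\<bar>\<Sum>u\<in>S. \<Sum>v\<in>T. F u v\<bar> \<le> \<bar>2 * n ^ 2 / sqrt (real L)\<bar>"
    by (simp only: abs_le_square_iff)
  then show ?thesis by (simp add: F_def n_def \<Omega>_def)
qed

section \<open>From regular triples to regular pairs\<close>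

lemma sum_edge_ind_bounds:
  assumes "finite X" "finite Y" "finite Z"
  shows "0 \<le> sum (edge_ind H) (X \<times> Y \<times> Z)"
    "sum (edge_ind H) (X \<times> Y \<times> Z) \<le> real (card X) * real (card Y) * real (card Z)"
proof -
  show "0 \<le> sum (edge_ind H) (X \<times> Y \<times> Z)" by (simp add: sum_nonneg edge_ind_bounds)
  have "sum (edge_ind H) (X \<times> Y \<times> Z) \<le> (\<Sum>t\<in>X \<times> Y \<times> Z. 1)" by (intro sum_mono edge_ind_bounds)
  then show "sum (edge_ind H) (X \<times> Y \<times> Z) \<le> real (card X) * real (card Y) * real (card Z)"
    by (simp add: card_cartesian_product)
qed

text \<open>Regularity as an additive error valid for all subboxes. If one side is too short for the
  definition to apply, the subbox has volume at most \<open>\<epsilon>\<close> times the whole; for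
  an irregular triple the full volume is a trivial bound.\<close>

lemma box_discrepancy:
  assumes \<epsilon>: "\<epsilon> > 0" and fin: "finite X" "finite Y" "finite Z" and sub: "X' \<subseteq> X" "Y' \<subseteq> Y" "Z' \<subseteq> Z"
  shows "\<bar>sum (edge_ind H) (X' \<times> Y' \<times> Z') - density H X Y Z * (real (card X') * real (card Y') * real (card Z'))\<bar>
    \<le> (if eps_regular_triple \<epsilon> H X Y Z then \<epsilon> else 1) * (real (card X) * real (card Y) * real (card Z))"
proof -
  define E where "E = sum (edge_ind H) (X' \<times> Y' \<times> Z')"
  define v' where "v' = real (card X') * real (card Y') * real (card Z')"
  define v where "v = real (card X) * real (card Y) * real (card Z)"
  define \<rho> where "\<rho> = density H X Y Z"
  note fin' = finite_subset [OF sub(1) fin(1)] finite_subset [OF sub(2) fin(2)] finite_subset [OF sub(3) fin(3)]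
  have le: "real (card X') \<le> real (card X)" "real (card Y') \<le> real (card Y)" "real (card Z') \<le> real (card Z)"
    using fin sub by (auto intro: card_mono)
  have E: "0 \<le> E" "E \<le> v'" unfolding E_def v'_def by (rule sum_edge_ind_bounds [OF fin'])+
  have "0 \<le> x / y \<and> x / y \<le> 1" if "0 \<le> x" "x \<le> y" for x y :: real
    using that by (auto simp: divide_le_eq_1)
  from this [OF sum_edge_ind_bounds [OF fin, of H]] have "0 \<le> \<rho> \<and> \<rho> \<le> 1"
    unfolding \<rho>_def density_def card_edges_eq_sum [OF fin] .
  then have \<rho>: "0 \<le> \<rho> * v'" "\<rho> * v' \<le> v'"
    by (auto simp: v'_def intro: mult_nonneg_nonneg mult_left_le_one_le)
  have triv: "\<bar>E - \<rho> * v'\<bar> \<le> v'" using E \<rho> by linarith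
  have v'v: "v' \<le> v" unfolding v_def v'_def using le by (intro mult_mono) auto
  show ?thesis
  proof (cases "eps_regular_triple \<epsilon> H X Y Z")
    case False
    then show ?thesis using triv v'v by (simp add: E_def \<rho>_def v_def v'_def)
  next
    case True
    have "\<bar>E - \<rho> * v'\<bar> \<le> \<epsilon> * v"
    proof (cases "real (card X') \<ge> \<epsilon> * real (card X) \<and> real (card Y') \<ge> \<epsilon> * real (card Y) \<and> real (card Z') \<ge> \<epsilon> * real (card Z)")
      case large: True
      then have "\<bar>\<rho> - density H X' Y' Z'\<bar> \<le> \<epsilon>"
        using True sub unfolding eps_regular_triple_def \<rho>_def by blast
      then have "\<bar>density H X' Y' Z' - \<rho>\<bar> * v' \<le> \<epsilon> * v'"
        by (intro mult_right_mono) (auto simp: v'_def abs_minus_commute)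
      moreover have "density H X' Y' Z' * v' = E"
      proof (cases "v' = 0")
        case True
        then show ?thesis using E by simp
      next
        case False
        then show ?thesis
          unfolding density_def card_edges_eq_sum [OF fin'] E_def [symmetric] v'_def [symmetric] by simp
      qed
      moreover have "\<bar>density H X' Y' Z' - \<rho>\<bar> * v' = \<bar>density H X' Y' Z' * v' - \<rho> * v'\<bar>"
        by (simp add: v'_def abs_mult flip: left_diff_distrib)
      moreover have "\<epsilon> * v' \<le> \<epsilon> * v" using v'v \<epsilon> by simp
      ultimately show ?thesis by simp
    next
      case small: False
      have "v' \<le> \<epsilon> * v"
      proof -
        consider "real (card X') \<le> \<epsilon> * real (card X)" | "real (card Y') \<le> \<epsilon> * real (card Y)"
          | "real (card Z') \<le> \<epsilon> * real (card Z)" using small by linarith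
        then show ?thesis
        proof cases
          case 1
          then have "v' \<le> (\<epsilon> * real (card X)) * real (card Y) * real (card Z)"
            unfolding v'_def using le \<epsilon> by (intro mult_mono) auto
          then show ?thesis by (simp add: v_def mult_ac)
        next
          case 2
          then have "v' \<le> real (card X) * (\<epsilon> * real (card Y)) * real (card Z)"
            unfolding v'_def using le \<epsilon> by (intro mult_mono) auto
          then show ?thesis by (simp add: v_def mult_ac)
        next
          case 3
          then have "v' \<le> real (card X) * real (card Y) * (\<epsilon> * real (card Z))"
            unfolding v'_def using le \<epsilon> by (intro mult_mono) auto
          then show ?thesis by (simp add: v_def mult_ac)
        qed
      qed
      then show ?thesis using triv by linarith
    qed
    then show ?thesis using True by (simp add: E_def \<rho>_def v_def v'_def)
  qed
qed

lemma sum_edge_ind_image: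
  fixes \<phi> \<psi> \<chi> :: "'a \<Rightarrow> 'v"
  assumes "inj_on \<phi> S" "inj_on \<psi> T" "inj_on \<chi> U"
    and "\<And>u v w. u \<in> S \<Longrightarrow> v \<in> T \<Longrightarrow> w \<in> U \<Longrightarrow> {\<phi> u, \<psi> v, \<chi> w} \<in> snd H \<longleftrightarrow> E u v"
  shows "sum (edge_ind H) (\<phi> ` S \<times> \<psi> ` T \<times> \<chi> ` U) = real (card U) * (\<Sum>u\<in>S. \<Sum>v\<in>T. of_bool (E u v))"
proof -
  have "sum (edge_ind H) (\<phi> ` S \<times> \<psi> ` T \<times> \<chi> ` U)
      = (\<Sum>x\<in>\<phi> ` S. \<Sum>y\<in>\<psi> ` T. \<Sum>z\<in>\<chi> ` U. edge_ind H (x, y, z))"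
    by (simp add: sum.cartesian_product')
  also have "\<dots> = (\<Sum>u\<in>S. \<Sum>v\<in>T. \<Sum>w\<in>U. edge_ind H (\<phi> u, \<psi> v, \<chi> w))"
    by (simp only: sum.reindex [OF assms(1)] sum.reindex [OF assms(2)] sum.reindex [OF assms(3)] o_def)
  also have "\<dots> = (\<Sum>u\<in>S. \<Sum>v\<in>T. \<Sum>w\<in>U. of_bool (E u v))"
    using assms(4) by (intro sum.cong refl) (simp add: edge_ind_def)
  finally show ?thesis by (simp add: sum_distrib_left)
qed

lemma family_on_preimages:
  assumes "is_partition P V" "finite P" "finite A" "\<phi> ` A \<subseteq> V"
  shows "family_on P (\<lambda>X. {u \<in> A. \<phi> u \<in> X}) A"
  unfolding family_on_def disjoint_family_on_def
proof (intro conjI ballI impI)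
  show "(\<Union>X\<in>P. {u \<in> A. \<phi> u \<in> X}) = A" using assms(1,4) unfolding is_partition_def by blast
  fix X Y assume "X \<in> P" "Y \<in> P" "X \<noteq> Y"
  then have "X \<inter> Y = {}" using assms(1) unfolding is_partition_def disjoint_def by blast
  then show "{u \<in> A. \<phi> u \<in> X} \<inter> {u \<in> A. \<phi> u \<in> Y} = {}" by blast
qed (use assms in auto)

text \<open>One \<open>\<epsilon>\<close> comes from the errors in regular boxes and one from the
  total volume of the irregular ones.\<close>

lemma sum_box_defects_le:
  fixes H :: "'a hgraph"
  assumes fin: "finite (fst H)" and reg: "eps_regular_partition \<epsilon> H P" and \<epsilon>: "\<epsilon> > 0"
  shows "(\<Sum>X\<in>P. \<Sum>Y\<in>P. \<Sum>Z\<in>P. (if eps_regular_triple \<epsilon> H X Y Z then \<epsilon> else 1)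
      * (real (card X) * real (card Y) * real (card Z))) \<le> 2 * \<epsilon> * real (card (fst H)) ^ 3"
proof -
  define V where "V = fst H"
  define N where "N = real (card V)"
  have P: "is_partition P V" using reg by (simp add: eps_regular_partition_def V_def)
  have finP: "finite P" using P fin unfolding is_partition_def V_def by (metis finite_UnionD)
  define c where "c = (\<lambda>(X, Y, Z). real (card (X :: 'a set)) * real (card (Y :: 'a set)) * real (card (Z :: 'a set)))"
  define good where "good = (\<lambda>(X, Y, Z). eps_regular_triple \<epsilon> H X Y Z)"
  define G where "G = {t \<in> P \<times> P \<times> P. good t}"
  have finG: "finite G" using finP by (simp add: G_def)
  have "family_on P (\<lambda>X. {u \<in> V. u \<in> X}) V"
    using family_on_preimages [OF P finP, of V "\<lambda>u. u"] fin by (simp add: V_def)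
  from family_on_card_sum [OF this] have "(\<Sum>X\<in>P. card {u \<in> V. u \<in> X}) = card V" .
  moreover have "(\<Sum>X\<in>P. card {u \<in> V. u \<in> X}) = (\<Sum>X\<in>P. card X)"
    using P unfolding is_partition_def by (intro sum.cong refl arg_cong [where f=card]) blast
  ultimately have sumP: "(\<Sum>X\<in>P. real (card X)) = N" by (simp add: N_def flip: of_nat_sum)
  have tot: "sum c (P \<times> P \<times> P) = N ^ 3"
  proof -
    have "sum c (P \<times> P \<times> P) = (\<Sum>X\<in>P. \<Sum>Y\<in>P. \<Sum>Z\<in>P. real (card X) * (real (card Y) * real (card Z)))"
      by (simp add: c_def sum.cartesian_product' mult.assoc)
    also have "\<dots> = N * (N * N)" by (simp only: sum_distrib_left [symmetric] sum_distrib_right [symmetric] sumP)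
    finally show ?thesis by (simp add: power3_eq_cube)
  qed
  define Rg where "Rg = {(x,y,z). x \<in> V \<and> y \<in> V \<and> z \<in> V \<and>
        (\<exists>X\<in>P. \<exists>Y\<in>P. \<exists>Z\<in>P. x \<in> X \<and> y \<in> Y \<and> z \<in> Z \<and> eps_regular_triple \<epsilon> H X Y Z)}"
  define bx where "bx = (\<lambda>(X :: 'a set, Y :: 'a set, Z :: 'a set). X \<times> Y \<times> Z)"
  have "Rg \<subseteq> (\<Union>t\<in>G. bx t)"
  proof
    fix t assume "t \<in> Rg"
    then obtain x y z X Y Z where "t = (x, y, z)" "(X, Y, Z) \<in> G" "x \<in> X" "y \<in> Y" "z \<in> Z"
      unfolding Rg_def G_def good_def by blast
    then show "t \<in> (\<Union>t\<in>G. bx t)" unfolding bx_def by blast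
  qed
  moreover have "finite (\<Union>t\<in>G. bx t)"
  proof -
    have "finite X" if "X \<in> P" for X using that P fin unfolding is_partition_def V_def by (auto intro: finite_subset)
    then show ?thesis using finG by (auto simp: G_def bx_def)
  qed
  ultimately have "card Rg \<le> card (\<Union>t\<in>G. bx t)" by (rule card_mono [rotated])
  also have "\<dots> \<le> (\<Sum>t\<in>G. card (bx t))" by (rule card_UN_le [OF finG])
  finally have "real (card Rg) \<le> (\<Sum>t\<in>G. real (card (bx t)))" by (simp flip: of_nat_sum)
  also have "\<dots> = sum c G" by (intro sum.cong refl) (auto simp: bx_def c_def card_cartesian_product)
  finally have "(1 - \<epsilon>) * N ^ 3 \<le> sum c G"
    using reg unfolding eps_regular_partition_def Rg_def N_def V_def by linarith
  moreover have "sum c G = (\<Sum>t\<in>P \<times> P \<times> P. of_bool (good t) * c t)"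
  proof -
    have "sum c G = (\<Sum>t\<in>P \<times> P \<times> P. if good t then c t else 0)"
      unfolding G_def using finP by (intro sum.inter_filter) simp
    also have "\<dots> = (\<Sum>t\<in>P \<times> P \<times> P. of_bool (good t) * c t)" by (intro sum.cong refl) simp
    finally show ?thesis .
  qed
  moreover have "(\<Sum>X\<in>P. \<Sum>Y\<in>P. \<Sum>Z\<in>P. (if eps_regular_triple \<epsilon> H X Y Z then \<epsilon> else 1)
      * (real (card X) * real (card Y) * real (card Z))) = (\<Sum>t\<in>P \<times> P \<times> P. (if good t then \<epsilon> else 1) * c t)"
    by (simp add: sum.cartesian_product' good_def c_def)
  moreover have "(\<Sum>t\<in>P \<times> P \<times> P. (if good t then \<epsilon> else 1) * c t)
      \<le> (\<Sum>t\<in>P \<times> P \<times> P. \<epsilon> * c t + c t - of_bool (good t) * c t)"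
    using \<epsilon> by (intro sum_mono) (auto simp: c_def)
  moreover have "(\<Sum>t\<in>P \<times> P \<times> P. \<epsilon> * c t + c t - of_bool (good t) * c t)
      = \<epsilon> * N ^ 3 + N ^ 3 - (\<Sum>t\<in>P \<times> P \<times> P. of_bool (good t) * c t)"
    by (simp only: sum_subtractf sum.distrib sum_distrib_left [symmetric] tot)
  ultimately show ?thesis unfolding N_def V_def by (simp add: algebra_simps)
qed

text \<open>Summing the regularity defect over the third coordinate, on which adjacency does not depend,
  turns a regular partition of the 3-graph into one of the bipartite graph \<open>E\<close>.\<close>

lemma bipartite_defects:
  fixes H :: "'v hgraph" and \<phi> \<psi> \<chi> :: "'a \<Rightarrow> 'v"
  assumes \<epsilon>: "\<epsilon> > 0" and fin: "finite (fst H)" and reg: "eps_regular_partition \<epsilon> H P"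
    and \<Omega>: "finite \<Omega>" "0 < card \<Omega>" and inj: "inj_on \<phi> \<Omega>" "inj_on \<psi> \<Omega>" "inj_on \<chi> \<Omega>"
    and im: "\<chi> ` \<Omega> \<subseteq> fst H" and cV: "card (fst H) = 3 * card \<Omega>"
    and edge: "\<And>u v w. u \<in> \<Omega> \<Longrightarrow> v \<in> \<Omega> \<Longrightarrow> w \<in> \<Omega> \<Longrightarrow> {\<phi> u, \<psi> v, \<chi> w} \<in> snd H \<longleftrightarrow> E u v"
  obtains d D where
    "\<And>X Y S T. X \<in> P \<Longrightarrow> Y \<in> P \<Longrightarrow> S \<subseteq> {u \<in> \<Omega>. \<phi> u \<in> X} \<Longrightarrow> T \<subseteq> {v \<in> \<Omega>. \<psi> v \<in> Y} \<Longrightarrow>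
       \<bar>(\<Sum>u\<in>S. \<Sum>v\<in>T. of_bool (E u v)) - d X Y * real (card S) * real (card T)\<bar> \<le> D X Y"
    "(\<Sum>X\<in>P. \<Sum>Y\<in>P. D X Y) \<le> 54 * \<epsilon> * real (card \<Omega>) ^ 2"
proof -
  define n where "n = real (card \<Omega>)"
  have n: "0 < n" using \<Omega> by (simp add: n_def)
  have P: "is_partition P (fst H)" using reg by (simp add: eps_regular_partition_def)
  have finP: "finite P" using P fin unfolding is_partition_def by (metis finite_UnionD)
  have finX: "finite X" if "X \<in> P" for X
    using that P fin unfolding is_partition_def by (auto intro: finite_subset)
  define U where "U Z = {w \<in> \<Omega>. \<chi> w \<in> Z}" for Z
  define D3 where "D3 X Y Z = (if eps_regular_triple \<epsilon> H X Y Z then \<epsilon> else 1)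
      * (real (card X) * real (card Y) * real (card Z))" for X Y Z
  define d where "d X Y = (\<Sum>Z\<in>P. density H X Y Z * real (card (U Z))) / n" for X Y
  define D where "D X Y = (\<Sum>Z\<in>P. D3 X Y Z) / n" for X Y
  have sumU: "(\<Sum>Z\<in>P. real (card (U Z))) = n"
    using family_on_card_sum [OF family_on_preimages [OF P finP \<Omega>(1) im]] by (simp add: U_def n_def flip: of_nat_sum)
  show ?thesis
  proof (rule that [of d D])
    fix X Y S T
    assume XY: "X \<in> P" "Y \<in> P" and S: "S \<subseteq> {u \<in> \<Omega>. \<phi> u \<in> X}" and T: "T \<subseteq> {v \<in> \<Omega>. \<psi> v \<in> Y}"
    define e :: real where "e = (\<Sum>u\<in>S. \<Sum>v\<in>T. of_bool (E u v))"
    have sub: "S \<subseteq> \<Omega>" "T \<subseteq> \<Omega>" "\<phi> ` S \<subseteq> X" "\<psi> ` T \<subseteq> Y" using S T by auto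
    have inj': "inj_on \<phi> S" "inj_on \<psi> T" using inj sub by (auto intro: inj_on_subset)
    have each: "\<bar>real (card (U Z)) * e - density H X Y Z * real (card (U Z)) * (real (card S) * real (card T))\<bar> \<le> D3 X Y Z"
      if Z: "Z \<in> P" for Z
    proof -
      have UZ: "U Z \<subseteq> \<Omega>" "\<chi> ` U Z \<subseteq> Z" by (auto simp: U_def)
      have injU: "inj_on \<chi> (U Z)" using inj(3) UZ(1) by (rule inj_on_subset)
      have "sum (edge_ind H) (\<phi> ` S \<times> \<psi> ` T \<times> \<chi> ` U Z) = real (card (U Z)) * e"
        unfolding e_def using edge sub(1,2) UZ(1) by (intro sum_edge_ind_image inj' injU) blast
      with box_discrepancy [OF \<epsilon> finX [OF XY(1)] finX [OF XY(2)] finX [OF Z] sub(3,4) UZ(2), of H]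
      show ?thesis
        by (simp add: card_image inj' injU D3_def mult_ac)
    qed
    have "n * e - n * d X Y * (real (card S) * real (card T))
        = (\<Sum>Z\<in>P. real (card (U Z)) * e - density H X Y Z * real (card (U Z)) * (real (card S) * real (card T)))"
      using n by (simp only: sum_subtractf sum_distrib_right [symmetric] sumU) (simp add: d_def)
    then have "\<bar>n * e - n * d X Y * (real (card S) * real (card T))\<bar> \<le> (\<Sum>Z\<in>P. D3 X Y Z)"
      using each by (simp only:) (intro order.trans [OF sum_abs sum_mono])
    also have "\<dots> = n * D X Y" using n by (simp add: D_def)
    also have "n * e - n * d X Y * (real (card S) * real (card T)) = n * (e - d X Y * real (card S) * real (card T))"
      by (simp add: algebra_simps)
    finally have "n * \<bar>e - d X Y * real (card S) * real (card T)\<bar> \<le> n * D X Y"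
      using n by (simp add: abs_mult)
    then show "\<bar>(\<Sum>u\<in>S. \<Sum>v\<in>T. of_bool (E u v)) - d X Y * real (card S) * real (card T)\<bar> \<le> D X Y"
      using n by (simp add: e_def)
  next
    have "n * (\<Sum>X\<in>P. \<Sum>Y\<in>P. D X Y) = (\<Sum>X\<in>P. \<Sum>Y\<in>P. \<Sum>Z\<in>P. D3 X Y Z)"
      using n by (simp add: D_def flip: sum_divide_distrib)
    also have "\<dots> \<le> 2 * \<epsilon> * real (card (fst H)) ^ 3"
      unfolding D3_def by (rule sum_box_defects_le [OF fin reg \<epsilon>])
    \<comment> \<open>\<open>54 = 2 * 3 ^ 3\<close>, as the 3-graph has \<open>3 * n\<close>
      vertices.\<close>
    also have "\<dots> = n * (54 * \<epsilon> * n ^ 2)"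
      by (simp add: cV n_def power2_eq_square power3_eq_cube)
    finally show "(\<Sum>X\<in>P. \<Sum>Y\<in>P. D X Y) \<le> 54 * \<epsilon> * real (card \<Omega>) ^ 2"
      using n by (simp add: n_def)
  qed
qed

text \<open>\<open>M\<close> and \<open>N\<close> are fixed before \<open>L\<close>. Hence
  \<open>L\<close> can be so large that the 3-graph has at least \<open>N\<close> vertices and that
  the blow-up discrepancy, paid once for each of at most \<open>M ^ 2\<close> pairs of parts, is at
  most \<open>\<epsilon> * n ^ 2\<close> in total.\<close>

lemma regular_partitions_large:
  assumes hered: "hereditary \<H>"
    and trip: "\<And>k. k \<ge> 1 \<Longrightarrow> in_Trip_class \<H> (tensor k (U_graph k))"
    and \<epsilon>: "\<epsilon> > 0" and s: "1 \<le> s" and small: "225280 * real s ^ 3 * \<epsilon> \<le> 1"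
    and M: "\<forall>H\<in>\<H>. card (fst H) \<ge> N \<longrightarrow> (\<exists>P. eps_regular_partition \<epsilon> H P \<and> card P \<le> M)"
  shows "lev s \<le> 2 * M"
proof -
  define L where "L = max (max 1 N) (nat \<lceil>(2 * real M ^ 2 / \<epsilon>) ^ 2\<rceil>)"
  have L: "1 \<le> L" "N \<le> L" "(2 * real M ^ 2 / \<epsilon>) ^ 2 \<le> real L" unfolding L_def by (auto, linarith)
  have "2 * real M ^ 2 / \<epsilon> \<le> sqrt (real L)" using L(3) by (rule real_le_rsqrt)
  then have sqL: "real M ^ 2 * (2 / sqrt (real L)) \<le> \<epsilon>" using \<epsilon> L(1) by (simp add: field_simps)
  define \<Omega> where "\<Omega> = blowup s L"
  define n where "n = card \<Omega>"
  have "1 * L \<le> lev s * (L * s ^ L)" using s by (intro mult_le_mono) auto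
  then have nL: "L \<le> n" by (simp add: n_def \<Omega>_def card_blowup)
  have n0: "0 < n" using nL L(1) by simp
  have fin\<Omega>: "finite \<Omega>" by (simp add: \<Omega>_def)
  obtain H \<phi> \<psi> \<chi> where H: "H \<in> \<H>" and inj: "inj_on \<phi> \<Omega>" "inj_on \<psi> \<Omega>" "inj_on \<chi> \<Omega>"
    and dis: "\<phi> ` \<Omega> \<inter> \<psi> ` \<Omega> = {}" "\<phi> ` \<Omega> \<inter> \<chi> ` \<Omega> = {}" "\<psi> ` \<Omega> \<inter> \<chi> ` \<Omega> = {}"
    and V: "fst H = \<phi> ` \<Omega> \<union> \<psi> ` \<Omega> \<union> \<chi> ` \<Omega>"
    and edge: "\<And>u v w. u \<in> \<Omega> \<Longrightarrow> v \<in> \<Omega> \<Longrightarrow> w \<in> \<Omega> \<Longrightarrow> {\<phi> u, \<psi> v, \<chi> w} \<in> snd H \<longleftrightarrow> g_sel u v = 1"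
    using hereditary_contains_tripartite [OF hered trip fin\<Omega> fin\<Omega> fin\<Omega>, of "\<lambda>u v. g_sel u v = 1"] by blast
  have "(\<phi> ` \<Omega> \<union> \<psi> ` \<Omega>) \<inter> \<chi> ` \<Omega> = {}" using dis by blast
  then have cV: "card (fst H) = 3 * n"
    unfolding V using dis(1) fin\<Omega> inj by (simp add: card_Un_disjoint card_image n_def)
  have finV: "finite (fst H)" unfolding V using fin\<Omega> by simp
  have "N \<le> card (fst H)" using cV nL L(2) by simp
  then obtain P where P: "eps_regular_partition \<epsilon> H P" "card P \<le> M" using M H by blast
  have part: "is_partition P (fst H)" using P(1) by (simp add: eps_regular_partition_def)
  have finP: "finite P" using part finV unfolding is_partition_def by (metis finite_UnionD)
  have im: "\<phi> ` \<Omega> \<subseteq> fst H" "\<psi> ` \<Omega> \<subseteq> fst H" "\<chi> ` \<Omega> \<subseteq> fst H" using V by auto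
  have c\<Omega>: "0 < card \<Omega>" "card (fst H) = 3 * card \<Omega>" using n0 cV by (simp_all add: n_def)
  obtain d D where dD: "\<And>X Y S T. X \<in> P \<Longrightarrow> Y \<in> P \<Longrightarrow> S \<subseteq> {u \<in> \<Omega>. \<phi> u \<in> X} \<Longrightarrow> T \<subseteq> {v \<in> \<Omega>. \<psi> v \<in> Y} \<Longrightarrow>
       \<bar>(\<Sum>u\<in>S. \<Sum>v\<in>T. of_bool (g_sel u v = 1)) - d X Y * real (card S) * real (card T)\<bar> \<le> D X Y"
    "(\<Sum>X\<in>P. \<Sum>Y\<in>P. D X Y) \<le> 54 * \<epsilon> * real (card \<Omega>) ^ 2"
    by (rule bipartite_defects [OF \<epsilon> finV P(1) fin\<Omega> c\<Omega>(1) inj im(3) c\<Omega>(2), where E = "\<lambda>u v. g_sel u v = 1"])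
       (rule edge, assumption+, rule that, assumption+)
  define \<tau> where "\<tau> = 2 * real n ^ 2 / sqrt (real L)"
  \<comment> \<open>The affine map turns edge densities into averages of the sign
    \<open>g_sel\<close>, and the factor \<open>s\<close> turns these into averages of
    \<open>h_sum\<close>.\<close>
  define d' where "d' X Y = real s * (2 * d X Y - 1)" for X Y
  define D' where "D' X Y = real s * (2 * D X Y + \<tau>)" for X Y
  have reg: "\<bar>(\<Sum>u\<in>S. \<Sum>v\<in>T. h_sum s (fst u) (fst v)) - d' X Y * real (card S) * real (card T)\<bar> \<le> D' X Y"
    if XY: "X \<in> P" "Y \<in> P" and S: "S \<subseteq> {u \<in> \<Omega>. \<phi> u \<in> X}" and T: "T \<subseteq> {v \<in> \<Omega>. \<psi> v \<in> Y}" for X Y S T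
  proof -
    define e :: real where "e = (\<Sum>u\<in>S. \<Sum>v\<in>T. of_bool (g_sel u v = 1))"
    define a where "a = (\<Sum>u\<in>S. \<Sum>v\<in>T. h_sum s (fst u) (fst v) / real s)"
    have "g_sel u v = 2 * of_bool (g_sel u v = 1) - 1" for u v
      by (auto simp: g_sel_def g_lev_def sgn_bit_def)
    then have "(\<Sum>u\<in>S. \<Sum>v\<in>T. g_sel u v) = (\<Sum>u\<in>S. \<Sum>v\<in>T. 2 * of_bool (g_sel u v = 1) - 1)"
      by (intro sum.cong refl)
    also have "\<dots> = 2 * e - real (card S) * real (card T)"
      by (simp add: sum_subtractf e_def sum_distrib_left)
    finally have g: "(\<Sum>u\<in>S. \<Sum>v\<in>T. g_sel u v) = 2 * e - real (card S) * real (card T)" .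
    have ST: "S \<subseteq> blowup s L" "T \<subseteq> blowup s L" using S T by (auto simp: \<Omega>_def)
    have "\<bar>(2 * e - real (card S) * real (card T)) - a\<bar> \<le> \<tau>"
      using blowup_discrepancy [OF s L(1) ST] unfolding sum_subtractf g a_def \<tau>_def n_def \<Omega>_def .
    moreover have "\<bar>e - d X Y * real (card S) * real (card T)\<bar> \<le> D X Y"
      unfolding e_def by (rule dD(1) [OF XY S T])
    moreover have "\<bar>y\<bar> \<le> 2 * D X Y + \<tau>" if "\<bar>q\<bar> \<le> \<tau>" "\<bar>p\<bar> \<le> D X Y" "y = 2 * p - q" for y p q
      using that by linarith
    moreover have "a - (2 * d X Y - 1) * real (card S) * real (card T)
        = 2 * (e - d X Y * real (card S) * real (card T)) - ((2 * e - real (card S) * real (card T)) - a)"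
      by (simp add: algebra_simps)
    ultimately have "\<bar>a - (2 * d X Y - 1) * real (card S) * real (card T)\<bar> \<le> 2 * D X Y + \<tau>" by blast
    then have "real s * \<bar>a - (2 * d X Y - 1) * real (card S) * real (card T)\<bar> \<le> D' X Y"
      unfolding D'_def by (intro mult_left_mono) auto
    moreover have "(\<Sum>u\<in>S. \<Sum>v\<in>T. h_sum s (fst u) (fst v)) = real s * a"
      using s by (simp add: a_def sum_distrib_left)
    moreover have "real s * a - d' X Y * real (card S) * real (card T)
        = real s * (a - (2 * d X Y - 1) * real (card S) * real (card T))"
      by (simp add: d'_def algebra_simps)
    ultimately show ?thesis by (simp add: abs_mult)
  qed
  \<comment> \<open>\<open>109 = 2 * 54 + 1\<close>, the last unit being the blow-up discrepancy;
    \<open>2048 * 109 = 223232\<close> stays below the constant in \<open>small\<close>.\<close>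
  define \<delta> where "\<delta> = 109 * real s * \<epsilon> * real n"
  have "(\<Sum>X\<in>P. \<Sum>Y\<in>P. D' X Y) = real s * (2 * (\<Sum>X\<in>P. \<Sum>Y\<in>P. D X Y) + real (card P) ^ 2 * \<tau>)"
    by (simp add: D'_def sum.distrib sum_distrib_left distrib_left power2_eq_square mult_ac)
  also have "\<dots> \<le> real s * (2 * (54 * \<epsilon> * real n ^ 2) + \<epsilon> * real n ^ 2)"
  proof (intro mult_left_mono add_mono)
    have "real (card P) ^ 2 * \<tau> \<le> real M ^ 2 * \<tau>"
      using P(2) by (intro mult_right_mono power_mono) (auto simp: \<tau>_def)
    also have "\<dots> = (real M ^ 2 * (2 / sqrt (real L))) * real n ^ 2" by (simp add: \<tau>_def)
    also have "\<dots> \<le> \<epsilon> * real n ^ 2" by (intro mult_right_mono sqL) auto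
    finally show "real (card P) ^ 2 * \<tau> \<le> \<epsilon> * real n ^ 2" .
  qed (use dD(2) in \<open>auto simp: n_def\<close>)
  also have "\<dots> = \<delta> * real n" by (simp add: \<delta>_def power2_eq_square algebra_simps)
  finally have Dsum: "(\<Sum>X\<in>P. \<Sum>Y\<in>P. D' X Y) \<le> \<delta> * real n" .
  have "2048 * real s ^ 2 * \<delta> = (223232 * (real s ^ 3 * \<epsilon>)) * real n"
    by (simp add: \<delta>_def power2_eq_square power3_eq_cube)
  also have "\<dots> \<le> 1 * real n" using small \<epsilon> by (intro mult_right_mono) auto
  finally have small': "2048 * real s ^ 2 * \<delta> \<le> real n" by simp
  have "lev s \<le> 2 * card P"
  proof (rule many_parts [where la = fst and lb = fst and d = d' and D = D'])
    show "uniform s \<Omega> fst" "uniform s \<Omega> fst" unfolding \<Omega>_def by (rule uniform_blowup)+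
    show "family_on P (\<lambda>X. {u \<in> \<Omega>. \<phi> u \<in> X}) \<Omega>" "family_on P (\<lambda>X. {u \<in> \<Omega>. \<psi> u \<in> X}) \<Omega>"
      using family_on_preimages [OF part finP fin\<Omega>] im by blast+
    show "0 \<le> \<delta>" using \<epsilon> by (simp add: \<delta>_def)
  qed (fact reg Dsum small' s n0 n_def [symmetric])+
  then show ?thesis using P(2) by simp
qed

section \<open>Comparison with the tower function and choice of exponents\<close>

lemma Tw_Suc_le: "Tw (Suc n) \<le> 2 ^ Tw n"
  by (cases n) auto

text \<open>Levels \<open>0\<close> to \<open>3\<close> have \<open>1, 2, 4, 8\<close> cells; only
  from length \<open>8\<close> on does the code size exceed \<open>2\<close>. The factor
  \<open>8\<close> compensates for the division in \<open>code_size\<close> during the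
  induction.\<close>

lemma lev_ge_Tw: "8 * Tw r \<le> lev (r + 3)"
proof (induction r)
  case 0
  show ?case by (simp add: numeral_3_eq_3 code_size_def)
next
  case (Suc r)
  define l where "l = lev (r + 3)"
  have "1 \<le> Tw r" by (rule Tw_pos)
  then have l: "8 \<le> l" "Tw r \<le> l div 8" using Suc unfolding l_def by linarith+
  have "8 * Tw (Suc r) \<le> 8 * 2 ^ Tw r" using Tw_Suc_le by simp
  also have "\<dots> \<le> l * 2 ^ (l div 8 + 1)" using l by (intro mult_le_mono power_increasing) auto
  also have "\<dots> = lev (Suc (r + 3))" by (simp only: l_def code_size_def lev.simps mult.commute)
  also have "Suc (r + 3) = Suc r + 3" by simp
  finally show ?case .
qed

theorem theorem5p4:
  fixes \<H> :: "nat hgraph set"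
  assumes "hereditary \<H>"
    and "\<And>k. k \<ge> 1 \<Longrightarrow> in_Trip_class \<H> (tensor k (U_graph k))"
  shows "\<exists>K K'. K > 0 \<and> K' > 0 \<and> (\<exists>\<epsilon>0>0. \<forall>\<epsilon>::real. 0 < \<epsilon> \<and> \<epsilon> < \<epsilon>0 \<longrightarrow>
           Tw (nat \<lceil>\<epsilon> powr (-K)\<rceil>) \<le> M_reg \<H> \<epsilon> \<and>
           M_reg \<H> \<epsilon> \<le> Tw (nat \<lceil>\<epsilon> powr (-K')\<rceil>))"
proof -
  \<comment> \<open>The lower bound needs \<open>t = \<epsilon> powr (-(1/4))\<close> to be at least
    \<open>8 * 225280 = 1802240\<close>; this choice gives \<open>2000000 \<le> t\<close>.\<close>
  define \<epsilon>0 :: real where "\<epsilon>0 = 1 / 2000000 ^ 4"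
  have "Tw (nat \<lceil>\<epsilon> powr (-(1/4))\<rceil>) \<le> M_reg \<H> \<epsilon> \<and> M_reg \<H> \<epsilon> \<le> Tw (nat \<lceil>\<epsilon> powr (-7)\<rceil>)"
    if \<epsilon>: "0 < \<epsilon>" "\<epsilon> < \<epsilon>0" for \<epsilon> :: real
  proof -
    define x where "x = 1 / \<epsilon>"
    have "2000000 ^ 4 < x" using \<epsilon> unfolding x_def \<epsilon>0_def by (simp add: field_simps)
    then have x: "16 \<le> x" "2000000 ^ 4 \<le> x" by simp_all
    \<comment> \<open>About \<open>\<epsilon> powr (-6)\<close> refinements at five tower levels
      each; the exponent \<open>7\<close> absorbs the constants once
      \<open>16 \<le> 1 / \<epsilon>\<close>.\<close>
    define n where "n = nat \<lceil>x ^ 6\<rceil> + 1"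
    have x6: "1 \<le> x ^ 6" using x by (intro one_le_power) simp
    have n: "x ^ 6 < real n" "real n \<le> x ^ 6 + 2" unfolding n_def using x6 by linarith+
    have "x ^ 6 * \<epsilon> ^ 6 = 1" using \<epsilon> by (simp add: x_def power_one_over)
    moreover have "x ^ 6 * \<epsilon> ^ 6 < real n * \<epsilon> ^ 6" using n(1) \<epsilon> by (intro mult_strict_right_mono) auto
    ultimately have n\<epsilon>: "1 < real n * \<epsilon> ^ 6" by simp
    have ex: "\<exists>P. eps_regular_partition \<epsilon> H P \<and> card P \<le> Tw (Suc (5 * n))" if "H \<in> \<H>" for H
    proof -
      have "finite (fst H)" using assms(1) that by (simp add: hereditary_def is_3graph_def)
      from regular_partition_exists [OF this \<epsilon>(1) n\<epsilon>] show ?thesis .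
    qed
    define Q where "Q M \<longleftrightarrow> (\<exists>N. \<forall>H\<in>\<H>. card (fst H) \<ge> N \<longrightarrow> (\<exists>P. eps_regular_partition \<epsilon> H P \<and> card P \<le> M))" for M
    have M_reg: "M_reg \<H> \<epsilon> = (LEAST M. Q M)" by (simp add: M_reg_def Q_def)
    have QTw: "Q (Tw (Suc (5 * n)))" unfolding Q_def using ex by blast
    have "M_reg \<H> \<epsilon> \<le> Tw (Suc (5 * n))" unfolding M_reg using QTw by (rule Least_le)
    also have "\<dots> \<le> Tw (nat \<lceil>\<epsilon> powr (-7)\<rceil>)"
    proof (rule Tw_mono)
      have "real (Suc (5 * n)) \<le> 16 * x ^ 6" using n(2) x6 by simp
      also have "\<dots> \<le> x * x ^ 6" using x by (intro mult_right_mono) auto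
      also have "\<dots> = x ^ 7" by (simp add: power_numeral_reduce)
      also have "\<dots> = \<epsilon> powr (-7)"
        using \<epsilon> by (simp add: x_def powr_minus power_one_over inverse_eq_divide)
      finally show "Suc (5 * n) \<le> nat \<lceil>\<epsilon> powr (-7)\<rceil>" by linarith
    qed
    finally have upper: "M_reg \<H> \<epsilon> \<le> Tw (nat \<lceil>\<epsilon> powr (-7)\<rceil>)" .
    define t where "t = \<epsilon> powr (-(1/4))"
    \<comment> \<open>The shift by \<open>3\<close> is the one in \<open>lev_ge_Tw\<close>, and
      \<open>s \<le> 2 * t\<close> is the source of the factor \<open>8\<close> in
      \<open>1802240\<close>.\<close>
    define s where "s = nat \<lceil>t\<rceil> + 3"
    have t0: "0 < t" using \<epsilon> by (simp add: t_def)
    have "t ^ 4 = \<epsilon> powr (-1)" using \<epsilon> by (simp add: t_def powr_power)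
    then have t4: "t ^ 4 = x" using \<epsilon> by (simp add: x_def powr_minus inverse_eq_divide)
    have t: "2000000 \<le> t"
      by (rule power_le_imp_le_base [of _ 3]) (use t4 x(2) t0 in \<open>simp_all\<close>)
    have st: "real s \<le> 2 * t" unfolding s_def using t by linarith
    have "real s ^ 3 \<le> (2 * t) ^ 3" using st by (intro power_mono) auto
    then have "225280 * real s ^ 3 * \<epsilon> \<le> 225280 * (2 * t) ^ 3 * \<epsilon>" using \<epsilon> by simp
    also have "\<dots> = (1802240 / t) * (t ^ 4 * \<epsilon>)" using t0 by (simp add: power_numeral_reduce field_simps)
    also have "t ^ 4 * \<epsilon> = 1" using t4 \<epsilon> by (simp add: x_def)
    also have "(1802240 / t) * 1 \<le> 1" using t by simp
    finally have small: "225280 * real s ^ 3 * \<epsilon> \<le> 1" .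
    \<comment> \<open>The least value is attained because the upper bound provides some
      \<open>M\<close> with \<open>Q M\<close>.\<close>
    have "Q (M_reg \<H> \<epsilon>)" unfolding M_reg using QTw by (rule LeastI)
    then obtain N where "\<forall>H\<in>\<H>. card (fst H) \<ge> N \<longrightarrow> (\<exists>P. eps_regular_partition \<epsilon> H P \<and> card P \<le> M_reg \<H> \<epsilon>)"
      unfolding Q_def by blast
    from regular_partitions_large [OF assms \<epsilon>(1) _ small this] have "lev s \<le> 2 * M_reg \<H> \<epsilon>"
      by (simp add: s_def)
    moreover have "8 * Tw (nat \<lceil>t\<rceil>) \<le> lev s" unfolding s_def by (rule lev_ge_Tw)
    ultimately have "Tw (nat \<lceil>t\<rceil>) \<le> M_reg \<H> \<epsilon>" by linarith
    then show ?thesis using upper unfolding t_def by blast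
  qed
  then show ?thesis
    by (intro exI [of _ "1/4"] exI [of _ 7] conjI exI [of _ \<epsilon>0]) (auto simp: \<epsilon>0_def)
qed

end
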